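(* Let $t$ be an injective-reachable quantum seed and let $\mathrm{A}(t)$ be a $\Bbbk$-subalgebra of the upper quantum cluster algebra $\mathcal{U}_q(t)$. Assume that $\mathrm{A}(t)$ possesses the common triangular basis $\mathbf{L}$. Then: (1) For any seed $t'\in\Delta^+$, $\mu_{t,t'}^*\mathbf{L}$ is the double triangular basis of $\mathrm{A}(t')=\mu_{t,t'}^*\mathrm{A}(t)$ with respect to $t'$. (2) $\mathbf{L}$ is compatibly copointed at $\Delta^+$.
   Context: **Quantum seeds.** Let $v=q^{1/2}$ be a formal parameter, $\Bbbk=\mathbb{Z}[v^{\pm1}]$, $\mathbf{m}=v^{-1}\mathbb{Z}[v^{-1}]$, $[a]_+=\max(a,0)$ (componentwise on vectors). Fix a finite set $I=I_{\mathrm{uf}}\sqcup I_{\mathrm{f}}$ (unfrozen and frozen vertices). A quantum seed $t=(\widetilde B(t),\Lambda(t),(X_i(t))_{i\in I})$ consists of an integer matrix $\widetilde B(t)=(b_{ij}(t))_{i\in I,j\in I_{\mathrm{uf}}}$, a skew-symmetric integer matrix $\Lambda(t)=(\Lambda_{ij}(t))_{i,j\in I}$ and indeterminates $X_i(t)$, such that $(\widetilde B(t)^T\Lambda(t))_{kj}=\delta_{kj}d_k$ for $k\in I_{\mathrm{uf}},j\in I$, for some positive integers $d_k$. Put $M^\circ(t)=\mathbb{Z}^I$ with unit vectors $f_i(t)$, $N_{\mathrm{uf}}(t)=\mathbb{Z}^{I_{\mathrm{uf}}}$, $N_{\mathrm{uf}}^{\ge0}(t)=\mathbb{N}^{I_{\mathrm{uf}}}$,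 $p^*n=\widetilde B(t)n$ for $n\in N_{\mathrm{uf}}(t)$, and $\lambda(g,g')=g^T\Lambda(t)g'$. Let $\mathcal{LP}(t)$ be the free $\Bbbk$-module with basis $X(t)^m$, $m\in M^\circ(t)$, where $X(t)^{f_i(t)}=X_i(t)$; it has the commutative product $X^m\cdot X^{m'}=X^{m+m'}$ and the twisted product $X^m*X^{m'}=v^{\lambda(m,m')}X^{m+m'}$. Its algebra structure is $(+,* )$ unless otherwise specified; $\mathcal F(t)$ is its skew field of fractions. The bar involution is $v\mapsto v^{-1}$, $X(t)^m\mapsto X(t)^m$. **Mutations.** For $k\in I_{\mathrm{uf}}$, $t'=\mu_kt$ has $b'_{ij}=-b_{ij}$ if $k\in\{i,j\}$ and $b'_{ij}=b_{ij}+[b_{ik}]_+[b_{kj}]_+-[-b_{ik}]_+[-b_{kj}]_+$ otherwise; $\Lambda'$ is skew-symmetric with $\Lambda'_{ij}=\Lambda_{ij}$ for $i,j\ne k$ and $\Lambda'_{kj}=\lambda(-f_k+\sum_i[-b_{ik}]_+f_i,f_j)$ for $j\neq k$. There is an isomorphism $\mu_k^*:\mathcal F(t')\to\mathcal F(t)$ with $\mu_k^*X_i(t')=X_i(t)$ for $i\ne k$ and $\mu_k^*X_k(t')=X(t)^{-f_k+\sum_j[-b_{jk}]_+f_j}+X(t)^{-f_k+\sum_i[b_{ik}]_+f_i}$. $\Delta^+$ denotes the set of all seeds obtained from $t$ by iterated mutations. For $t,t'\in\Delta^+$, composing along a mutation sequence from $t$ to $t'$ gives $\mu_{t',t}^*:\mathcal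 F(t')\to\mathcal F(t)$, independent of the sequence. Upper quantum cluster algebra: $\mathcal U_q(t)=\bigcap_{t'\in\Delta^+}\mu_{t',t}^*\mathcal{LP}(t')$. Quantum cluster monomials in $t'$ are the elements $\mu_{t',t}^*X(t')^m$, $m\in\mathbb{N}^I$. **(Co)degrees.** For $g,g'\in M^\circ(t)$, $g'\preceq_tg$ iff $g'=g+p^*n$ for some $n\in N_{\mathrm{uf}}^{\ge0}(t)$. An element $Z=\sum b_mX(t)^m\in\mathcal{LP}(t)$ has degree $g=\deg^tZ$ (resp. codegree $\eta=\operatorname{codeg}^tZ$) if $g$ is the unique $\prec_t$-maximal (resp. $\eta$ the unique $\prec_t$-minimal) element of $\{m\mid b_m\ne0\}$; it is $g$-pointed if moreover $b_g=1$ (resp. $\eta$-copointed if moreover $b_\eta=1$). Normalizations: $[Z]^t:=b_g^{-1}Z$ and $\{Z\}^t:=b_\eta^{-1}Z$. **Tropical transformations.** For $t'=\mu_kt$, $\phi_{t',t}:M^\circ(t)\to M^\circ(t')$ sends $g$ to $g'$ with $g'_k=-g_k$, and for $i\neq k$, $g'_i=g_i+b_{ik}(t)[g_k]_+$ if $b_{ik}(t)\ge0$, $g'_i=g_i+b_{ik}(t)[-g_k]_+$ if $b_{ik}(t)<0$. The codegree tropical transformation $\phi^{\mathrm{op}}_{t',t}:M^\circ(t)\to M^\circ(t')$ sends $g$ to $g'$ with $g'_k=-g_k$, and for $i\ne k$, $g'_i=g_i-b_{ik}(t)[g_k]_+$ if $b_{ik}(t)\le0$, $g'_i=g_i-b_{ik}(t)[-g_k]_+$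 if $b_{ik}(t)>0$. In general $\phi_{t',t}$ and $\phi^{\mathrm{op}}_{t',t}$ are the compositions along a mutation sequence from $t$ to $t'$ (independent of choice). **Compatible copointedness.** $Z\in\mathcal U_q(t)$ is compatibly copointed at $\Delta^+$ if for some $\eta\in M^\circ(t)$ it is $\eta$-copointed in $\mathcal{LP}(t)$ and for every $t'\in\Delta^+$, $\mu_{t,t'}^*Z$ is $\phi^{\mathrm{op}}_{t',t}(\eta)$-copointed in $\mathcal{LP}(t')$. A basis is compatibly copointed at $\Delta^+$ if all its elements are (with distinct codegrees in $M^\circ(t)$). **Injective-reachability.** $t$ is injective-reachable if there are a seed $t[1]\in\Delta^+$ and a permutation $\sigma$ of $I_{\mathrm{uf}}$ with $b_{\sigma i,\sigma j}(t[1])=b_{ij}(t)$ for $i,j\in I_{\mathrm{uf}}$ and $\deg^t\mu_{t[1],t}^*X_{\sigma k}(t[1])\in-f_k(t)+\mathbb{Z}^{I_{\mathrm f}}$ for all $k\in I_{\mathrm{uf}}$. ($t[1]$ is unique up to relabelling; if $t$ is injective-reachable, so are all seeds of $\Delta^+$.) $t[-1]\in\Delta^+$ denotes the seed with $(t[-1])[1]=t$ (it exists and is unique up to relabelling). **Bases.** Let $\mathrm A(t)\subset\mathcal U_q(t)$ be a $\Bbbk$-subalgebra, $\mathrm A(t')=\mu_{t,t'}^*\mathrm A(t)$, and let $\mathbf L$ be a $\Bbbk$-basis of $\mathrm A(t)$. Degree-triangular with respect to $t$: (1) $X_i(t)\in\mathbf L$ for $i\in I$; (2) every element of $\mathbf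 L$ is bar-invariant; (3) $\mathbf L=\{\mathbf L_g\mid g\in M^\circ(t)\}$ with $\mathbf L_g$ $g$-pointed; (4) for all $g$ and $i\in I$, $[X_i(t)*\mathbf L_g]^t=\sum_{g'\preceq_tg+f_i}b_{g'}\mathbf L_{g'}$ with $b_{g+f_i}=1$ and $b_{g'}\in\mathbf m$ for $g'\prec_tg+f_i$. Codegree-triangular with respect to $t$: (1), (2) as before; (3') $\mathbf L=\{\mathbf L^\eta\mid\eta\in M^\circ(t)\}$ with $\mathbf L^\eta$ $\eta$-copointed; (4') for all $\eta$ and $i\in I$, $\{\mathbf L^\eta*X_i(t)\}^t=\sum_{\eta'\succeq_t\eta+f_i}c_{\eta'}\mathbf L^{\eta'}$ with $c_{\eta+f_i}=1$ and $c_{\eta'}\in\mathbf m$ for $\eta'\succ_t\eta+f_i$. The triangular basis with respect to $t$ is a degree-triangular basis containing the quantum cluster monomials in $t$ and $t[1]$ (unique if it exists). The double triangular basis with respect to $t$ is a basis that is both degree-triangular and codegree-triangular with respect to $t$ and contains the quantum cluster monomials in $t$, $t[-1]$ and $t[1]$. The triangular basis $\mathbf L$ of $\mathrm A(t)$ with respect to $t$ is the common triangular basis if, for every $t'\in\Delta^+$, $\mu_{t,t'}^*\mathbf L$ is the triangular basis of $\mathrm A(t')$ with respect to $t'$, and $\mu_{t,t'}^*\mathbf L_g$ is $\phi_{t',t}(g)$-pointed in $\mathcal{LP}(t')$ for every $g$. *)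

theory Defs
  imports
    "HOL-Combinatorics.Permutations"
    "HOL-Library.Poly_Mapping"
    "HOL-Analysis.Finite_Cartesian_Product"
begin

section \<open>The base ring\<close>

text \<open>
  The base ring \<open>\<int>[v\<^sup>\<plusminus>\<^sup>1]\<close> is the group ring \<open>int \<Rightarrow>\<^sub>0 int\<close>; the coefficient of \<open>v\<^sup>n\<close> in \<open>p\<close>
  is \<open>lookup p n\<close>.
\<close>

type_synonym laurent = "int \<Rightarrow>\<^sub>0 int"

definition laurent_m :: "laurent set" where
  "laurent_m = {p. \<forall>n \<in> Poly_Mapping.keys p. n < 0}"

definition laurent_bar :: "laurent \<Rightarrow> laurent" where
  "laurent_bar p = Poly_Mapping.map_key uminus p"

definition scalar :: "'f::division_ring \<Rightarrow> laurent \<Rightarrow> 'f" where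
  "scalar v p = (\<Sum>n \<in> Poly_Mapping.keys p. of_int (Poly_Mapping.lookup p n) * v powi n)"

definition scale :: "'f::division_ring \<Rightarrow> laurent \<Rightarrow> 'f \<Rightarrow> 'f" where
  "scale v p z = scalar v p * z"

definition kk_basis :: "'f::division_ring \<Rightarrow> 'f set \<Rightarrow> 'f set \<Rightarrow> bool" where
  "kk_basis v L A \<longleftrightarrow> \<not> module.dependent (scale v) L \<and> module.span (scale v) L = A"

definition kk_subalgebra :: "'f::division_ring \<Rightarrow> 'f set \<Rightarrow> bool" where
  "kk_subalgebra v A \<longleftrightarrow>
     module.subspace (scale v) A \<and> 1 \<in> A \<and> (\<forall>x\<in>A. \<forall>y\<in>A. x * y \<in> A)"


section \<open>Quantum seeds\<close>

text \<open>
  All the skew fields \<open>\<F>(t')\<close> of mutation equivalent seeds are identified, by means of the isomorphisms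
  \<open>\<mu>\<^sub>k\<^sup>*\<close>, with one skew field \<open>'f\<close>, so that every \<open>\<mu>\<^sup>*\<close> becomes the identity of \<open>'f\<close>.
  Accordingly \<open>frame t m\<close> is the Laurent monomial \<open>X(t)\<^sup>m\<close> as an element of \<open>'f\<close>, and multiplication in \<open>'f\<close>
  is the twisted product. The vertex set \<open>I\<close> is the type \<open>'i\<close>. The columns of \<open>bmat t\<close> indexed by frozen
  vertices do not belong to the exchange matrix; they are kept equal to zero.
\<close>

record ('i, 'f) qseed =
  unfrozen :: "'i set"
  vpar :: "'f"
  bmat :: "int ^ 'i ^ 'i"
  lam :: "int ^ 'i ^ 'i"
  frame :: "int ^ 'i \<Rightarrow> 'f"

abbreviation unit_vec :: "'i \<Rightarrow> int ^ 'i" where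
  "unit_vec i \<equiv> axis i 1"

definition pos_part :: "int \<Rightarrow> int" where
  "pos_part a = max a 0"

definition bilin :: "int ^ 'i ^ 'i \<Rightarrow> int ^ ('i::finite) \<Rightarrow> int ^ 'i \<Rightarrow> int" where
  "bilin M g g' = (\<Sum>i\<in>UNIV. \<Sum>j\<in>UNIV. g $ i * M $ i $ j * g' $ j)"

definition p_star :: "('i::finite, 'f) qseed \<Rightarrow> int ^ 'i \<Rightarrow> int ^ 'i" where
  "p_star t n = bmat t *v n"

definition N_uf_nonneg :: "('i::finite, 'f) qseed \<Rightarrow> (int ^ 'i) set" where
  "N_uf_nonneg t = {n. (\<forall>i. 0 \<le> n $ i) \<and> (\<forall>i. i \<notin> unfrozen t \<longrightarrow> n $ i = 0)}"

definition cluster_var :: "('i::finite, 'f) qseed \<Rightarrow> 'i \<Rightarrow> 'f" where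
  "cluster_var t i = frame t (unit_vec i)"

definition laurent_expand ::
  "('i::finite, 'f::division_ring) qseed \<Rightarrow> (int ^ 'i \<Rightarrow>\<^sub>0 laurent) \<Rightarrow> 'f" where
  "laurent_expand t c =
     (\<Sum>m \<in> Poly_Mapping.keys c. scalar (vpar t) (Poly_Mapping.lookup c m) * frame t m)"

definition LP :: "('i::finite, 'f::division_ring) qseed \<Rightarrow> 'f set" where
  "LP t = range (laurent_expand t)"

definition compatible_pair :: "'i set \<Rightarrow> int ^ 'i ^ 'i \<Rightarrow> int ^ ('i::finite) ^ 'i \<Rightarrow> bool" where
  "compatible_pair U B M \<longleftrightarrow>
     (\<forall>i j. M $ j $ i = - M $ i $ j) \<and>
     (\<exists>d. \<forall>k\<in>U. d k > 0 \<and> (\<forall>j. (transpose B ** M) $ k $ j = (if j = k then d k else 0)))"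

text \<open>
  The conditions on \<open>vpar\<close> and \<open>frame\<close> say that \<open>'f\<close>, with the embedding \<open>laurent_expand t\<close> of the quantum
  torus, is the skew field of fractions of the quantum torus.
\<close>

definition quantum_seed :: "('i::finite, 'f::division_ring) qseed \<Rightarrow> bool" where
  "quantum_seed t \<longleftrightarrow>
     (\<forall>i j. j \<notin> unfrozen t \<longrightarrow> bmat t $ i $ j = 0) \<and>
     compatible_pair (unfrozen t) (bmat t) (lam t) \<and>
     vpar t \<noteq> 0 \<and> (\<forall>x. vpar t * x = x * vpar t) \<and>
     frame t 0 = 1 \<and>
     (\<forall>m m'. frame t m * frame t m' = vpar t powi bilin (lam t) m m' * frame t (m + m')) \<and>
     inj (laurent_expand t) \<and>
     (\<forall>x. \<exists>a\<in>LP t. \<exists>s\<in>LP t. s \<noteq> 0 \<and> x = a * inverse s)"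


section \<open>Mutations\<close>

text \<open>The two exponents in \<open>\<mu>\<^sub>k\<^sup>* X\<^sub>k(t')\<close>.\<close>

definition exch_minus :: "'i \<Rightarrow> ('i::finite, 'f) qseed \<Rightarrow> int ^ 'i" where
  "exch_minus k t = - unit_vec k + (\<chi> i. pos_part (- bmat t $ i $ k))"

definition exch_plus :: "'i \<Rightarrow> ('i::finite, 'f) qseed \<Rightarrow> int ^ 'i" where
  "exch_plus k t = - unit_vec k + (\<chi> i. pos_part (bmat t $ i $ k))"

definition mutate_bmat :: "'i \<Rightarrow> ('i::finite, 'f) qseed \<Rightarrow> int ^ 'i ^ 'i" where
  "mutate_bmat k t = (\<chi> i j.
     if i = k \<or> j = k then - bmat t $ i $ j
     else bmat t $ i $ j + pos_part (bmat t $ i $ k) * pos_part (bmat t $ k $ j)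
            - pos_part (- bmat t $ i $ k) * pos_part (- bmat t $ k $ j))"

definition mutate_lam :: "'i \<Rightarrow> ('i::finite, 'f) qseed \<Rightarrow> int ^ 'i ^ 'i" where
  "mutate_lam k t = (\<chi> i j.
     if i = k \<and> j = k then 0
     else if i = k then bilin (lam t) (exch_minus k t) (unit_vec j)
     else if j = k then - bilin (lam t) (exch_minus k t) (unit_vec i)
     else lam t $ i $ j)"

definition mutate_var :: "'i \<Rightarrow> ('i::finite, 'f::division_ring) qseed \<Rightarrow> 'f" where
  "mutate_var k t = frame t (exch_minus k t) + frame t (exch_plus k t)"

definition drop_coord :: "'i \<Rightarrow> int ^ 'i \<Rightarrow> int ^ ('i::finite)" where
  "drop_coord k m = (\<chi> i. if i = k then 0 else m $ i)"

text \<open>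
  \<open>mutate_frame k t m\<close> is \<open>\<mu>\<^sub>k\<^sup>* X(t')\<^sup>m\<close>. In the quantum torus of \<open>t'\<close> one has
  \<open>X\<^sub>k(t')\<^sup>a * X(t')\<^sup>n = v\<^sup>c X(t')\<^sup>m\<close> for \<open>a = m\<^sub>k\<close>, \<open>n = m - a f\<^sub>k\<close> and \<open>c = \<lambda>'(a f\<^sub>k, n)\<close>, where \<open>\<mu>\<^sub>k\<^sup>* X(t')\<^sup>n = X(t)\<^sup>n\<close>.
  The lemmas \<open>cluster_var_mutate\<close> and \<open>frame_mutate_mult\<close> below confirm that this is the homomorphism
  with the prescribed values on the cluster variables.
\<close>

definition mutate_frame :: "'i \<Rightarrow> ('i::finite, 'f::division_ring) qseed \<Rightarrow> int ^ 'i \<Rightarrow> 'f" where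
  "mutate_frame k t m =
     vpar t powi (- bilin (mutate_lam k t) (axis k (m $ k)) (drop_coord k m))
       * (mutate_var k t powi (m $ k) * frame t (drop_coord k m))"

definition mutate :: "'i \<Rightarrow> ('i::finite, 'f::division_ring) qseed \<Rightarrow> ('i, 'f) qseed" where
  "mutate k t = t\<lparr>bmat := mutate_bmat k t, lam := mutate_lam k t, frame := mutate_frame k t\<rparr>"

lemma bilin_add_left: "bilin M (a + b) c = bilin M a c + bilin M b c"
  by (simp add: bilin_def algebra_simps sum.distrib)

lemma bilin_add_right: "bilin M c (a + b) = bilin M c a + bilin M c b"
  by (simp add: bilin_def algebra_simps sum.distrib)

lemma bilin_axis_left: "bilin M (axis k a) c = a * (\<Sum>j\<in>UNIV. M $ k $ j * c $ j)"
proof -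
  have "bilin M (axis k a) c =
      (\<Sum>i\<in>UNIV. if i = k then (\<Sum>j\<in>UNIV. a * M $ k $ j * c $ j) else 0)"
    unfolding bilin_def by (intro sum.cong refl) (auto simp: axis_def)
  then show ?thesis
    by (simp add: sum_distrib_left mult.assoc)
qed

lemma bilin_skew:
  assumes "\<And>i j. M $ j $ i = - M $ i $ j"
  shows "bilin M b a = - bilin M a b"
proof -
  have "bilin M b a = (\<Sum>j\<in>UNIV. \<Sum>i\<in>UNIV. b $ i * M $ i $ j * a $ j)"
    unfolding bilin_def by (rule sum.swap)
  also have "\<dots> = (\<Sum>j\<in>UNIV. \<Sum>i\<in>UNIV. - (a $ j * M $ j $ i * b $ i))"
    by (intro sum.cong refl) (subst assms, simp)
  finally show ?thesis
    by (simp add: bilin_def sum_negf)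
qed

lemma bilin_drop_coord:
  "bilin M a (drop_coord k b) + bilin M a (axis k (b $ k)) = bilin M a b"
proof -
  have "drop_coord k b + axis k (b $ k) = b"
    by (simp add: vec_eq_iff drop_coord_def axis_def)
  then show ?thesis
    by (metis bilin_add_right)
qed

lemma exch_diff:
  "exch_plus k t = exch_minus k t + (\<chi> i. bmat t $ i $ k)"
  by (auto simp: vec_eq_iff exch_plus_def exch_minus_def pos_part_def max_def)

lemma bilin_exch:
  fixes t :: "('i::finite, 'f::division_ring) qseed"
  assumes "quantum_seed t" "k \<in> unfrozen t" "u $ k = 0"
  shows "bilin (lam t) (exch_plus k t) u = bilin (lam t) (exch_minus k t) u"
proof -
  obtain d where d: "\<And>j. (transpose (bmat t) ** lam t) $ k $ j = (if j = k then d k else (0::int))"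
    using assms unfolding quantum_seed_def compatible_pair_def by blast
  have *: "(\<Sum>i\<in>UNIV. bmat t $ i $ k * lam t $ i $ j) = (if j = k then d k else 0)" for j
    using d[of j] by (simp add: matrix_matrix_mult_def transpose_def)
  have "bilin (lam t) (\<chi> i. bmat t $ i $ k) u
      = (\<Sum>j\<in>UNIV. \<Sum>i\<in>UNIV. bmat t $ i $ k * lam t $ i $ j * u $ j)"
    unfolding bilin_def by (subst sum.swap) simp
  also have "\<dots> = (\<Sum>j\<in>UNIV. (if j = k then d k else 0) * u $ j)"
    by (simp add: sum_distrib_right[symmetric] *)
  also have "\<dots> = 0"
    using assms(3) by (intro sum.neutral) auto
  finally show ?thesis
    by (simp add: exch_diff bilin_add_left)
qed

lemma frame_nonzero:
  assumes "quantum_seed t"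
  shows "frame t m \<noteq> 0"
proof
  assume "frame t m = 0"
  moreover have "frame t m * frame t (- m) = vpar t powi bilin (lam t) m (- m) * frame t 0"
    using assms unfolding quantum_seed_def by (metis add.right_inverse)
  ultimately show False
    using assms by (simp add: quantum_seed_def)
qed


lemma powi_skew_commute:
  fixes x y z :: "'f::division_ring"
  assumes xy: "x * y = y * z" and "x \<noteq> 0" "z \<noteq> 0"
  shows "x powi n * y = y * z powi n"
proof -
  have pow: "x ^ j * y = y * z ^ j" for j
  proof (induction j)
    case (Suc j)
    have "x ^ Suc j * y = x * (x ^ j * y)"
      by (simp add: mult.assoc)
    also have "\<dots> = x * y * z ^ j"
      by (simp add: Suc mult.assoc)
    finally show ?case
      by (simp add: xy mult.assoc)
  qed auto
  show ?thesis
  proof (cases n rule: int_cases4)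
    case (neg j)
    have "inverse (x ^ j) * (x ^ j * y) * inverse (z ^ j)
        = inverse (x ^ j) * (y * z ^ j) * inverse (z ^ j)"
      by (simp only: pow)
    moreover have "inverse (x ^ j) * (x ^ j * y) = y"
      by (subst mult.assoc[symmetric]) (simp add: assms)
    moreover have "(y * z ^ j) * inverse (z ^ j) = y"
      by (subst mult.assoc) (simp add: assms)
    ultimately have "y * inverse (z ^ j) = inverse (x ^ j) * y"
      by (metis mult.assoc)
    then show ?thesis
      by (simp add: neg power_int_minus)
  qed (simp add: pow)
qed

lemma vpar_powi_commute:
  assumes "quantum_seed t"
  shows "vpar t powi a * x = x * vpar t powi a"
  using assms by (intro powi_skew_commute) (auto simp: quantum_seed_def)

lemma vpar_powi_add:
  assumes "quantum_seed t"
  shows "vpar t powi a * vpar t powi b = vpar t powi (a + b)"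
  using assms by (simp add: quantum_seed_def power_int_add)

lemma mutate_var_nonzero:
  fixes t :: "('i::finite, 'f::division_ring) qseed"
  assumes t: "quantum_seed t" and k: "k \<in> unfrozen t"
  shows "mutate_var k t \<noteq> 0"
proof
  assume 0: "mutate_var k t = 0"
  obtain d where d: "d k > (0::int)"
    "\<And>j. (transpose (bmat t) ** lam t) $ k $ j = (if j = k then d k else 0)"
    using t k unfolding quantum_seed_def compatible_pair_def by blast
  have ne: "exch_minus k t \<noteq> exch_plus k t"
  proof
    assume "exch_minus k t = exch_plus k t"
    then have "bmat t $ i $ k = 0" for i
      by (simp add: exch_diff vec_eq_iff)
    then show False
      using d(1) d(2)[of k] by (simp add: matrix_matrix_mult_def transpose_def)
  qed
  define c :: "int ^ 'i \<Rightarrow>\<^sub>0 laurent" where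
    "c = Poly_Mapping.single (exch_minus k t) 1 + Poly_Mapping.single (exch_plus k t) 1"
  have look: "Poly_Mapping.lookup c m = (if m = exch_minus k t \<or> m = exch_plus k t then 1 else 0)" for m
    using ne by (auto simp: c_def lookup_add lookup_single when_def)
  then have keys: "Poly_Mapping.keys c = {exch_minus k t, exch_plus k t}"
    by (auto simp: in_keys_iff split: if_splits)
  have "laurent_expand t c = mutate_var k t"
    using ne by (simp add: laurent_expand_def keys look mutate_var_def scalar_def)
  also have "\<dots> = laurent_expand t 0"
    by (simp add: 0 laurent_expand_def)
  finally have "c = 0"
    using t by (auto simp: quantum_seed_def dest: injD)
  then show False
    using keys by simp
qed

lemma bilin_mutate_lam:
  assumes "k \<in> unfrozen t" "a $ k = 0"
  shows "bilin (mutate_lam k t) (axis k x) a = x * bilin (lam t) (exch_minus k t) a"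
proof -
  have *: "bilin (lam t) (exch_minus k t) (axis j (1::int))
      = (\<Sum>i\<in>UNIV. exch_minus k t $ i * lam t $ i $ j)" for j
  proof -
    have "(\<Sum>j'\<in>UNIV. exch_minus k t $ i * lam t $ i $ j' * axis j (1::int) $ j')
        = exch_minus k t $ i * lam t $ i $ j" for i
      by (subst sum.remove[of _ j]) (auto simp: axis_def intro!: sum.neutral)
    then show ?thesis by (simp add: bilin_def)
  qed
  have "(\<Sum>j\<in>UNIV. mutate_lam k t $ k $ j * a $ j)
      = (\<Sum>j\<in>UNIV. bilin (lam t) (exch_minus k t) (axis j 1) * a $ j)"
    by (intro sum.cong refl) (use assms in \<open>auto simp: mutate_lam_def\<close>)
  also have "\<dots> = bilin (lam t) (exch_minus k t) a"
    unfolding * sum_distrib_right by (subst sum.swap) (simp add: bilin_def)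
  finally show ?thesis
    by (simp add: bilin_axis_left)
qed

lemma mutate_lam_skew:
  assumes "quantum_seed t"
  shows "mutate_lam k t $ j $ i = - mutate_lam k t $ i $ j"
proof -
  have "lam t $ j $ i = - lam t $ i $ j"
    using assms unfolding quantum_seed_def compatible_pair_def by blast
  then show ?thesis
    by (simp add: mutate_lam_def)
qed

lemma bilin_mutate_lam_drop:
  assumes "a $ k = 0" "b $ k = 0"
  shows "bilin (mutate_lam k t) a b = bilin (lam t) a b"
  unfolding bilin_def by (intro sum.cong refl) (use assms in \<open>auto simp: mutate_lam_def\<close>)

lemma drop_coord_nth [simp]: "drop_coord k m $ k = 0"
  by (simp add: drop_coord_def)

lemma drop_coord_add: "drop_coord k (a + b) = drop_coord k a + drop_coord k b"
  by (simp add: vec_eq_iff drop_coord_def)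

lemma drop_coord_axis: "axis k (m $ k) + drop_coord k m = m"
  by (simp add: vec_eq_iff drop_coord_def axis_def)

lemma cluster_var_mutate:
  assumes "quantum_seed t" and "k \<in> unfrozen t"
  shows "cluster_var (mutate k t) i = (if i = k then mutate_var k t else cluster_var t i)"
proof (cases "i = k")
  case True
  then have "drop_coord k (unit_vec i) = 0"
    by (simp add: vec_eq_iff drop_coord_def axis_def)
  then show ?thesis
    using assms True by (simp add: cluster_var_def mutate_def mutate_frame_def quantum_seed_def
        bilin_def)
next
  case False
  then have *: "drop_coord k (unit_vec i) = unit_vec i" "unit_vec i $ k = (0::int)"
    by (auto simp add: vec_eq_iff drop_coord_def axis_def)
  then show ?thesis
    using False by (simp add: cluster_var_def mutate_def mutate_frame_def bilin_axis_left)
qed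

lemma frame_mutate_mult:
  fixes t :: "('i::finite, 'f::division_ring) qseed"
  assumes t: "quantum_seed t" and k: "k \<in> unfrozen t"
  shows "frame (mutate k t) m * frame (mutate k t) m' =
    vpar t powi bilin (lam (mutate k t)) m m' * frame (mutate k t) (m + m')"
proof -
  define v where "v = vpar t"
  define x where "x = mutate_var k t"
  define e where "e = exch_minus k t"
  define c where "c a = bilin (lam t) e a" for a
  note vc = vpar_powi_commute[OF t, folded v_def]
  note va = vpar_powi_add[OF t, folded v_def]
  have v0: "v \<noteq> 0" and fm: "\<And>a b. frame t a * frame t b = v powi bilin (lam t) a b * frame t (a + b)"
    and sk: "\<And>i j. lam t $ j $ i = - lam t $ i $ j"
    using t unfolding quantum_seed_def compatible_pair_def v_def by blast+
  have x0: "x \<noteq> 0"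
    using mutate_var_nonzero[OF t k] by (simp add: x_def)
  have one: "frame t e' * frame t a = v powi (2 * c a) * (frame t a * frame t e')"
    if "bilin (lam t) e' a = c a" for e' a
  proof -
    have "bilin (lam t) a e' = - c a"
      using bilin_skew[of "lam t" a e', OF sk] that by simp
    then have "v powi (2 * c a) * (frame t a * frame t e') = v powi c a * frame t (e' + a)"
      by (simp add: fm mult.assoc[symmetric] va add.commute)
    then show ?thesis
      by (simp add: fm that)
  qed
  have comm1: "x * frame t a = frame t a * (v powi (2 * c a) * x)" if "a $ k = 0" for a
  proof -
    have "x * frame t a = v powi (2 * c a) * (frame t a * x)"
      using one[of "exch_minus k t" a] one[of "exch_plus k t" a] bilin_exch[OF t k that]
      by (simp add: x_def mutate_var_def c_def e_def distrib_left distrib_right)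
    then show ?thesis
      by (metis vc mult.assoc)
  qed
  have powx: "(v powi b * x) powi n = v powi (n * b) * x powi n" for b n
  proof -
    have pw: "(v powi b * x) ^ j = (v powi b) ^ j * x ^ j" for j
    proof (induction j)
      case (Suc j)
      have "(v powi b * x) ^ Suc j = v powi b * (x * (v powi b) ^ j) * x ^ j"
        by (simp add: Suc mult.assoc)
      also have "x * (v powi b) ^ j = (v powi b) ^ j * x"
        by (metis vc power_int_power')
      finally show ?case
        by (simp add: mult.assoc)
    qed auto
    have pv: "(v powi b) ^ j = v powi (int j * b)" for j
      by (simp add: power_int_power' mult.commute)
    show ?thesis
    proof (cases n rule: int_cases4)
      case (nonneg j)
      then show ?thesis by (simp add: pw pv)
    next
      case (neg j)
      have "inverse (v powi (int j * b) * x ^ j) = inverse (x ^ j) * inverse (v powi (int j * b))"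
        using x0 v0 by (simp add: nonzero_inverse_mult_distrib)
      also have "\<dots> = v powi (- (int j * b)) * inverse (x ^ j)"
        by (metis vc power_int_minus)
      finally show ?thesis by (simp add: neg pw pv power_int_minus)
    qed
  qed
  have comm: "frame t a * x powi n = v powi (- (2 * n * c a)) * (x powi n * frame t a)"
    if "a $ k = 0" for a n
  proof -
    have "x powi n * frame t a = frame t a * (v powi (2 * c a) * x) powi n"
      by (rule powi_skew_commute) (use comm1[OF that] x0 v0 in auto)
    also have "\<dots> = v powi (2 * n * c a) * (frame t a * x powi n)"
      by (metis powx vc mult.assoc mult.commute)
    finally show ?thesis
      by (simp add: mult.assoc[symmetric] va)
  qed
  define a where "a = drop_coord k m"
  define b where "b = drop_coord k m'"
  have ab0: "a $ k = 0" "b $ k = 0" "(a + b) $ k = 0"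
    by (simp_all add: a_def b_def)
  have fr: "frame (mutate k t) u =
      v powi (- (u $ k * c (drop_coord k u))) * (x powi (u $ k) * frame t (drop_coord k u))" for u
    by (simp add: mutate_def mutate_frame_def v_def x_def c_def e_def bilin_mutate_lam[OF k])
  have cadd: "c (a + b) = c a + c b"
    by (simp add: c_def bilin_add_right)
  have L: "bilin (mutate_lam k t) m m' = m $ k * c b - m' $ k * c a + bilin (lam t) a b"
  proof -
    have "bilin (mutate_lam k t) m m' =
        bilin (mutate_lam k t) (axis k (m $ k) + a) (axis k (m' $ k) + b)"
      by (simp add: a_def b_def drop_coord_axis)
    also have "bilin (mutate_lam k t) (axis k (m $ k)) (axis k (m' $ k)) = 0"
      unfolding bilin_axis_left
      by (rule disjI2[THEN mult_eq_0_iff[THEN iffD2]], rule sum.neutral)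
        (auto simp: axis_def mutate_lam_def)
    ultimately show ?thesis
      using bilin_skew[of "mutate_lam k t" a "axis k (m' $ k)", OF mutate_lam_skew[OF t]]
      by (simp add: bilin_add_left bilin_add_right bilin_mutate_lam[OF k] ab0 c_def e_def
          bilin_mutate_lam_drop)
  qed
  have "frame (mutate k t) m * frame (mutate k t) m' =
      v powi (- (m $ k * c a)) * (x powi (m $ k) * (frame t a * v powi (- (m' $ k * c b)))
        * (x powi (m' $ k) * frame t b))"
    by (simp add: fr a_def b_def mult.assoc)
  also have "frame t a * v powi (- (m' $ k * c b)) = v powi (- (m' $ k * c b)) * frame t a"
    by (simp add: vc)
  also have "v powi (- (m $ k * c a)) * (x powi (m $ k) * (v powi (- (m' $ k * c b)) * frame t a)
        * (x powi (m' $ k) * frame t b))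
      = v powi (- (m $ k * c a)) * (v powi (- (m' $ k * c b)) *
          (x powi (m $ k) * ((frame t a * x powi (m' $ k)) * frame t b)))"
    by (metis (no_types, lifting) vc mult.assoc)
  also have "frame t a * x powi (m' $ k) =
      v powi (- (2 * m' $ k * c a)) * (x powi (m' $ k) * frame t a)"
    by (rule comm[OF ab0(1)])
  also have "x powi (m $ k) * (v powi (- (2 * m' $ k * c a)) * (x powi (m' $ k) * frame t a)
        * frame t b)
      = v powi (- (2 * m' $ k * c a)) * (x powi (m $ k) * x powi (m' $ k) * (frame t a * frame t b))"
    by (metis (no_types, lifting) vc mult.assoc)
  also have "x powi (m $ k) * x powi (m' $ k) = x powi ((m + m') $ k)"
    using x0 by (simp add: power_int_add)
  also have "frame t a * frame t b = v powi bilin (lam t) a b * frame t (a + b)"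
    by (rule fm)
  also have "x powi ((m + m') $ k) * (v powi bilin (lam t) a b * frame t (a + b)) =
      v powi bilin (lam t) a b * (x powi ((m + m') $ k) * frame t (a + b))"
    by (metis vc mult.assoc)
  also have "v powi (- (m $ k * c a)) * (v powi (- (m' $ k * c b)) * (v powi (- (2 * m' $ k * c a)) *
        (v powi bilin (lam t) a b * (x powi ((m + m') $ k) * frame t (a + b)))))
      = v powi (- (m $ k * c a) - m' $ k * c b - 2 * m' $ k * c a + bilin (lam t) a b)
          * (x powi ((m + m') $ k) * frame t (a + b))"
  proof -
    have "v powi p * (v powi q * (v powi r * (v powi s * z))) = v powi (p + q + r + s) * z" for p q r s z
      by (simp add: mult.assoc[symmetric] va add.assoc)
    then show ?thesis by simp
  qed
  also have "- (m $ k * c a) - m' $ k * c b - 2 * m' $ k * c a + bilin (lam t) a b =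
      bilin (mutate_lam k t) m m' - (m + m') $ k * c (a + b)"
    by (simp add: L cadd algebra_simps)
  also have "v powi (bilin (mutate_lam k t) m m' - (m + m') $ k * c (a + b))
          * (x powi ((m + m') $ k) * frame t (a + b))
      = v powi bilin (mutate_lam k t) m m' * frame (mutate k t) (m + m')"
    unfolding fr by (simp add: drop_coord_add a_def b_def mult.assoc[symmetric] va)
  finally show ?thesis
    by (simp add: v_def mutate_def)
qed

lemma scalar_superset:
  assumes "finite S" "Poly_Mapping.keys p \<subseteq> S"
  shows "scalar v p = (\<Sum>n\<in>S. of_int (Poly_Mapping.lookup p n) * v powi n)"
  unfolding scalar_def using assms
  by (intro sum.mono_neutral_left) (auto simp: in_keys_iff)

lemma scalar_add: "scalar v (p + q) = scalar v p + scalar v q"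
proof -
  let ?S = "Poly_Mapping.keys p \<union> Poly_Mapping.keys q"
  have "scalar v (p + q) = (\<Sum>n\<in>?S. of_int (Poly_Mapping.lookup (p + q) n) * v powi n)"
    by (rule scalar_superset) (auto dest: set_mp[OF Poly_Mapping.keys_add])
  then show ?thesis
    by (simp add: scalar_superset[of ?S] lookup_add distrib_right sum.distrib)
qed

lemma scalar_single: "scalar v (Poly_Mapping.single n a) = of_int a * v powi n"
  by (simp add: scalar_def)

lemma laurent_induct [case_names single add]:
  assumes "\<And>n a. P (Poly_Mapping.single n a)" and "\<And>p q. P p \<Longrightarrow> P q \<Longrightarrow> P (p + q)"
  shows "P (p :: laurent)"
proof (induction p rule: update_induct)
  case const
  then show ?case
    using assms(1)[of 0 0] by simp
next
  case (update p n a)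
  have "Poly_Mapping.update n a p = p + Poly_Mapping.single n a"
    using update(1)
    by (intro poly_mapping_eqI) (auto simp: lookup_update lookup_add lookup_single when_def in_keys_iff)
  then show ?case
    using assms update by simp
qed

lemma scalar_mult:
  fixes v :: "'f::division_ring"
  assumes "v \<noteq> 0"
  shows "scalar v (p * q) = scalar v p * scalar v q"
proof -
  have *: "scalar v (Poly_Mapping.single n a * q) = of_int a * v powi n * scalar v q" for n a
  proof (induction q rule: laurent_induct)
    case (single m b)
    have "of_int a * of_int b * (v powi n * v powi m) = of_int a * (of_int b * v powi n) * v powi m"
      by (simp add: mult.assoc)
    also have "of_int b * v powi n = v powi n * of_int b"
      by (simp add: mult_of_int_commute)
    finally show ?case
      using assms by (simp add: mult_single scalar_single power_int_add mult.assoc)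
  qed (simp add: distrib_left scalar_add)
  show ?thesis
    by (induction p rule: laurent_induct)
      (simp_all add: * scalar_single distrib_right scalar_add)
qed

lemma module_scale:
  fixes v :: "'f::division_ring"
  assumes "v \<noteq> 0"
  shows "module (scale v)"
proof
  have "scalar v 1 = 1"
    by (simp add: scalar_def)
  then show "scale v 1 x = x" for x
    by (simp add: scale_def)
qed (simp_all add: scale_def scalar_add scalar_mult[OF assms] distrib_left distrib_right mult.assoc)

definition mutate_seq :: "'i list \<Rightarrow> ('i::finite, 'f::division_ring) qseed \<Rightarrow> ('i, 'f) qseed" where
  "mutate_seq w t = fold mutate w t"

definition seeds :: "('i::finite, 'f::division_ring) qseed \<Rightarrow> ('i, 'f) qseed set" where
  "seeds t = {mutate_seq w t | w. set w \<subseteq> unfrozen t}"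

definition upper_cluster_algebra :: "('i::finite, 'f::division_ring) qseed \<Rightarrow> 'f set" where
  "upper_cluster_algebra t = (\<Inter>t'\<in>seeds t. LP t')"

definition cluster_monomials :: "('i::finite, 'f) qseed \<Rightarrow> 'f set" where
  "cluster_monomials t = {frame t m | m. \<forall>i. 0 \<le> m $ i}"


section \<open>Degrees and codegrees\<close>

definition dom_le :: "('i::finite, 'f) qseed \<Rightarrow> int ^ 'i \<Rightarrow> int ^ 'i \<Rightarrow> bool" where
  "dom_le t g' g \<longleftrightarrow> (\<exists>n\<in>N_uf_nonneg t. g' = g + p_star t n)"

definition dom_less :: "('i::finite, 'f) qseed \<Rightarrow> int ^ 'i \<Rightarrow> int ^ 'i \<Rightarrow> bool" where
  "dom_less t g' g \<longleftrightarrow> dom_le t g' g \<and> g' \<noteq> g"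

text \<open>The expansion coefficients are meaningful for elements of \<open>LP t\<close> only.\<close>

definition lp_coeffs ::
  "('i::finite, 'f::division_ring) qseed \<Rightarrow> 'f \<Rightarrow> (int ^ 'i \<Rightarrow>\<^sub>0 laurent)" where
  "lp_coeffs t = the_inv (laurent_expand t)"

definition lp_supp :: "('i::finite, 'f::division_ring) qseed \<Rightarrow> 'f \<Rightarrow> (int ^ 'i) set" where
  "lp_supp t Z = Poly_Mapping.keys (lp_coeffs t Z)"

definition lp_coeff ::
  "('i::finite, 'f::division_ring) qseed \<Rightarrow> 'f \<Rightarrow> int ^ 'i \<Rightarrow> laurent" where
  "lp_coeff t Z m = Poly_Mapping.lookup (lp_coeffs t Z) m"

definition has_degree ::
  "('i::finite, 'f::division_ring) qseed \<Rightarrow> int ^ 'i \<Rightarrow> 'f \<Rightarrow> bool" where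
  "has_degree t g Z \<longleftrightarrow>
     Z \<in> LP t \<and> {m \<in> lp_supp t Z. \<not> (\<exists>m'\<in>lp_supp t Z. dom_less t m m')} = {g}"

definition has_codegree ::
  "('i::finite, 'f::division_ring) qseed \<Rightarrow> int ^ 'i \<Rightarrow> 'f \<Rightarrow> bool" where
  "has_codegree t \<eta> Z \<longleftrightarrow>
     Z \<in> LP t \<and> {m \<in> lp_supp t Z. \<not> (\<exists>m'\<in>lp_supp t Z. dom_less t m' m)} = {\<eta>}"

definition deg :: "('i::finite, 'f::division_ring) qseed \<Rightarrow> 'f \<Rightarrow> int ^ 'i" where
  "deg t Z = (THE g. has_degree t g Z)"

definition codeg :: "('i::finite, 'f::division_ring) qseed \<Rightarrow> 'f \<Rightarrow> int ^ 'i" where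
  "codeg t Z = (THE \<eta>. has_codegree t \<eta> Z)"

definition pointed :: "('i::finite, 'f::division_ring) qseed \<Rightarrow> int ^ 'i \<Rightarrow> 'f \<Rightarrow> bool" where
  "pointed t g Z \<longleftrightarrow> has_degree t g Z \<and> lp_coeff t Z g = 1"

definition copointed :: "('i::finite, 'f::division_ring) qseed \<Rightarrow> int ^ 'i \<Rightarrow> 'f \<Rightarrow> bool" where
  "copointed t \<eta> Z \<longleftrightarrow> has_codegree t \<eta> Z \<and> lp_coeff t Z \<eta> = 1"

definition deg_normalize :: "('i::finite, 'f::division_ring) qseed \<Rightarrow> 'f \<Rightarrow> 'f" where
  "deg_normalize t Z = inverse (scalar (vpar t) (lp_coeff t Z (deg t Z))) * Z"

definition codeg_normalize :: "('i::finite, 'f::division_ring) qseed \<Rightarrow> 'f \<Rightarrow> 'f" where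
  "codeg_normalize t Z = inverse (scalar (vpar t) (lp_coeff t Z (codeg t Z))) * Z"

definition bar :: "('i::finite, 'f::division_ring) qseed \<Rightarrow> 'f \<Rightarrow> 'f" where
  "bar t Z = laurent_expand t (Poly_Mapping.map laurent_bar (lp_coeffs t Z))"

definition bar_invariant :: "('i::finite, 'f::division_ring) qseed \<Rightarrow> 'f \<Rightarrow> bool" where
  "bar_invariant t Z \<longleftrightarrow> Z \<in> LP t \<and> bar t Z = Z"


section \<open>Tropical transformations\<close>

definition trop :: "'i \<Rightarrow> ('i::finite, 'f) qseed \<Rightarrow> int ^ 'i \<Rightarrow> int ^ 'i" where
  "trop k t g = (\<chi> i.
     if i = k then - g $ k
     else if bmat t $ i $ k \<ge> 0 then g $ i + bmat t $ i $ k * pos_part (g $ k)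
     else g $ i + bmat t $ i $ k * pos_part (- g $ k))"

definition trop_op :: "'i \<Rightarrow> ('i::finite, 'f) qseed \<Rightarrow> int ^ 'i \<Rightarrow> int ^ 'i" where
  "trop_op k t g = (\<chi> i.
     if i = k then - g $ k
     else if bmat t $ i $ k \<le> 0 then g $ i - bmat t $ i $ k * pos_part (g $ k)
     else g $ i - bmat t $ i $ k * pos_part (- g $ k))"

text \<open>
  Compositions along the mutation sequence \<open>w\<close> starting at \<open>t\<close>. Since they depend only on the end point
  of the sequence, conditions involving \<open>\<phi>\<close> from \<open>t\<close> to \<open>t'\<close> are imposed below for every mutation
  sequence from \<open>t\<close> to \<open>t'\<close>.
\<close>

fun trop_seq ::
  "'i list \<Rightarrow> ('i::finite, 'f::division_ring) qseed \<Rightarrow> int ^ 'i \<Rightarrow> int ^ 'i" where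
  "trop_seq [] t g = g"
| "trop_seq (k # w) t g = trop_seq w (mutate k t) (trop k t g)"

fun trop_op_seq ::
  "'i list \<Rightarrow> ('i::finite, 'f::division_ring) qseed \<Rightarrow> int ^ 'i \<Rightarrow> int ^ 'i" where
  "trop_op_seq [] t g = g"
| "trop_op_seq (k # w) t g = trop_op_seq w (mutate k t) (trop_op k t g)"

definition compatibly_copointed :: "('i::finite, 'f::division_ring) qseed \<Rightarrow> 'f \<Rightarrow> bool" where
  "compatibly_copointed t Z \<longleftrightarrow>
     Z \<in> upper_cluster_algebra t \<and>
     (\<exists>\<eta>. copointed t \<eta> Z \<and>
        (\<forall>w. set w \<subseteq> unfrozen t \<longrightarrow> copointed (mutate_seq w t) (trop_op_seq w t \<eta>) Z))"

definition compatibly_copointed_basis ::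
  "('i::finite, 'f::division_ring) qseed \<Rightarrow> 'f set \<Rightarrow> bool" where
  "compatibly_copointed_basis t L \<longleftrightarrow>
     (\<forall>Z\<in>L. compatibly_copointed t Z) \<and> inj_on (codeg t) L"


section \<open>Injective-reachability\<close>

text \<open>\<open>shifted t s\<close> means that \<open>s\<close> is a seed \<open>t[1]\<close>.\<close>

definition shifted ::
  "('i::finite, 'f::division_ring) qseed \<Rightarrow> ('i, 'f) qseed \<Rightarrow> bool" where
  "shifted t s \<longleftrightarrow>
     s \<in> seeds t \<and>
     (\<exists>\<sigma>. \<sigma> permutes unfrozen t \<and>
        (\<forall>i\<in>unfrozen t. \<forall>j\<in>unfrozen t. bmat s $ \<sigma> i $ \<sigma> j = bmat t $ i $ j) \<and>
        (\<forall>k\<in>unfrozen t. \<exists>h. (\<forall>i\<in>unfrozen t. h $ i = 0) \<and>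
           has_degree t (- unit_vec k + h) (cluster_var s (\<sigma> k))))"

definition injective_reachable :: "('i::finite, 'f::division_ring) qseed \<Rightarrow> bool" where
  "injective_reachable t \<longleftrightarrow> (\<exists>s. shifted t s)"


section \<open>Triangular bases\<close>

definition degree_triangular ::
  "('i::finite, 'f::division_ring) qseed \<Rightarrow> 'f set \<Rightarrow> 'f set \<Rightarrow> bool" where
  "degree_triangular t A L \<longleftrightarrow>
     kk_basis (vpar t) L A \<and>
     (\<forall>i. cluster_var t i \<in> L) \<and>
     (\<forall>Z\<in>L. bar_invariant t Z) \<and>
     (\<exists>Lg :: int ^ 'i \<Rightarrow> 'f.
        L = range Lg \<and> (\<forall>g. pointed t g (Lg g)) \<and>
        (\<forall>g i. \<exists>b :: int ^ 'i \<Rightarrow>\<^sub>0 laurent.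
           (\<forall>g'\<in>Poly_Mapping.keys b. dom_le t g' (g + unit_vec i)) \<and>
           Poly_Mapping.lookup b (g + unit_vec i) = 1 \<and>
           (\<forall>g'. dom_less t g' (g + unit_vec i) \<longrightarrow> Poly_Mapping.lookup b g' \<in> laurent_m) \<and>
           deg_normalize t (cluster_var t i * Lg g) =
             (\<Sum>g'\<in>Poly_Mapping.keys b. scale (vpar t) (Poly_Mapping.lookup b g') (Lg g'))))"

definition codegree_triangular ::
  "('i::finite, 'f::division_ring) qseed \<Rightarrow> 'f set \<Rightarrow> 'f set \<Rightarrow> bool" where
  "codegree_triangular t A L \<longleftrightarrow>
     kk_basis (vpar t) L A \<and>
     (\<forall>i. cluster_var t i \<in> L) \<and>
     (\<forall>Z\<in>L. bar_invariant t Z) \<and>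
     (\<exists>Le :: int ^ 'i \<Rightarrow> 'f.
        L = range Le \<and> (\<forall>\<eta>. copointed t \<eta> (Le \<eta>)) \<and>
        (\<forall>\<eta> i. \<exists>c :: int ^ 'i \<Rightarrow>\<^sub>0 laurent.
           (\<forall>\<eta>'\<in>Poly_Mapping.keys c. dom_le t (\<eta> + unit_vec i) \<eta>') \<and>
           Poly_Mapping.lookup c (\<eta> + unit_vec i) = 1 \<and>
           (\<forall>\<eta>'. dom_less t (\<eta> + unit_vec i) \<eta>' \<longrightarrow> Poly_Mapping.lookup c \<eta>' \<in> laurent_m) \<and>
           codeg_normalize t (Le \<eta> * cluster_var t i) =
             (\<Sum>\<eta>'\<in>Poly_Mapping.keys c. scale (vpar t) (Poly_Mapping.lookup c \<eta>') (Le \<eta>'))))"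

text \<open>
  The seeds \<open>t[1]\<close> and \<open>t[-1]\<close> are unique up to relabelling, which does not change the set of cluster
  monomials, so it does not matter which representative is used.
\<close>

definition triangular_basis ::
  "('i::finite, 'f::division_ring) qseed \<Rightarrow> 'f set \<Rightarrow> 'f set \<Rightarrow> bool" where
  "triangular_basis t A L \<longleftrightarrow>
     degree_triangular t A L \<and>
     cluster_monomials t \<subseteq> L \<and>
     (\<exists>s. shifted t s \<and> cluster_monomials s \<subseteq> L)"

definition double_triangular_basis ::
  "('i::finite, 'f::division_ring) qseed \<Rightarrow> 'f set \<Rightarrow> 'f set \<Rightarrow> bool" where
  "double_triangular_basis t A L \<longleftrightarrow>
     degree_triangular t A L \<and> codegree_triangular t A L \<and>
     cluster_monomials t \<subseteq> L \<and>
     (\<exists>s\<in>seeds t. shifted s t \<and> cluster_monomials s \<subseteq> L) \<and>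
     (\<exists>s. shifted t s \<and> cluster_monomials s \<subseteq> L)"

definition common_triangular_basis ::
  "('i::finite, 'f::division_ring) qseed \<Rightarrow> 'f set \<Rightarrow> 'f set \<Rightarrow> bool" where
  "common_triangular_basis t A L \<longleftrightarrow>
     triangular_basis t A L \<and>
     (\<forall>w. set w \<subseteq> unfrozen t \<longrightarrow>
        triangular_basis (mutate_seq w t) A L \<and>
        (\<forall>Z\<in>L. \<forall>g. pointed t g Z \<longrightarrow> pointed (mutate_seq w t) (trop_seq w t g) Z))"

end

theory Submission
  imports Defs
begin

text \<open>
  Let \<open>t = s[1]\<close>. All cluster monomials belong to \<open>L\<close>, so those of \<open>t\<close> are pointed in \<open>s\<close>, and their
  degrees define a linear bijection \<open>\<psi>\<close> from the exponents of \<open>t\<close> to those of \<open>s\<close>. It preserves \<open>\<lambda>\<close> and,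
  since exchange relations are pointed in \<open>s\<close> as well, it sends \<open>p\<^sup>*n\<close> to \<open>-p\<^sup>*n\<close> up to relabelling. Hence \<open>\<psi>\<close>
  reverses the dominance orders and turns codegrees in \<open>t\<close> into degrees in \<open>s\<close>. Mutating both members
  of the pair \<open>(s, t)\<close> gives another such pair, and \<open>\<psi>\<close> intertwines \<open>\<phi>\<^sup>o\<^sup>p\<close> for \<open>t\<close> with \<open>\<phi>\<close> for \<open>s\<close>. So every seed is
  of the form \<open>s[1]\<close>, and compatible pointedness becomes compatible copointedness.

  Read in \<open>s\<close>, codegree-triangularity with respect to \<open>t\<close> says that right multiplication by \<open>X\<^sub>i(t)\<close> is
  degree-triangular. Left multiplication by \<open>X(s)\<^sup>a\<close> is, so the normalized products \<open>X(s)\<^sup>a * X(t)\<^sup>u\<close> form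
  a unitriangular system with respect to \<open>L\<close>, and right multiplication by \<open>X\<^sub>i(t)\<close> maps such products to
  each other up to powers of \<open>v\<close>.
\<close>

section \<open>Laurent scalars and linear combinations\<close>

text \<open>Two signs decide whether normalizing a product spoils triangularity. If \<open>h\<close>
  lies below \<open>g\<close> in the dominance order of \<open>s\<close>, compatibility and
  skew-symmetry make \<lambda>(\<open>unit_vec i\<close>, \<open>h - g\<close>) nonpositive. The
  degree \<delta> in \<open>s\<close> of a variable of \<open>t\<close> has nonpositive unfrozen
  coordinates, so \<lambda>(\<open>h - g\<close>, \<delta>) is nonpositive as well. Left
  multiplication by variables of \<open>s\<close> and right multiplication by variables of
  \<open>t\<close> therefore rescale lower terms by nonpositive powers of \<open>v\<close>, which
  keeps coefficients in \<open>laurent_m\<close>. The expansion of basis elements in the products is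
  never formed; the coefficients of right multiplication are solved from a recursion instead. To
  reach every degree, the exponent \<open>a\<close> must be allowed negative frozen coordinates, so
  inverses of frozen variables have to act on \<open>L\<close> too. Pairing with \<lambda> sees a
  column of the exchange matrix only up to its weight, hence one family of weights is fixed for the
  whole mutation class. All seeds live in one skew field, so it must be shown that a mutated seed is
  again a quantum seed; leading terms give the linear independence.\<close>

definition vp :: "int \<Rightarrow> laurent" where
  "vp a = Poly_Mapping.single a 1"

lemma vp_0 [simp]: "vp 0 = 1"
  by (simp add: vp_def)

lemma vp_add: "vp a * vp b = vp (a + b)"
  by (simp add: vp_def mult_single)

lemma vp_neq_0 [simp]: "vp a \<noteq> 0"
  by (metis add.right_inverse mult_zero_left vp_0 vp_add zero_neq_one)

lemma vp_inv: "vp a * (vp (- a) * p) = p" "vp (- a) * (vp a * p) = p"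
  by (simp_all add: mult.assoc[symmetric] vp_add)

lemma scalar_vp [simp]: "scalar v (vp a) = v powi a"
  by (simp add: vp_def scalar_single)

lemma scalar_0 [simp]: "scalar v 0 = 0"
  by (simp add: scalar_def)

lemma scalar_1 [simp]: "scalar v 1 = 1"
  by (simp add: scalar_def)

lemma scalar_uminus: "scalar v (- p) = - scalar v p"
  using scalar_add[of v p "- p"] by (simp add: eq_neg_iff_add_eq_0 add.commute)

lemma scalar_central:
  fixes v :: "'f::division_ring"
  assumes "v \<noteq> 0" "\<And>x. v * x = x * v"
  shows "scalar v p * x = x * scalar v p"
proof (induction p rule: laurent_induct)
  case (single n a)
  have "v powi n * x = x * v powi n"
    by (rule powi_skew_commute) (use assms in auto)
  then show ?case
    by (simp add: scalar_single mult.assoc) (metis mult.assoc mult_of_int_commute)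
qed (simp add: scalar_add distrib_left distrib_right)

text \<open>Coefficient families are plain functions rather than polynomial mappings, so that they
  can be defined pointwise, shifted and composed; finiteness of the support is carried as a separate
  assumption.\<close>

definition lincomb :: "'f::division_ring \<Rightarrow> ('a \<Rightarrow> 'f) \<Rightarrow> ('a \<Rightarrow> laurent) \<Rightarrow> 'f" where
  "lincomb v F c = (\<Sum>m | c m \<noteq> 0. scalar v (c m) * F m)"

lemma lincomb_superset:
  assumes "finite S" "{m. c m \<noteq> 0} \<subseteq> S"
  shows "lincomb v F c = (\<Sum>m\<in>S. scalar v (c m) * F m)"
  unfolding lincomb_def using assms by (intro sum.mono_neutral_left) auto

lemma finite_supp_add:
  fixes c d :: "'a \<Rightarrow> laurent"
  assumes "finite {m. c m \<noteq> 0}" "finite {m. d m \<noteq> 0}"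
  shows "finite {m. c m + d m \<noteq> 0}"
  by (rule finite_subset[OF _ finite_UnI[OF assms]]) auto

lemma finite_supp_scale:
  fixes c :: "'a \<Rightarrow> laurent"
  assumes "finite {m. c m \<noteq> 0}"
  shows "finite {m. p m * c m \<noteq> 0}"
  by (rule finite_subset[OF _ assms]) auto

lemma finite_supp_sum:
  fixes c :: "'b \<Rightarrow> 'a \<Rightarrow> laurent"
  assumes "finite S" "\<And>x. x \<in> S \<Longrightarrow> finite {m. c x m \<noteq> 0}"
  shows "finite {m. (\<Sum>x\<in>S. c x m) \<noteq> 0}"
proof (rule finite_subset)
  show "{m. (\<Sum>x\<in>S. c x m) \<noteq> 0} \<subseteq> (\<Union>x\<in>S. {m. c x m \<noteq> 0})"
  proof safe
    fix m assume "(\<Sum>x\<in>S. c x m) \<noteq> 0"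
    then obtain x where "x \<in> S" "c x m \<noteq> 0"
      by (meson sum.neutral)
    then show "m \<in> (\<Union>x\<in>S. {m. c x m \<noteq> 0})" by auto
  qed
qed (use assms in auto)

lemma lincomb_add:
  assumes "finite {m. c m \<noteq> 0}" "finite {m. d m \<noteq> 0}"
  shows "lincomb v F (\<lambda>m. c m + d m) = lincomb v F c + lincomb v F d"
proof -
  let ?S = "{m. c m \<noteq> 0} \<union> {m. d m \<noteq> 0}"
  have "finite ?S" using assms by simp
  then show ?thesis
    by (subst (1 2 3) lincomb_superset[of ?S])
      (auto simp: scalar_add distrib_right sum.distrib)
qed

lemma lincomb_scale:
  assumes "finite {m. c m \<noteq> 0}" "v \<noteq> 0"
  shows "lincomb v F (\<lambda>m. p * c m) = scalar v p * lincomb v F c"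
  by (subst (1 2) lincomb_superset[OF assms(1)])
    (auto simp: scalar_mult[OF assms(2)] sum_distrib_left mult.assoc)

lemma lincomb_0 [simp]: "lincomb v F (\<lambda>_. 0) = 0"
  by (simp add: lincomb_def)

lemma lincomb_sum:
  assumes "finite S" "\<And>x. x \<in> S \<Longrightarrow> finite {m. c x m \<noteq> 0}"
  shows "lincomb v F (\<lambda>m. \<Sum>x\<in>S. c x m) = (\<Sum>x\<in>S. lincomb v F (c x))"
  using assms
  by (induction S rule: finite_induct) (simp_all add: lincomb_add finite_supp_sum)

lemma lincomb_single: "lincomb v F (\<lambda>m. if m = a then p else 0) = scalar v p * F a"
proof -
  have "lincomb v F (\<lambda>m. if m = a then p else 0)
      = (\<Sum>m\<in>{a}. scalar v (if m = a then p else 0) * F m)"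
    by (rule lincomb_superset) auto
  then show ?thesis by simp
qed

text \<open>Used to turn an expansion indexed by degrees in one seed into one indexed by codegrees
  in another.\<close>

lemma lincomb_reindex:
  assumes "bij f"
  shows "lincomb v F c = lincomb v (F \<circ> f) (c \<circ> f)"
proof -
  have eq: "{m. c m \<noteq> 0} = f ` {m. (c \<circ> f) m \<noteq> 0}"
    using bij_is_surj[OF assms] by (auto simp: image_iff)
  have "inj_on f {m. (c \<circ> f) m \<noteq> 0}"
    using assms by (meson bij_is_inj inj_on_subset top_greatest)
  then show ?thesis
    unfolding lincomb_def eq by (subst sum.reindex) (auto simp: o_def)
qed

lemma laurent_expand_lincomb:
  "laurent_expand t c = lincomb (vpar t) (frame t) (Poly_Mapping.lookup c)"
  by (simp add: laurent_expand_def lincomb_def Poly_Mapping.keys.rep_eq)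

lemma lookup_Abs: "finite {m. c m \<noteq> 0} \<Longrightarrow> Poly_Mapping.lookup (Abs_poly_mapping c) = c"
  by (simp add: Abs_poly_mapping_inverse)


section \<open>Quantum tori\<close>

text \<open>The part of \<open>quantum_seed\<close> that makes \<open>LP t\<close> a subring.\<close>

definition torus_frame :: "('i::finite, 'f::division_ring) qseed \<Rightarrow> bool" where
  "torus_frame t \<longleftrightarrow> vpar t \<noteq> 0 \<and> (\<forall>x. vpar t * x = x * vpar t) \<and> frame t 0 = 1 \<and>
     (\<forall>m m'. frame t m * frame t m' = vpar t powi bilin (lam t) m m' * frame t (m + m'))"

lemma quantum_seed_torus: "quantum_seed t \<Longrightarrow> torus_frame t"
  by (simp add: quantum_seed_def torus_frame_def)

lemma LP_iff: "Z \<in> LP t \<longleftrightarrow> (\<exists>c. finite {m. c m \<noteq> 0} \<and> Z = lincomb (vpar t) (frame t) c)"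
proof
  assume "Z \<in> LP t"
  then show "\<exists>c. finite {m. c m \<noteq> 0} \<and> Z = lincomb (vpar t) (frame t) c"
    unfolding LP_def laurent_expand_lincomb by (metis finite_lookup rangeE)
next
  assume "\<exists>c. finite {m. c m \<noteq> 0} \<and> Z = lincomb (vpar t) (frame t) c"
  then obtain c where "finite {m. c m \<noteq> 0}" "Z = lincomb (vpar t) (frame t) c"
    by blast
  then have "Z = laurent_expand t (Abs_poly_mapping c)"
    by (simp add: laurent_expand_lincomb lookup_Abs)
  then show "Z \<in> LP t"
    by (simp add: LP_def)
qed

lemma LP_0 [simp]: "0 \<in> LP t"
  by (auto simp: LP_iff intro!: exI[of _ "\<lambda>_. 0"])

lemma LP_add: "Z \<in> LP t \<Longrightarrow> W \<in> LP t \<Longrightarrow> Z + W \<in> LP t"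
proof -
  assume "Z \<in> LP t" "W \<in> LP t"
  then obtain c d where *: "finite {m. c m \<noteq> 0}" "Z = lincomb (vpar t) (frame t) c"
    "finite {m. d m \<noteq> 0}" "W = lincomb (vpar t) (frame t) d"
    by (auto simp: LP_iff)
  show "Z + W \<in> LP t"
    unfolding LP_iff using *
    by (intro exI[of _ "\<lambda>m. c m + d m"]) (simp add: finite_supp_add lincomb_add)
qed

lemma LP_scale: "Z \<in> LP t \<Longrightarrow> vpar t \<noteq> 0 \<Longrightarrow> scalar (vpar t) p * Z \<in> LP t"
proof -
  assume "Z \<in> LP t" and v: "vpar t \<noteq> 0"
  then obtain c where *: "finite {m. c m \<noteq> 0}" "Z = lincomb (vpar t) (frame t) c"
    by (auto simp: LP_iff)
  show "scalar (vpar t) p * Z \<in> LP t"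
    unfolding LP_iff using * v
    by (intro exI[of _ "\<lambda>m. p * c m"]) (simp add: finite_supp_scale[OF *(1), of "\<lambda>_. p"] lincomb_scale del: mult_eq_0_iff)
qed

lemma LP_powi_scale:
  assumes "Z \<in> LP t" "vpar t \<noteq> 0"
  shows "vpar t powi a * Z \<in> LP t"
  using LP_scale[OF assms, of "vp a"] by simp

lemma LP_frame [simp]: "frame t m \<in> LP t"
  unfolding LP_iff
proof (intro exI conjI)
  show "frame t m = lincomb (vpar t) (frame t) (\<lambda>m'. if m' = m then 1 else 0)"
    by (simp add: lincomb_single)
qed auto

lemma LP_sum: "(\<And>x. x \<in> S \<Longrightarrow> f x \<in> LP t) \<Longrightarrow> sum f S \<in> LP t"
  by (induction S rule: infinite_finite_induct) (auto intro: LP_add)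

lemma torus_powi_commute:
  assumes "torus_frame t"
  shows "vpar t powi a * x = x * vpar t powi a"
  using assms by (intro powi_skew_commute) (auto simp: torus_frame_def)

lemma torus_powi_add:
  assumes "torus_frame t"
  shows "vpar t powi a * vpar t powi b = vpar t powi (a + b)"
  using assms by (simp add: torus_frame_def power_int_add)

lemma torus_frame_mult:
  assumes "torus_frame t"
  shows "frame t m * frame t m' = vpar t powi bilin (lam t) m m' * frame t (m + m')"
  using assms by (simp add: torus_frame_def)

lemma torus_scalar_central:
  assumes "torus_frame t"
  shows "scalar (vpar t) p * x = x * scalar (vpar t) p"
  using assms by (intro scalar_central) (auto simp: torus_frame_def)

lemma LP_mult:
  assumes "torus_frame t" "Z \<in> LP t" "W \<in> LP t"
  shows "Z * W \<in> LP t"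
proof -
  have v0: "vpar t \<noteq> 0" using assms(1) by (simp add: torus_frame_def)
  obtain c d where cd: "finite {m. c m \<noteq> 0}" "Z = lincomb (vpar t) (frame t) c"
    "finite {m. d m \<noteq> 0}" "W = lincomb (vpar t) (frame t) d"
    using assms by (auto simp: LP_iff)
  have 1: "frame t m * W \<in> LP t" for m
  proof -
    have "frame t m * W = (\<Sum>m' | d m' \<noteq> 0.
        scalar (vpar t) (d m') * (vpar t powi bilin (lam t) m m' * frame t (m + m')))"
      unfolding cd(4) lincomb_def sum_distrib_left
      by (intro sum.cong refl)
        (metis mult.assoc torus_scalar_central[OF assms(1)] torus_frame_mult[OF assms(1)])
    then show ?thesis
      by (auto intro!: LP_sum LP_scale LP_powi_scale v0)
  qed
  have "Z * W = (\<Sum>m | c m \<noteq> 0. scalar (vpar t) (c m) * (frame t m * W))"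
    by (simp add: cd(2) lincomb_def sum_distrib_right mult.assoc)
  then show ?thesis
    by (auto intro!: LP_sum LP_scale 1 v0)
qed


section \<open>Coefficients\<close>

lemma lp_coeff_lincomb:
  assumes "quantum_seed t" "finite {m. c m \<noteq> 0}"
  shows "lp_coeff t (lincomb (vpar t) (frame t) c) = c"
proof -
  have "lincomb (vpar t) (frame t) c = laurent_expand t (Abs_poly_mapping c)"
    using assms by (simp add: laurent_expand_lincomb lookup_Abs)
  moreover have "inj (laurent_expand t)"
    using assms by (simp add: quantum_seed_def)
  ultimately show ?thesis
    using assms by (simp add: lp_coeff_def lp_coeffs_def the_inv_f_f lookup_Abs fun_eq_iff)
qed

lemma finite_lp_supp [simp]: "finite (lp_supp t Z)"
  by (simp add: lp_supp_def)

lemma lp_supp_iff: "m \<in> lp_supp t Z \<longleftrightarrow> lp_coeff t Z m \<noteq> 0"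
  by (simp add: lp_supp_def lp_coeff_def in_keys_iff)

lemma lp_supp_coeff: "{m. lp_coeff t Z m \<noteq> 0} = lp_supp t Z"
  by (auto simp: lp_supp_iff)

lemma LP_lincomb_coeff:
  assumes "quantum_seed t" "Z \<in> LP t"
  shows "Z = lincomb (vpar t) (frame t) (lp_coeff t Z)"
  using assms lp_coeff_lincomb by (metis LP_iff)

lemma LP_expand:
  assumes "quantum_seed t" "Z \<in> LP t"
  shows "Z = (\<Sum>m\<in>lp_supp t Z. scalar (vpar t) (lp_coeff t Z m) * frame t m)"
  using LP_lincomb_coeff[OF assms] by (simp add: lincomb_def lp_supp_coeff)

lemma lp_coeff_0:
  assumes "quantum_seed t"
  shows "lp_coeff t 0 m = 0"
  using lp_coeff_lincomb[OF assms, of "\<lambda>_. 0"] by simp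

lemma lp_coeff_add:
  assumes "quantum_seed t" "Z \<in> LP t" "W \<in> LP t"
  shows "lp_coeff t (Z + W) m = lp_coeff t Z m + lp_coeff t W m"
proof -
  have "Z + W = lincomb (vpar t) (frame t) (\<lambda>m. lp_coeff t Z m + lp_coeff t W m)"
    by (subst lincomb_add)
      (simp_all add: lp_supp_coeff LP_lincomb_coeff[OF assms(1,2), symmetric]
        LP_lincomb_coeff[OF assms(1,3), symmetric])
  then show ?thesis
    using lp_coeff_lincomb[OF assms(1) finite_supp_add[of "lp_coeff t Z" "lp_coeff t W"]]
    by (simp add: lp_supp_coeff)
qed

lemma lp_coeff_scale:
  assumes "quantum_seed t" "Z \<in> LP t"
  shows "lp_coeff t (scalar (vpar t) p * Z) m = p * lp_coeff t Z m"
proof -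
  have v0: "vpar t \<noteq> 0" using assms by (simp add: quantum_seed_def)
  have "scalar (vpar t) p * Z = lincomb (vpar t) (frame t) (\<lambda>m. p * lp_coeff t Z m)"
    by (subst lincomb_scale)
      (simp_all add: lp_supp_coeff v0 LP_lincomb_coeff[OF assms, symmetric])
  then show ?thesis
    using lp_coeff_lincomb[OF assms(1) finite_supp_scale[of "lp_coeff t Z" "\<lambda>_. p"]]
    by (simp add: lp_supp_coeff)
qed

lemma lp_coeff_powi_scale:
  assumes "quantum_seed t" "Z \<in> LP t"
  shows "lp_coeff t (vpar t powi a * Z) m = vp a * lp_coeff t Z m"
  using lp_coeff_scale[OF assms, of "vp a"] by simp

lemma lp_coeff_sum:
  assumes "quantum_seed t" "\<And>x. x \<in> S \<Longrightarrow> f x \<in> LP t"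
  shows "lp_coeff t (sum f S) m = (\<Sum>x\<in>S. lp_coeff t (f x) m)"
  using assms(2)
  by (induction S rule: infinite_finite_induct)
    (auto simp: lp_coeff_0[OF assms(1)] lp_coeff_add[OF assms(1)] LP_sum)

lemma lp_coeff_frame:
  assumes "quantum_seed t"
  shows "lp_coeff t (frame t u) m = (if m = u then 1 else 0)"
proof -
  have "frame t u = lincomb (vpar t) (frame t) (\<lambda>m. if m = u then 1 else 0)"
    by (simp add: lincomb_single)
  then show ?thesis
    using lp_coeff_lincomb[OF assms, of "\<lambda>m. if m = u then 1 else 0"] by simp
qed

lemma lp_coeff_frame_mult:
  assumes t: "quantum_seed t" "Z \<in> LP t"
  shows "lp_coeff t (frame t u * Z) x = vp (bilin (lam t) u (x - u)) * lp_coeff t Z (x - u)"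
proof -
  note qt = quantum_seed_torus[OF t(1)]
  have v0: "vpar t \<noteq> 0" using t by (simp add: quantum_seed_def)
  have "frame t u * Z = (\<Sum>m\<in>lp_supp t Z.
      scalar (vpar t) (lp_coeff t Z m) * (vpar t powi bilin (lam t) u m * frame t (u + m)))"
    unfolding torus_frame_mult[OF qt, symmetric]
    by (subst LP_expand[OF t], subst sum_distrib_left)
      (intro sum.cong refl, metis mult.assoc torus_scalar_central[OF qt])
  then have "lp_coeff t (frame t u * Z) x = (\<Sum>m\<in>lp_supp t Z.
      lp_coeff t Z m * (vp (bilin (lam t) u m) * (if x = u + m then 1 else 0)))"
    by (simp add: lp_coeff_sum[OF t(1)] LP_scale LP_powi_scale v0 lp_coeff_scale[OF t(1)]
        lp_coeff_powi_scale[OF t(1)] lp_coeff_frame[OF t(1)])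
  also have "\<dots> = (\<Sum>m\<in>lp_supp t Z. if m = x - u
      then vp (bilin (lam t) u (x - u)) * lp_coeff t Z (x - u) else 0)"
    by (intro sum.cong refl) (auto simp: algebra_simps)
  also have "\<dots> = vp (bilin (lam t) u (x - u)) * lp_coeff t Z (x - u)"
    by (simp add: lp_supp_iff)
  finally show ?thesis .
qed

lemma lp_coeff_mult:
  assumes t: "quantum_seed t" and ZW: "Z \<in> LP t" "W \<in> LP t"
  shows "lp_coeff t (Z * W) x =
    (\<Sum>m\<in>lp_supp t Z. lp_coeff t Z m * (vp (bilin (lam t) m (x - m)) * lp_coeff t W (x - m)))"
proof -
  note qt = quantum_seed_torus[OF t(1)]
  have v0: "vpar t \<noteq> 0" using t by (simp add: quantum_seed_def)
  have "Z * W = (\<Sum>m\<in>lp_supp t Z. scalar (vpar t) (lp_coeff t Z m) * (frame t m * W))"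
    by (subst LP_expand[OF t ZW(1)]) (simp add: sum_distrib_right mult.assoc)
  then show ?thesis
    by (simp add: lp_coeff_sum[OF t] LP_scale LP_mult[OF qt] v0 lp_coeff_scale[OF t] ZW
        lp_coeff_frame_mult[OF t])
qed


section \<open>The dominance order\<close>

text \<open>The weights are named instead of staying under an existential quantifier because
  mutation preserves them, and one family has to serve all seeds at once.\<close>

definition compatible_with :: "('i::finite, 'f) qseed \<Rightarrow> ('i \<Rightarrow> int) \<Rightarrow> bool" where
  "compatible_with t d \<longleftrightarrow>
     (\<forall>k\<in>unfrozen t. d k > 0 \<and> (\<forall>j. (transpose (bmat t) ** lam t) $ k $ j = (if j = k then d k else 0)))"

lemma quantum_seed_compatible_with:
  assumes "quantum_seed t"
  obtains d where "compatible_with t d"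
  using assms by (auto simp: quantum_seed_def compatible_pair_def compatible_with_def)

lemma quantum_seed_skew:
  assumes "quantum_seed t"
  shows "bilin (lam t) b a = - bilin (lam t) a b"
proof (rule bilin_skew)
  show "lam t $ j $ i = - lam t $ i $ j" for i j
    using assms unfolding quantum_seed_def compatible_pair_def by blast
qed

lemma quantum_seed_frozen_col:
  "quantum_seed t \<Longrightarrow> j \<notin> unfrozen t \<Longrightarrow> bmat t $ i $ j = 0"
  by (simp add: quantum_seed_def)

text \<open>The compatibility condition, extended bilinearly. It turns the pairing with a difference
  in the dominance order into a sum with positive weights, which is the source of the later sign
  arguments.\<close>

lemma bilin_p_star:
  assumes "quantum_seed t" "compatible_with t d"
  shows "bilin (lam t) (p_star t n) m = (\<Sum>k\<in>unfrozen t. d k * n $ k * m $ k)"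
proof -
  have *: "(\<Sum>i\<in>UNIV. bmat t $ i $ k * lam t $ i $ j) = (if j = k then d k else 0)"
    if "k \<in> unfrozen t" for k j
    using assms that by (simp add: compatible_with_def matrix_matrix_mult_def transpose_def)
  have col: "(\<Sum>i\<in>UNIV. p_star t n $ i * lam t $ i $ j) = (if j \<in> unfrozen t then d j * n $ j else 0)" for j
  proof -
    have "(\<Sum>i\<in>UNIV. p_star t n $ i * lam t $ i $ j)
        = (\<Sum>i\<in>UNIV. \<Sum>k\<in>UNIV. n $ k * (bmat t $ i $ k * lam t $ i $ j))"
      unfolding p_star_def matrix_vector_mult_def
      by (simp add: sum_distrib_left mult_ac)
    also have "\<dots> = (\<Sum>k\<in>UNIV. \<Sum>i\<in>UNIV. n $ k * (bmat t $ i $ k * lam t $ i $ j))"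
      by (rule sum.swap)
    also have "\<dots> = (\<Sum>k\<in>UNIV. n $ k * (\<Sum>i\<in>UNIV. bmat t $ i $ k * lam t $ i $ j))"
      by (simp add: sum_distrib_left)
    also have "\<dots> = (\<Sum>k\<in>UNIV. if k = j then (if j \<in> unfrozen t then d j * n $ j else 0) else 0)"
    proof (intro sum.cong refl)
      fix k
      show "n $ k * (\<Sum>i\<in>UNIV. bmat t $ i $ k * lam t $ i $ j)
          = (if k = j then (if j \<in> unfrozen t then d j * n $ j else 0) else 0)"
      proof (cases "k \<in> unfrozen t")
        case False
        then have "bmat t $ i $ k = 0" for i
          by (rule quantum_seed_frozen_col[OF assms(1)])
        then show ?thesis using False by auto
      qed (auto simp: *)
    qed
    finally show ?thesis by simp
  qed
  have "bilin (lam t) (p_star t n) m = (\<Sum>j\<in>UNIV. (\<Sum>i\<in>UNIV. p_star t n $ i * lam t $ i $ j) * m $ j)"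
    unfolding bilin_def sum_distrib_right by (rule sum.swap)
  also have "\<dots> = (\<Sum>j\<in>UNIV. if j \<in> unfrozen t then d j * n $ j * m $ j else 0)"
    unfolding col by (intro sum.cong) auto
  finally show ?thesis
    by (simp add: sum.If_cases)
qed

lemma p_star_add: "p_star t (m + n) = p_star t m + p_star t n"
  by (simp add: p_star_def matrix_vector_right_distrib)

lemma p_star_diff: "p_star t (m - n) = p_star t m - p_star t n"
  by (simp add: p_star_def matrix_vector_mult_diff_distrib)

lemma p_star_0 [simp]: "p_star t 0 = 0"
  by (simp add: p_star_def)

lemma p_star_uminus: "p_star t (- n) = - p_star t n"
  using p_star_diff[of t 0 n] by simp

lemma p_star_unit: "p_star t (unit_vec k) $ i = bmat t $ i $ k"
proof -
  have "(\<Sum>j\<in>UNIV. bmat t $ i $ j * unit_vec k $ j) = (\<Sum>j\<in>UNIV. if j = k then bmat t $ i $ k else 0)"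
    by (intro sum.cong refl) (auto simp: axis_def)
  then show ?thesis
    by (simp add: p_star_def matrix_vector_mult_def)
qed

lemma unit_vec_nth [simp]: "unit_vec i $ j = (if j = i then 1 else 0)"
  by (simp add: axis_def)

lemma bilin_p_star_unit:
  assumes "quantum_seed t" "compatible_with t d"
  shows "bilin (lam t) (p_star t n) (unit_vec i) = (if i \<in> unfrozen t then d i * n $ i else 0)"
proof -
  have "(\<Sum>k\<in>unfrozen t. d k * n $ k * unit_vec i $ k) = (\<Sum>k\<in>unfrozen t. if k = i then d i * n $ i else 0)"
    by (intro sum.cong refl) auto
  then show ?thesis
    by (simp add: bilin_p_star[OF assms])
qed

text \<open>Full rank of the exchange matrix: pairing with \<open>unit_vec i\<close> recovers
  \<open>d i * n $ i\<close>. Frozen coordinates cannot be recovered, as frozen columns of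
  \<open>bmat\<close> are zero.\<close>

lemma p_star_eqD:
  assumes "quantum_seed t" "p_star t n = p_star t n'" "i \<in> unfrozen t"
  shows "n $ i = n' $ i"
proof -
  obtain d where d: "compatible_with t d"
    using quantum_seed_compatible_with[OF assms(1)] .
  have "d i * n $ i = d i * n' $ i"
    using assms(2,3) bilin_p_star_unit[OF assms(1) d, of n i] bilin_p_star_unit[OF assms(1) d, of n' i]
    by presburger
  moreover have "d i \<noteq> 0"
    using d assms(3) by (auto simp: compatible_with_def)
  ultimately show ?thesis by simp
qed

lemma dom_le_refl [simp]: "dom_le t g g"
  unfolding dom_le_def by (rule bexI[of _ 0]) (auto simp: N_uf_nonneg_def)

lemma N_uf_add: "m \<in> N_uf_nonneg t \<Longrightarrow> n \<in> N_uf_nonneg t \<Longrightarrow> m + n \<in> N_uf_nonneg t"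
  by (auto simp: N_uf_nonneg_def)

lemma dom_le_add:
  assumes "dom_le t a b" "dom_le t a' b'"
  shows "dom_le t (a + a') (b + b')"
proof -
  obtain m n where "m \<in> N_uf_nonneg t" "a = b + p_star t m" "n \<in> N_uf_nonneg t" "a' = b' + p_star t n"
    using assms by (auto simp: dom_le_def)
  then show ?thesis
    unfolding dom_le_def by (intro bexI[of _ "m + n"]) (auto simp: p_star_add N_uf_add)
qed

lemma dom_le_trans:
  assumes "dom_le t a b" "dom_le t b c"
  shows "dom_le t a c"
  using dom_le_add[OF assms] unfolding dom_le_def by (auto simp: algebra_simps)

lemma dom_le_cancel_right [simp]: "dom_le t (a + c) (b + c) \<longleftrightarrow> dom_le t a b"
  by (auto simp: dom_le_def algebra_simps)

lemma dom_le_antisym: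
  assumes "quantum_seed t" "dom_le t a b" "dom_le t b a"
  shows "a = b"
proof -
  obtain m where m: "m \<in> N_uf_nonneg t" "a = b + p_star t m"
    using assms(2) by (auto simp: dom_le_def)
  obtain n where n: "n \<in> N_uf_nonneg t" "b = a + p_star t n"
    using assms(3) by (auto simp: dom_le_def)
  note mn = m n
  then have "p_star t (m + n) = p_star t 0"
    by (simp add: p_star_add algebra_simps)
  then have "(m + n) $ i = 0 $ i" if "i \<in> unfrozen t" for i
    using p_star_eqD[OF assms(1)] that by blast
  then have "m $ i = 0" for i
    using mn(1,3) by (cases "i \<in> unfrozen t") (auto simp: N_uf_nonneg_def add_nonneg_eq_0_iff)
  then have "m = 0" by (simp add: vec_eq_iff)
  then show ?thesis using mn by simp
qed

lemma finite_dom_maximal: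
  assumes "quantum_seed t" "finite S" "x \<in> S"
  obtains y where "y \<in> S" "dom_le t x y" "\<And>z. z \<in> S \<Longrightarrow> dom_le t y z \<Longrightarrow> z = y"
proof -
  have "asymp_on S (dom_less t)"
    by (auto simp: asymp_on_def dom_less_def dest: dom_le_antisym[OF assms(1)])
  moreover have "transp_on S (dom_less t)"
    by (auto simp: transp_on_def dom_less_def intro: dom_le_trans dest: dom_le_antisym[OF assms(1)])
  ultimately have "\<exists>y\<in>S. dom_le t x y \<and> (\<forall>z\<in>S. dom_less t y z \<longrightarrow> \<not> dom_le t x z)"
    by (intro Finite_Set.bex_max_element_with_property) (use assms in \<open>auto intro!: bexI[of _ x]\<close>)
  then obtain y where y: "y \<in> S" "dom_le t x y" "\<And>z. z \<in> S \<Longrightarrow> dom_less t y z \<Longrightarrow> \<not> dom_le t x z"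
    by auto
  show ?thesis
  proof (rule that[OF y(1,2)])
    fix z assume z: "z \<in> S" "dom_le t y z"
    then have "dom_le t x z" using y(2) dom_le_trans by blast
    then show "z = y" using y(3)[OF z(1)] z(2) by (auto simp: dom_less_def)
  qed
qed

lemma finite_dom_minimal:
  assumes "quantum_seed t" "finite S" "x \<in> S"
  obtains y where "y \<in> S" "dom_le t y x" "\<And>z. z \<in> S \<Longrightarrow> dom_le t z y \<Longrightarrow> z = y"
proof -
  \<comment> \<open>Negation reverses the order, so minimal elements are obtained from maximal
    ones.\<close>
  have neg: "dom_le t (- a) (- b) \<longleftrightarrow> dom_le t b a" for a b
    using dom_le_cancel_right[of t "- a" "a + b" "- b"] by simp
  obtain y where "y \<in> uminus ` S" "dom_le t (- x) y" "\<And>z. z \<in> uminus ` S \<Longrightarrow> dom_le t y z \<Longrightarrow> z = y"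
    using finite_dom_maximal[OF assms(1), of "uminus ` S" "- x"] assms(2,3) by auto
  then show ?thesis
    using that[of "- y"] neg by (metis add.inverse_inverse image_iff)
qed


section \<open>Leading terms\<close>

definition below :: "('i::finite, 'f::division_ring) qseed \<Rightarrow> int ^ 'i \<Rightarrow> 'f \<Rightarrow> bool" where
  "below t g Z \<longleftrightarrow> Z \<in> LP t \<and> (\<forall>m. lp_coeff t Z m \<noteq> 0 \<longrightarrow> dom_le t m g)"

text \<open>The coefficient \<open>p\<close> is arbitrary and may even be zero. Unlike pointedness,
  this notion is stable under scalars and under the twisted product, which creates powers of
  \<open>v\<close>.\<close>

definition leading :: "('i::finite, 'f::division_ring) qseed \<Rightarrow> int ^ 'i \<Rightarrow> laurent \<Rightarrow> 'f \<Rightarrow> bool" where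
  "leading t g p Z \<longleftrightarrow> below t g Z \<and> lp_coeff t Z g = p"

text \<open>In a finite support every exponent lies below a maximal one, so a unique maximal
  exponent dominates the whole support.\<close>

lemma has_degree_iff:
  assumes t: "quantum_seed t"
  shows "has_degree t g Z \<longleftrightarrow> below t g Z \<and> lp_coeff t Z g \<noteq> 0"
proof
  assume g: "has_degree t g Z"
  have "dom_le t m g" if m: "m \<in> lp_supp t Z" for m
  proof -
    obtain y where y: "y \<in> lp_supp t Z" "dom_le t m y" "\<And>z. z \<in> lp_supp t Z \<Longrightarrow> dom_le t y z \<Longrightarrow> z = y"
      by (rule finite_dom_maximal[OF t finite_lp_supp m]) (blast intro: that)
    then have "y \<in> {m \<in> lp_supp t Z. \<not> (\<exists>m'\<in>lp_supp t Z. dom_less t m m')}"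
      by (auto simp: dom_less_def)
    moreover have "{m \<in> lp_supp t Z. \<not> (\<exists>m'\<in>lp_supp t Z. dom_less t m m')} = {g}"
      using g unfolding has_degree_def by blast
    ultimately show ?thesis
      using y(2) by (simp only: singleton_iff)
  qed
  then show "below t g Z \<and> lp_coeff t Z g \<noteq> 0"
    using g by (auto simp: has_degree_def below_def lp_supp_iff)
next
  assume g: "below t g Z \<and> lp_coeff t Z g \<noteq> 0"
  then have "{m \<in> lp_supp t Z. \<not> (\<exists>m'\<in>lp_supp t Z. dom_less t m m')} = {g}"
    by (auto simp: below_def lp_supp_iff dom_less_def dest: dom_le_antisym[OF t])
  then show "has_degree t g Z"
    using g by (simp add: has_degree_def below_def)
qed

lemma pointed_iff_leading: "quantum_seed t \<Longrightarrow> pointed t g Z \<longleftrightarrow> leading t g 1 Z"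
  by (auto simp: pointed_def leading_def has_degree_iff)

lemma has_codegree_iff:
  assumes t: "quantum_seed t"
  shows "has_codegree t g Z \<longleftrightarrow>
    Z \<in> LP t \<and> (\<forall>m. lp_coeff t Z m \<noteq> 0 \<longrightarrow> dom_le t g m) \<and> lp_coeff t Z g \<noteq> 0"
proof
  assume g: "has_codegree t g Z"
  have "dom_le t g m" if m: "m \<in> lp_supp t Z" for m
  proof -
    obtain y where y: "y \<in> lp_supp t Z" "dom_le t y m" "\<And>z. z \<in> lp_supp t Z \<Longrightarrow> dom_le t z y \<Longrightarrow> z = y"
      by (rule finite_dom_minimal[OF t finite_lp_supp m]) (blast intro: that)
    then have "y \<in> {m \<in> lp_supp t Z. \<not> (\<exists>m'\<in>lp_supp t Z. dom_less t m' m)}"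
      by (auto simp: dom_less_def)
    moreover have "{m \<in> lp_supp t Z. \<not> (\<exists>m'\<in>lp_supp t Z. dom_less t m' m)} = {g}"
      using g unfolding has_codegree_def by blast
    ultimately show ?thesis
      using y(2) by (simp only: singleton_iff)
  qed
  then show "Z \<in> LP t \<and> (\<forall>m. lp_coeff t Z m \<noteq> 0 \<longrightarrow> dom_le t g m) \<and> lp_coeff t Z g \<noteq> 0"
    using g by (auto simp: has_codegree_def lp_supp_iff)
next
  assume g: "Z \<in> LP t \<and> (\<forall>m. lp_coeff t Z m \<noteq> 0 \<longrightarrow> dom_le t g m) \<and> lp_coeff t Z g \<noteq> 0"
  then have "{m \<in> lp_supp t Z. \<not> (\<exists>m'\<in>lp_supp t Z. dom_less t m' m)} = {g}"
    by (auto simp: lp_supp_iff dom_less_def dest: dom_le_antisym[OF t])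
  then show "has_codegree t g Z"
    using g by (simp add: has_codegree_def)
qed

lemma has_degree_unique: "quantum_seed t \<Longrightarrow> has_degree t g Z \<Longrightarrow> has_degree t g' Z \<Longrightarrow> g = g'"
  by (auto simp: has_degree_def)

lemma deg_eqI: "quantum_seed t \<Longrightarrow> has_degree t g Z \<Longrightarrow> deg t Z = g"
  unfolding deg_def by (rule the_equality) (auto dest: has_degree_unique)

lemma codeg_eqI: "has_codegree t g Z \<Longrightarrow> codeg t Z = g"
  unfolding codeg_def by (rule the_equality) (auto simp: has_codegree_def)

lemma leading_unique:
  assumes "quantum_seed t" "leading t g p Z" "leading t g' p' Z" "p \<noteq> 0" "p' \<noteq> 0"
  shows "g = g'"
  using assms by (metis leading_def has_degree_iff has_degree_unique)

lemma leading_frame: "quantum_seed t \<Longrightarrow> leading t u 1 (frame t u)"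
  by (auto simp: leading_def below_def lp_coeff_frame split: if_splits)

lemma leading_scale:
  assumes "quantum_seed t" "leading t g p Z"
  shows "leading t g (q * p) (scalar (vpar t) q * Z)"
proof -
  have "vpar t \<noteq> 0" using assms by (simp add: quantum_seed_def)
  then show ?thesis
    using assms by (auto simp: leading_def below_def LP_scale lp_coeff_scale)
qed

lemma leading_powi_scale:
  assumes "quantum_seed t" "leading t g p Z"
  shows "leading t g (vp a * p) (vpar t powi a * Z)"
  using leading_scale[OF assms, of "vp a"] by simp

text \<open>Only the pair \<open>(g, h)\<close> contributes at \<open>g + h\<close>: if
  \<open>m\<close> is below \<open>g\<close> and \<open>g + h - m\<close> is below \<open>h\<close>,
  antisymmetry forces \<open>m = g\<close>.\<close>

lemma leading_mult:
  assumes t: "quantum_seed t" and Z: "leading t g p Z" and W: "leading t h q W"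
  shows "leading t (g + h) (vp (bilin (lam t) g h) * (p * q)) (Z * W)"
proof -
  have LP: "Z \<in> LP t" "W \<in> LP t"
    using Z W by (auto simp: leading_def below_def)
  note coeff = lp_coeff_mult[OF t LP]
  have "dom_le t x (g + h)" if nz: "lp_coeff t (Z * W) x \<noteq> 0" for x
  proof -
    obtain m where "lp_coeff t Z m * (vp (bilin (lam t) m (x - m)) * lp_coeff t W (x - m)) \<noteq> 0"
      using nz unfolding coeff by (rule sum.not_neutral_contains_not_neutral)
    then have "dom_le t m g" "dom_le t (x - m) h"
      using Z W by (auto simp: leading_def below_def)
    then show ?thesis
      using dom_le_add[of t m g "x - m" h] by simp
  qed
  moreover have "lp_coeff t (Z * W) (g + h) = vp (bilin (lam t) g h) * (p * q)"
  proof -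
    have "m = g" if "m \<in> lp_supp t Z" "lp_coeff t W (g + h - m) \<noteq> 0" for m
    proof -
      have "dom_le t m g" "dom_le t (g + h - m) h"
        using Z W that by (auto simp: leading_def below_def lp_supp_iff)
      moreover from this(2) have "dom_le t g m"
        using dom_le_cancel_right[of t "g + h - m" "m - h" h] by simp
      ultimately show ?thesis
        using dom_le_antisym[OF t] by blast
    qed
    then have "lp_coeff t (Z * W) (g + h) = (\<Sum>m\<in>lp_supp t Z.
        if m = g then p * (vp (bilin (lam t) g h) * q) else 0)"
      unfolding coeff using Z W by (intro sum.cong refl) (auto simp: leading_def)
    also have "\<dots> = p * (vp (bilin (lam t) g h) * q)"
      using Z by (simp add: lp_supp_iff leading_def)
    finally show ?thesis by (simp add: mult_ac)
  qed
  ultimately show ?thesis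
    using LP_mult[OF quantum_seed_torus[OF t] LP] by (simp add: leading_def below_def)
qed

text \<open>Terms with distinct degrees cannot cancel at a maximal degree.\<close>

lemma leading_lincomb_maximal:
  assumes t: "quantum_seed t" and fin: "finite {x. c x \<noteq> 0}"
    and Y: "\<And>x. c x \<noteq> 0 \<Longrightarrow> leading t (\<delta> x) (p x) (Y x)"
    and inj: "inj_on \<delta> {x. c x \<noteq> 0}"
    and x: "c x \<noteq> 0" and max: "\<And>y. c y \<noteq> 0 \<Longrightarrow> dom_le t (\<delta> x) (\<delta> y) \<Longrightarrow> \<delta> y = \<delta> x"
  shows "lp_coeff t (lincomb (vpar t) Y c) (\<delta> x) = c x * p x"
proof -
  have v0: "vpar t \<noteq> 0" using t by (simp add: quantum_seed_def)
  have LP: "Y y \<in> LP t" if "c y \<noteq> 0" for y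
    using Y[OF that] by (simp add: leading_def below_def)
  have "lp_coeff t (lincomb (vpar t) Y c) (\<delta> x) = (\<Sum>y | c y \<noteq> 0. c y * lp_coeff t (Y y) (\<delta> x))"
    unfolding lincomb_def
    by (subst lp_coeff_sum[OF t]) (use LP v0 in \<open>auto simp: LP_scale lp_coeff_scale[OF t]\<close>)
  also have "\<dots> = (\<Sum>y | c y \<noteq> 0. if y = x then c x * p x else 0)"
  proof (intro sum.cong refl)
    fix y assume y: "y \<in> {y. c y \<noteq> 0}"
    show "c y * lp_coeff t (Y y) (\<delta> x) = (if y = x then c x * p x else 0)"
    proof (cases "y = x")
      case False
      then have "\<delta> y \<noteq> \<delta> x" using inj x y by (auto dest: inj_onD)
      then have "lp_coeff t (Y y) (\<delta> x) = 0"
        using Y[of y] max[of y] y by (auto simp: leading_def below_def)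
      then show ?thesis using False by simp
    qed (use Y x in \<open>auto simp: leading_def\<close>)
  qed
  also have "\<dots> = c x * p x"
    using fin x by simp
  finally show ?thesis .
qed

lemma leading_lincomb_exists_maximal:
  assumes t: "quantum_seed t" and fin: "finite {x. c x \<noteq> 0}" and x: "c x \<noteq> (0::laurent)"
  obtains y where "c y \<noteq> 0" "dom_le t (\<delta> x) (\<delta> y)"
    "\<And>z. c z \<noteq> 0 \<Longrightarrow> dom_le t (\<delta> y) (\<delta> z) \<Longrightarrow> \<delta> z = \<delta> y"
proof -
  have "finite (\<delta> ` {x. c x \<noteq> 0})" "\<delta> x \<in> \<delta> ` {x. c x \<noteq> 0}"
    using fin x by auto
  then show ?thesis
    by (rule finite_dom_maximal[OF t]) (use that in blast)
qed

text \<open>Above \<open>\<delta> x\<close> there is a maximal \<open>\<delta> y\<close>. Nothing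
  cancels there, so \<open>\<delta> y\<close> occurs in the combination and must lie below
  \<open>g\<close>.\<close>

lemma below_lincombD:
  assumes t: "quantum_seed t" and fin: "finite {x. c x \<noteq> 0}"
    and Y: "\<And>x. c x \<noteq> 0 \<Longrightarrow> leading t (\<delta> x) (p x) (Y x) \<and> p x \<noteq> 0"
    and inj: "inj_on \<delta> {x. c x \<noteq> 0}"
    and below: "below t g (lincomb (vpar t) Y c)" and x: "c x \<noteq> 0"
  shows "dom_le t (\<delta> x) g"
proof -
  obtain y where y: "c y \<noteq> 0" "dom_le t (\<delta> x) (\<delta> y)"
    "\<And>z. c z \<noteq> 0 \<Longrightarrow> dom_le t (\<delta> y) (\<delta> z) \<Longrightarrow> \<delta> z = \<delta> y"
    using leading_lincomb_exists_maximal[OF t fin x, where \<delta> = \<delta>] by blast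
  have "lp_coeff t (lincomb (vpar t) Y c) (\<delta> y) = c y * p y"
    by (rule leading_lincomb_maximal[OF t fin _ inj y(1)]) (blast dest: Y, rule y(3))
  also have "\<dots> \<noteq> 0" using Y[OF y(1)] y(1) by simp
  finally have "dom_le t (\<delta> y) g" using below by (simp add: below_def)
  then show ?thesis using y dom_le_trans by blast
qed

text \<open>Linear independence of elements with pairwise distinct degrees, read off at a maximal
  degree.\<close>

lemma lincomb_leading_eq_0:
  assumes t: "quantum_seed t" and fin: "finite {x. c x \<noteq> 0}"
    and Y: "\<And>x. c x \<noteq> 0 \<Longrightarrow> leading t (\<delta> x) (p x) (Y x) \<and> p x \<noteq> 0"
    and inj: "inj_on \<delta> {x. c x \<noteq> 0}"
    and 0: "lincomb (vpar t) Y c = 0"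
  shows "c x = 0"
proof (rule ccontr)
  assume "c x \<noteq> 0"
  then obtain y where y: "c y \<noteq> 0"
    "\<And>z. c z \<noteq> 0 \<Longrightarrow> dom_le t (\<delta> y) (\<delta> z) \<Longrightarrow> \<delta> z = \<delta> y"
    using leading_lincomb_exists_maximal[OF t fin, where \<delta> = \<delta>] by blast
  have "lp_coeff t (lincomb (vpar t) Y c) (\<delta> y) = c y * p y"
    by (rule leading_lincomb_maximal[OF t fin _ inj y(1)]) (blast dest: Y, rule y(2))
  then show False using Y[OF y(1)] y(1) 0 by (simp add: lp_coeff_0[OF t])
qed


section \<open>Mutation of quantum seeds\<close>

lemma bilin_0 [simp]: "bilin M 0 b = 0" "bilin M a 0 = 0"
  by (simp_all add: bilin_def)

lemma bilin_scale_left: "bilin M (c *s a) b = c * bilin M a b"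
  by (simp add: bilin_def sum_distrib_left mult_ac)

lemma bilin_scale_right: "bilin M a (c *s b) = c * bilin M a b"
  by (simp add: bilin_def sum_distrib_left mult_ac)

lemma bilin_uminus_left: "bilin M (- a) b = - bilin M a b"
  by (simp add: bilin_def sum_negf)

lemma bilin_uminus_right: "bilin M a (- b) = - bilin M a b"
  by (simp add: bilin_def sum_negf)

lemma bilin_diff_left: "bilin M (a - b) c = bilin M a c - bilin M b c"
  using bilin_add_left[of M a "- b" c] by (simp add: bilin_uminus_left)

lemma bilin_diff_right: "bilin M c (a - b) = bilin M c a - bilin M c b"
  using bilin_add_right[of M c a "- b"] by (simp add: bilin_uminus_right)

lemma bilin_self: "quantum_seed t \<Longrightarrow> bilin (lam t) a a = 0"
  using quantum_seed_skew[of t a a] by simp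

lemma bilin_unit: "bilin M (unit_vec i) (unit_vec j) = M $ i $ j"
proof -
  have "(\<Sum>j'\<in>UNIV. M $ i $ j' * unit_vec j $ j') = (\<Sum>j'\<in>UNIV. if j' = j then M $ i $ j else 0)"
    by (intro sum.cong refl) auto
  then show ?thesis by (simp add: bilin_axis_left)
qed

lemma transpose_mult_eq_bilin:
  "(transpose (bmat t) ** lam t) $ k $ j = bilin (lam t) (p_star t (unit_vec k)) (unit_vec j)"
proof -
  have "(\<Sum>j'\<in>UNIV. bmat t $ i $ k * lam t $ i $ j' * unit_vec j $ j')
      = (\<Sum>j'\<in>UNIV. if j' = j then bmat t $ i $ k * lam t $ i $ j else 0)" for i
    by (intro sum.cong refl) auto
  then show ?thesis
    by (simp add: bilin_def p_star_unit matrix_matrix_mult_def transpose_def)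
qed

lemma bilin_p_star_unit_left:
  assumes "quantum_seed t" "compatible_with t d" "k \<in> unfrozen t"
  shows "bilin (lam t) (p_star t (unit_vec k)) m = d k * m $ k"
proof -
  have "(\<Sum>j\<in>unfrozen t. d j * unit_vec k $ j * m $ j) = (\<Sum>j\<in>unfrozen t. if j = k then d k * m $ k else 0)"
    by (intro sum.cong refl) auto
  then show ?thesis
    using assms by (simp add: bilin_p_star[OF assms(1,2)])
qed

text \<open>Evaluates \<lambda> on two columns of \<open>bmat\<close> in both orders.\<close>

lemma bmat_skew:
  assumes "quantum_seed t" "compatible_with t d" "k \<in> unfrozen t" "j \<in> unfrozen t"
  shows "d k * bmat t $ k $ j = - (d j * bmat t $ j $ k)"
  using bilin_p_star_unit_left[OF assms(1,2,3), of "p_star t (unit_vec j)"]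
    bilin_p_star_unit_left[OF assms(1,2,4), of "p_star t (unit_vec k)"]
    quantum_seed_skew[OF assms(1), of "p_star t (unit_vec j)" "p_star t (unit_vec k)"]
  by (simp add: p_star_unit)

lemma bmat_diag:
  assumes "quantum_seed t"
  shows "bmat t $ k $ k = 0"
proof (cases "k \<in> unfrozen t")
  case True
  obtain d where d: "compatible_with t d"
    using quantum_seed_compatible_with[OF assms] .
  show ?thesis
    using bmat_skew[OF assms d True True] d True by (auto simp: compatible_with_def)
qed (use assms in \<open>simp add: quantum_seed_frozen_col\<close>)

lemma pos_part_diff: "pos_part a - pos_part (- a) = a"
  by (simp add: pos_part_def max_def)

lemma pos_part_nonneg [simp]: "pos_part a \<ge> 0"
  by (simp add: pos_part_def)

lemma pos_part_0 [simp]: "pos_part 0 = 0"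
  by (simp add: pos_part_def)

lemma pos_part_mult: "d \<ge> 0 \<Longrightarrow> d * pos_part a = pos_part (d * a)"
  by (simp add: pos_part_def max_def mult_le_0_iff zero_le_mult_iff)

lemma mutate_simps [simp]:
  "unfrozen (mutate k t) = unfrozen t" "vpar (mutate k t) = vpar t"
  "bmat (mutate k t) = mutate_bmat k t" "lam (mutate k t) = mutate_lam k t"
  "frame (mutate k t) = mutate_frame k t"
  by (simp_all add: mutate_def)

text \<open>The exponent of the leading term of \<open>X(t')\<^sup>m\<close> in \<open>t\<close>, where \<open>t' = \<mu>\<^sub>k t\<close>.\<close>

definition lift :: "'i \<Rightarrow> ('i::finite, 'f) qseed \<Rightarrow> int ^ 'i \<Rightarrow> int ^ 'i" where
  "lift k t m = drop_coord k m + (m $ k) *s exch_minus k t"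

lemma lift_nth:
  assumes "quantum_seed t"
  shows "lift k t m $ i = (if i = k then - m $ k else m $ i + m $ k * pos_part (- bmat t $ i $ k))"
  by (simp add: lift_def drop_coord_def exch_minus_def bmat_diag[OF assms])

lemma drop_coord_plus_unit: "m = drop_coord k m + (m $ k) *s unit_vec k"
  by (simp add: vec_eq_iff drop_coord_def)

text \<open>The mutated form is the old one after a change of basis, so that later computations with
  \<open>mutate_lam\<close> become linear algebra in \<open>t\<close>.\<close>

lemma bilin_mutate:
  assumes t: "quantum_seed t" and k: "k \<in> unfrozen t"
  shows "bilin (mutate_lam k t) m m' = bilin (lam t) (lift k t m) (lift k t m')"
proof -
  have 1: "bilin (mutate_lam k t) (unit_vec k) (drop_coord k a) = bilin (lam t) (exch_minus k t) (drop_coord k a)" for a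
    using bilin_mutate_lam[OF k, where a = "drop_coord k a" and x = 1] by simp
  have 2: "bilin (mutate_lam k t) (drop_coord k a) (unit_vec k) = - bilin (lam t) (exch_minus k t) (drop_coord k a)" for a
    using bilin_skew[of "mutate_lam k t" "drop_coord k a" "unit_vec k", OF mutate_lam_skew[OF t]] 1
    by simp
  have 3: "bilin (lam t) (drop_coord k a) (exch_minus k t) = - bilin (lam t) (exch_minus k t) (drop_coord k a)" for a
    by (rule quantum_seed_skew[OF t])
  have 4: "bilin (mutate_lam k t) (unit_vec k) (unit_vec k) = 0"
    by (simp add: bilin_unit mutate_lam_def)
  have "bilin (mutate_lam k t) m m' = bilin (mutate_lam k t)
      (drop_coord k m + (m $ k) *s unit_vec k) (drop_coord k m' + (m' $ k) *s unit_vec k)"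
    by (simp only: drop_coord_plus_unit[symmetric])
  then show ?thesis
    unfolding lift_def bilin_add_left bilin_add_right bilin_scale_left bilin_scale_right 1 2 3 4
      bilin_self[OF t]
    by (simp add: bilin_mutate_lam_drop)
qed

text \<open>After the change of basis, matrix mutation is a column operation: column
  \<open>k\<close> changes sign and multiples of it are added to the other columns.\<close>

lemma lift_p_star:
  assumes t: "quantum_seed t"
  shows "lift k t (p_star (mutate k t) (unit_vec j)) =
    (if j = k then - p_star t (unit_vec k)
     else p_star t (unit_vec j) + pos_part (bmat t $ k $ j) *s p_star t (unit_vec k))"
proof -
  have "lift k t (p_star (mutate k t) (unit_vec j)) $ i =
    (if j = k then - p_star t (unit_vec k)
     else p_star t (unit_vec j) + pos_part (bmat t $ k $ j) *s p_star t (unit_vec k)) $ i" for i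
  proof -
    have "bmat t $ i $ k = pos_part (bmat t $ i $ k) - pos_part (- bmat t $ i $ k)"
      "bmat t $ k $ j = pos_part (bmat t $ k $ j) - pos_part (- bmat t $ k $ j)"
      by (simp_all add: pos_part_diff)
    then have "pos_part (bmat t $ i $ k) * pos_part (bmat t $ k $ j)
        - pos_part (- bmat t $ i $ k) * pos_part (- bmat t $ k $ j)
        - bmat t $ k $ j * pos_part (- bmat t $ i $ k) = pos_part (bmat t $ k $ j) * bmat t $ i $ k"
      by algebra
    then show ?thesis
      by (simp add: lift_nth[OF t] p_star_unit mutate_bmat_def bmat_diag[OF t])
  qed
  then show ?thesis by (simp add: vec_eq_iff)
qed

lemma compatible_with_mutate:
  assumes t: "quantum_seed t" and d: "compatible_with t d" and k: "k \<in> unfrozen t"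
  shows "compatible_with (mutate k t) d"
proof -
  have dpos: "d j > 0" if "j \<in> unfrozen t" for j
    using d that by (simp add: compatible_with_def)
  have "bilin (lam (mutate k t)) (p_star (mutate k t) (unit_vec j)) (unit_vec i) = (if i = j then d j else 0)"
    if j: "j \<in> unfrozen t" for i j
  proof -
    have lift_unit: "lift k t (unit_vec i) $ l =
        (if i = k then (if l = k then - 1 else pos_part (- bmat t $ l $ k)) else if l = i then 1 else 0)" for l
      by (auto simp: lift_nth[OF t])
    show ?thesis
    proof (cases "j = k")
      case True
      then show ?thesis
        by (simp add: bilin_mutate[OF t k] lift_p_star[OF t] bilin_uminus_left
            bilin_p_star_unit_left[OF t d k] lift_unit)
    next
      case False
      \<comment> \<open>For \<open>i = k\<close> the pairing has two contributions, one from each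
        column, and this equality makes them cancel.\<close>
      have "d j * pos_part (- bmat t $ j $ k) = d k * pos_part (bmat t $ k $ j)"
        using bmat_skew[OF t d k j] dpos[OF j] dpos[OF k] by (simp add: pos_part_mult)
      then show ?thesis
        using False by (simp add: bilin_mutate[OF t k] lift_p_star[OF t] bilin_add_left bilin_scale_left
            bilin_p_star_unit_left[OF t d k] bilin_p_star_unit_left[OF t d j] lift_unit)
    qed
  qed
  then show ?thesis
    unfolding compatible_with_def transpose_mult_eq_bilin using dpos by auto
qed

lemma frame_mutate_zero_coord:
  assumes "u $ k = 0"
  shows "mutate_frame k t u = frame t u"
proof -
  have "drop_coord k u = u"
    using assms by (auto simp: vec_eq_iff drop_coord_def)
  then show ?thesis
    using assms by (simp add: mutate_frame_def bilin_axis_left)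
qed

lemma frame_mutate_minus_unit:
  assumes "quantum_seed t" "k \<in> unfrozen t" "u $ k = 0"
  shows "mutate_frame k t (- unit_vec k + u) =
    vpar t powi bilin (lam t) (exch_minus k t) u * (inverse (mutate_var k t) * frame t u)"
proof -
  have "drop_coord k (- unit_vec k + u) = u"
    using assms by (auto simp: vec_eq_iff drop_coord_def)
  then show ?thesis
    using assms by (simp add: mutate_frame_def bilin_mutate_lam power_int_minus)
qed

lemma torus_frame_mutate:
  assumes t: "quantum_seed t" and k: "k \<in> unfrozen t"
  shows "torus_frame (mutate k t)"
proof -
  have "mutate_frame k t 0 = 1"
    using frame_mutate_zero_coord[of 0 k t] t by (simp add: quantum_seed_def)
  then show ?thesis
    using frame_mutate_mult[OF t k] t by (simp add: torus_frame_def quantum_seed_def)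
qed

section \<open>Exchange relations and the reverse mutation\<close>

definition neg_col :: "'i \<Rightarrow> ('i::finite, 'f) qseed \<Rightarrow> int ^ 'i" where
  "neg_col k t = (\<chi> i. pos_part (- bmat t $ i $ k))"

definition pos_col :: "'i \<Rightarrow> ('i::finite, 'f) qseed \<Rightarrow> int ^ 'i" where
  "pos_col k t = (\<chi> i. pos_part (bmat t $ i $ k))"

lemma pos_neg_col_nth [simp]:
  "neg_col k t $ i = pos_part (- bmat t $ i $ k)" "pos_col k t $ i = pos_part (bmat t $ i $ k)"
  by (simp_all add: neg_col_def pos_col_def)

lemma exch_eq_col: "exch_minus k t = - unit_vec k + neg_col k t" "exch_plus k t = - unit_vec k + pos_col k t"
  by (simp_all add: exch_minus_def exch_plus_def neg_col_def pos_col_def)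

lemma pos_col_eq: "pos_col k t = neg_col k t + p_star t (unit_vec k)"
  by (simp add: vec_eq_iff p_star_unit pos_part_def max_def)

lemma exch_plus_eq: "exch_plus k t = exch_minus k t + p_star t (unit_vec k)"
  by (simp add: exch_eq_col pos_col_eq)

lemma exchange_relation:
  assumes t: "quantum_seed t" and k: "k \<in> unfrozen t"
  shows "mutate_var k t * frame t (unit_vec k) =
    vpar t powi bilin (lam t) (exch_minus k t) (neg_col k t) * frame t (neg_col k t) +
    vpar t powi bilin (lam t) (exch_minus k t) (pos_col k t) * frame t (pos_col k t)"
proof -
  note qt = quantum_seed_torus[OF t]
  have minus: "neg_col k t = exch_minus k t + unit_vec k"
    and plus: "pos_col k t = exch_plus k t + unit_vec k"
    by (simp_all add: exch_eq_col)
  have 1: "bilin (lam t) (exch_minus k t) (neg_col k t) = bilin (lam t) (exch_minus k t) (unit_vec k)"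
    unfolding minus by (simp only: bilin_add_right bilin_self[OF t])
  \<comment> \<open>\<open>pos_col k t\<close> vanishes at \<open>k\<close>, so both exchange
    exponents pair with it alike; this allows both powers of \<open>v\<close> to be written with
    \<open>exch_minus\<close>.\<close>
  have "bilin (lam t) (exch_minus k t) (pos_col k t) = bilin (lam t) (exch_plus k t) (pos_col k t)"
    by (rule bilin_exch[OF t k, symmetric]) (simp add: bmat_diag[OF t])
  also have "\<dots> = bilin (lam t) (exch_plus k t) (unit_vec k)"
    unfolding plus by (simp only: bilin_add_right bilin_self[OF t])
  finally show ?thesis
    using 1 unfolding mutate_var_def distrib_right torus_frame_mult[OF qt] plus[symmetric] minus[symmetric]
    by simp
qed

text \<open>The exchange relation divided by the mutated variable: column \<open>k\<close> changes
  sign under mutation, so the two exchange monomials only swap places.\<close>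

lemma mutate_var_mutate:
  assumes t: "quantum_seed t" and k: "k \<in> unfrozen t"
  shows "mutate_var k (mutate k t) = frame t (unit_vec k)"
proof -
  let ?X = "mutate_var k t"
  note qt = quantum_seed_torus[OF t]
  have e: "exch_minus k (mutate k t) = - unit_vec k + pos_col k t"
    "exch_plus k (mutate k t) = - unit_vec k + neg_col k t"
    by (simp_all add: exch_minus_def exch_plus_def vec_eq_iff mutate_bmat_def)
  have "mutate_var k (mutate k t) =
      vpar t powi bilin (lam t) (exch_minus k t) (pos_col k t) * (inverse ?X * frame t (pos_col k t)) +
      vpar t powi bilin (lam t) (exch_minus k t) (neg_col k t) * (inverse ?X * frame t (neg_col k t))"
    unfolding mutate_var_def[of k "mutate k t"] e mutate_simps
    by (subst (1 2) frame_mutate_minus_unit[OF t k]) (simp_all add: bmat_diag[OF t])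
  also have "\<dots> = inverse ?X * (?X * frame t (unit_vec k))"
    unfolding exchange_relation[OF t k] distrib_left
    by (simp only: mult.assoc[symmetric] torus_powi_commute[OF qt, of _ "inverse ?X"] add.commute)
  also have "\<dots> = frame t (unit_vec k)"
    using mutate_var_nonzero[OF t k] by (simp add: mult.assoc[symmetric])
  finally show ?thesis .
qed

text \<open>The old variable at \<open>k\<close> is a sum of two monomials in the new torus, so its
  nonnegative powers remain Laurent there; all other variables are shared.\<close>

lemma frame_mem_LP_mutate:
  assumes t: "quantum_seed t" and k: "k \<in> unfrozen t" and m: "m $ k \<ge> 0"
  shows "frame t m \<in> LP (mutate k t)"
proof -
  note qt = quantum_seed_torus[OF t] and qt' = torus_frame_mutate[OF t k]
  have v0: "vpar t \<noteq> 0" using t by (simp add: quantum_seed_def)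
  have unit: "frame t (unit_vec k) \<in> LP (mutate k t)"
    unfolding mutate_var_mutate[OF t k, symmetric] mutate_var_def by (intro LP_add LP_frame)
  have zero: "frame t u \<in> LP (mutate k t)" if "u $ k = 0" for u
    using LP_frame[of "mutate k t" u] frame_mutate_zero_coord[OF that, of t] by simp
  have pow: "frame t (int n *s unit_vec k) \<in> LP (mutate k t)" for n
  proof (induction n)
    case 0
    then show ?case by (intro zero) simp
  next
    case (Suc n)
    have "frame t (int n *s unit_vec k) * frame t (unit_vec k) = frame t (int (Suc n) *s unit_vec k)"
      by (simp add: torus_frame_mult[OF qt] bilin_scale_left bilin_self[OF t]
          vector_sadd_rdistrib add.commute)
    then show ?case
      using LP_mult[OF qt' Suc unit] by simp
  qed
  have "frame t m = vpar t powi (- bilin (lam t) ((m $ k) *s unit_vec k) (drop_coord k m)) *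
      (frame t ((m $ k) *s unit_vec k) * frame t (drop_coord k m))"
    using v0 by (simp add: torus_frame_mult[OF qt] mult.assoc[symmetric] torus_powi_add[OF qt]
        add.commute[of _ "drop_coord k m"] drop_coord_plus_unit[symmetric])
  moreover have "frame t ((m $ k) *s unit_vec k) \<in> LP (mutate k t)"
    using pow[of "nat (m $ k)"] m by simp
  ultimately show ?thesis
    using LP_powi_scale[OF LP_mult[OF qt' _ zero], of "frame t ((m $ k) *s unit_vec k)"] v0
    by simp
qed

lemma LP_times_frame_mem_LP_mutate:
  assumes t: "quantum_seed t" and k: "k \<in> unfrozen t" and a: "a \<in> LP t"
  obtains N :: nat where "\<And>n. n \<ge> N \<Longrightarrow> a * frame t (int n *s unit_vec k) \<in> LP (mutate k t)"
proof
  note qt = quantum_seed_torus[OF t]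
  have v0: "vpar t \<noteq> 0" using t by (simp add: quantum_seed_def)
  \<comment> \<open>\<open>N\<close> outweighs every negative exponent at \<open>k\<close>; the
    inserted 0 keeps the maximum meaningful for an empty support.\<close>
  define N where "N = nat (Max (insert 0 ((\<lambda>m. - m $ k) ` lp_supp t a)))"
  fix n assume n: "n \<ge> N"
  have nonneg: "m $ k + int n \<ge> 0" if "m \<in> lp_supp t a" for m
  proof -
    have "- m $ k \<le> Max (insert 0 ((\<lambda>m. - m $ k) ` lp_supp t a))"
      using that by (intro Max_ge) auto
    then show ?thesis using n by (simp add: N_def)
  qed
  have "a * frame t (int n *s unit_vec k) = (\<Sum>m\<in>lp_supp t a. scalar (vpar t) (lp_coeff t a m) *
      (vpar t powi bilin (lam t) m (int n *s unit_vec k) * frame t (m + int n *s unit_vec k)))"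
    by (subst LP_expand[OF t a]) (simp add: sum_distrib_right mult.assoc torus_frame_mult[OF qt])
  moreover have "frame t (m + int n *s unit_vec k) \<in> LP (mutate k t)" if "m \<in> lp_supp t a" for m
    using nonneg[OF that] by (intro frame_mem_LP_mutate[OF t k]) simp
  ultimately show "a * frame t (int n *s unit_vec k) \<in> LP (mutate k t)"
    using LP_scale[of _ "mutate k t"] LP_powi_scale[of _ "mutate k t"] v0 by (auto intro!: LP_sum)
qed

lemma leading_mutate_var:
  assumes t: "quantum_seed t" and k: "k \<in> unfrozen t"
  shows "leading t (exch_minus k t) 1 (mutate_var k t)"
proof -
  have "p_star t (unit_vec k) \<noteq> p_star t 0"
    using p_star_eqD[OF t, of "unit_vec k" 0 k] k by auto
  then have ne: "exch_plus k t \<noteq> exch_minus k t"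
    by (simp add: exch_plus_eq)
  have "dom_le t (exch_plus k t) (exch_minus k t)"
    unfolding dom_le_def exch_plus_eq
    by (rule bexI[of _ "unit_vec k"]) (use k in \<open>auto simp: N_uf_nonneg_def\<close>)
  then show ?thesis
    using ne by (auto simp: leading_def below_def mutate_var_def lp_coeff_add[OF t] lp_coeff_frame[OF t]
        LP_add split: if_splits)
qed

section \<open>Linear independence and fractions in the mutated torus\<close>

lemma leading_power:
  assumes t: "quantum_seed t" and Z: "leading t g 1 Z"
  shows "leading t (int n *s g) 1 (Z ^ n)"
proof (induction n)
  case 0
  have "frame t 0 = 1" using t by (simp add: quantum_seed_def)
  then show ?case using leading_frame[OF t, of 0] by simp
next
  case (Suc n)
  have "leading t (g + int n *s g) (vp (bilin (lam t) g (int n *s g)) * (1 * 1)) (Z * Z ^ n)"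
    by (rule leading_mult[OF t Z Suc])
  then show ?case
    by (simp add: bilin_scale_right bilin_self[OF t] vector_sadd_rdistrib)
qed

text \<open>A linear relation among new monomials is multiplied by a power of the mutated variable.
  Then only nonnegative powers of it occur, the terms have leading terms in \<open>t\<close> with
  distinct degrees, and they are independent.\<close>

lemma inj_laurent_expand_mutate:
  assumes t: "quantum_seed t" and k: "k \<in> unfrozen t"
  shows "inj (laurent_expand (mutate k t))"
proof -
  let ?X = "mutate_var k t"
  note qt = quantum_seed_torus[OF t]
  have v0: "vpar t \<noteq> 0" using t by (simp add: quantum_seed_def)
  have X0: "?X \<noteq> 0" by (rule mutate_var_nonzero[OF t k])
  have ker: "c = (\<lambda>_. 0)" if fin: "finite {m. c m \<noteq> 0}" and 0: "lincomb (vpar t) (mutate_frame k t) c = 0"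
    for c :: "int ^ 'a \<Rightarrow> laurent"
  proof -
    define N where "N = nat (Max (insert 0 ((\<lambda>m. - m $ k) ` {m. c m \<noteq> 0})))"
    have nonneg: "m $ k + int N \<ge> 0" if "c m \<noteq> 0" for m
    proof -
      have "- m $ k \<le> Max (insert 0 ((\<lambda>m. - m $ k) ` {m. c m \<noteq> 0}))"
        using that fin by (intro Max_ge) auto
      then show ?thesis by (simp add: N_def)
    qed
    define Y where "Y m = ?X ^ N * mutate_frame k t m" for m
    define e where "e m = - bilin (mutate_lam k t) (axis k (m $ k)) (drop_coord k m)" for m
    define n where "n m = nat (m $ k + int N)" for m
    define \<delta> where "\<delta> m = int (n m) *s exch_minus k t + drop_coord k m" for m
    have Y: "Y m = vpar t powi e m * (?X ^ n m * frame t (drop_coord k m))" if "c m \<noteq> 0" for m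
    proof -
      have "?X ^ N * ?X powi (m $ k) = ?X powi (int N + m $ k)"
        using X0 by (simp add: power_int_add)
      also have "\<dots> = ?X ^ n m"
        using nonneg[OF that] by (simp add: n_def power_int_def add.commute)
      finally have *: "?X ^ N * ?X powi (m $ k) = ?X ^ n m" .
      have "Y m = vpar t powi e m * (?X ^ N * ?X powi (m $ k) * frame t (drop_coord k m))"
        unfolding Y_def mutate_frame_def e_def[symmetric]
        by (metis mult.assoc torus_powi_commute[OF qt])
      then show ?thesis by (simp add: *)
    qed
    have lead: "\<exists>p. leading t (\<delta> m) p (Y m) \<and> p \<noteq> 0" if "c m \<noteq> 0" for m
      using leading_powi_scale[OF t leading_mult[OF t
            leading_power[OF t leading_mutate_var[OF t k], of "n m"] leading_frame[OF t, of "drop_coord k m"]], of "e m"]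
      unfolding \<delta>_def Y[OF that]
      by (intro exI conjI, assumption) (simp add: vp_add)
    then obtain p where p: "\<And>m. c m \<noteq> 0 \<Longrightarrow> leading t (\<delta> m) (p m) (Y m) \<and> p m \<noteq> 0"
      by metis
    have inj: "inj_on \<delta> {m. c m \<noteq> 0}"
    proof (rule inj_onI)
      fix m m' assume mm: "m \<in> {m. c m \<noteq> 0}" "m' \<in> {m. c m \<noteq> 0}" "\<delta> m = \<delta> m'"
      \<comment> \<open>\<open>exch_minus k t\<close> has coordinate -1 at \<open>k\<close>, so
        \<open>\<delta> m\<close> determines the power of the mutated variable and then the
        remaining exponents.\<close>
      have "\<delta> m $ k = - int (n m)" for m
        by (simp add: \<delta>_def exch_minus_def bmat_diag[OF t])
      then have "n m = n m'" using mm(3) by (metis neg_equal_iff_equal of_nat_eq_iff)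
      then have "m $ k = m' $ k" "drop_coord k m = drop_coord k m'"
        using nonneg[of m] nonneg[of m'] mm by (simp_all add: n_def \<delta>_def eq_nat_nat_iff)
      then show "m = m'" by (metis drop_coord_plus_unit)
    qed
    have "lincomb (vpar t) Y c = ?X ^ N * lincomb (vpar t) (mutate_frame k t) c"
      unfolding lincomb_def Y_def sum_distrib_left
      by (intro sum.cong refl) (metis mult.assoc torus_scalar_central[OF qt])
    then have "lincomb (vpar t) Y c = 0" using 0 by simp
    then show ?thesis
      using lincomb_leading_eq_0[OF t fin p inj] by auto
  qed
  show ?thesis
  proof (rule injI)
    fix c c' assume eq: "laurent_expand (mutate k t) c = laurent_expand (mutate k t) c'"
    have "Poly_Mapping.lookup c = (\<lambda>m. Poly_Mapping.lookup (c - c') m + Poly_Mapping.lookup c' m)"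
      by (simp add: fun_eq_iff lookup_minus)
    then have "laurent_expand (mutate k t) c = laurent_expand (mutate k t) (c - c') + laurent_expand (mutate k t) c'"
      unfolding laurent_expand_lincomb by (simp add: lincomb_add finite_lookup)
    then have "lincomb (vpar t) (mutate_frame k t) (Poly_Mapping.lookup (c - c')) = 0"
      using eq by (simp add: laurent_expand_lincomb)
    then have "Poly_Mapping.lookup (c - c') = (\<lambda>_. 0)"
      by (intro ker) (auto simp: finite_lookup)
    then have "c - c' = 0" by (intro poly_mapping_eqI) simp
    then show "c = c'" by simp
  qed
qed

lemma quantum_seed_mutate:
  assumes t: "quantum_seed t" and k: "k \<in> unfrozen t"
  shows "quantum_seed (mutate k t)"
proof -
  obtain d where "compatible_with t d"
    using quantum_seed_compatible_with[OF t] .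
  then have d: "compatible_with (mutate k t) d"
    by (rule compatible_with_mutate[OF t _ k])
  have "compatible_pair (unfrozen (mutate k t)) (bmat (mutate k t)) (lam (mutate k t))"
    unfolding compatible_pair_def
  proof (intro conjI allI)
    show "lam (mutate k t) $ j $ i = - lam (mutate k t) $ i $ j" for i j
      using mutate_lam_skew[OF t, of k j i] by simp
    show "\<exists>d. \<forall>k'\<in>unfrozen (mutate k t). 0 < d k' \<and>
        (\<forall>j. (transpose (bmat (mutate k t)) ** lam (mutate k t)) $ k' $ j = (if j = k' then d k' else 0))"
      using d unfolding compatible_with_def by blast
  qed
  moreover have "bmat (mutate k t) $ i $ j = 0" if "j \<notin> unfrozen t" for i j
    using quantum_seed_frozen_col[OF t that] k that by (auto simp: mutate_bmat_def)
  moreover have "\<exists>a\<in>LP (mutate k t). \<exists>s\<in>LP (mutate k t). s \<noteq> 0 \<and> x = a * inverse s" for x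
  proof -
    obtain a s where as: "a \<in> LP t" "s \<in> LP t" "s \<noteq> 0" "x = a * inverse s"
      using t unfolding quantum_seed_def by blast
    obtain N where N: "\<And>n. n \<ge> N \<Longrightarrow> a * frame t (int n *s unit_vec k) \<in> LP (mutate k t)"
      using LP_times_frame_mem_LP_mutate[OF t k as(1)] by blast
    obtain N' where N': "\<And>n. n \<ge> N' \<Longrightarrow> s * frame t (int n *s unit_vec k) \<in> LP (mutate k t)"
      using LP_times_frame_mem_LP_mutate[OF t k as(2)] by blast
    \<comment> \<open>One power of the old variable clears the denominators of both \<open>a\<close>
      and \<open>s\<close>, and it cancels in the fraction.\<close>
    define f where "f = frame t (int (max N N') *s unit_vec k)"
    have f0: "f \<noteq> 0" unfolding f_def by (rule frame_nonzero[OF t])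
    have "a * f * inverse (s * f) = a * (f * inverse f) * inverse s"
      by (simp only: nonzero_inverse_mult_distrib[OF as(3) f0] mult.assoc)
    then have "x = a * f * inverse (s * f)"
      using f0 as(4) by simp
    moreover have "a * f \<in> LP (mutate k t)" "s * f \<in> LP (mutate k t)" "s * f \<noteq> 0"
      using N[of "max N N'"] N'[of "max N N'"] as(3) f0 by (auto simp: f_def)
    ultimately show ?thesis by blast
  qed
  ultimately show ?thesis
    using torus_frame_mutate[OF t k] inj_laurent_expand_mutate[OF t k]
    unfolding quantum_seed_def torus_frame_def mutate_simps(1) by blast
qed

text \<open>\<open>f\<close> is the set of coordinates that may be negative.\<close>

lemma int_vec_induct [consumes 1, case_names zero add diff]:
  fixes a :: "int ^ 'i::finite"
  assumes "\<forall>i. i \<notin> f \<longrightarrow> a $ i \<ge> 0"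
    and "P 0" and "\<And>a i. P a \<Longrightarrow> P (a + unit_vec i)"
    and "\<And>a i. i \<in> f \<Longrightarrow> P a \<Longrightarrow> P (a - unit_vec i)"
  shows "P a"
  using assms(1)
proof (induction "nat (\<Sum>i\<in>UNIV. \<bar>a $ i\<bar>)" arbitrary: a rule: less_induct)
  case less
  have step: "nat (\<Sum>i\<in>UNIV. \<bar>b $ i\<bar>) < nat (\<Sum>i\<in>UNIV. \<bar>a $ i\<bar>)"
    if "\<bar>b $ j\<bar> < \<bar>a $ j\<bar>" "\<And>i. i \<noteq> j \<Longrightarrow> b $ i = a $ i" for b j
  proof -
    have "(\<Sum>i\<in>UNIV. \<bar>b $ i\<bar>) < (\<Sum>i\<in>UNIV. \<bar>a $ i\<bar>)"
      by (rule sum_strict_mono_ex1) (use that in \<open>auto intro!: bexI[of _ j]\<close>, metis order_refl less_imp_le)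
    moreover have "(\<Sum>i\<in>UNIV. \<bar>b $ i\<bar>) \<ge> 0" by (simp add: sum_nonneg)
    ultimately show ?thesis by linarith
  qed
  show ?case
  proof (cases "a = 0")
    case False
    then obtain j where j: "a $ j \<noteq> 0" by (auto simp: vec_eq_iff)
    show ?thesis
    proof (cases "a $ j > 0")
      case True
      have "P (a - unit_vec j)"
        by (rule less.hyps, rule step[of _ j]) (use True less.prems in auto)
      then show ?thesis using assms(3)[of "a - unit_vec j" j] by simp
    next
      case False
      then have "j \<in> f" using less.prems j by force
      moreover have "P (a + unit_vec j)"
        by (rule less.hyps, rule step[of _ j]) (use False j less.prems \<open>j \<in> f\<close> in auto)
      ultimately show ?thesis using assms(4)[of j "a + unit_vec j"] by simp
    qed
  qed (simp add: assms(2))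
qed

text \<open>Every exponent is reached from 0 by unit steps, where a step down is handled by
  cancelling a nonzero cluster variable. Equality of frames is thus reduced to equality of cluster
  variables.\<close>

lemma torus_frame_unique:
  fixes s t :: "('a::finite, 'f::division_ring) qseed"
  assumes s: "torus_frame s" and t: "torus_frame t"
    and eq: "vpar s = vpar t" "lam s = lam t" "\<And>i. frame s (unit_vec i) = frame t (unit_vec i)"
    and nz: "\<And>m. frame t m \<noteq> 0"
  shows "frame s = frame t"
proof
  fix m :: "int ^ 'a"
  have v0: "vpar t \<noteq> 0" using t by (simp add: torus_frame_def)
  have "\<forall>i. i \<notin> (UNIV :: 'a set) \<longrightarrow> m $ i \<ge> 0" by simp
  then show "frame s m = frame t m"
  proof (induction m rule: int_vec_induct)
    case zero
    then show ?case using s t by (simp add: torus_frame_def)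
  next
    case (add a i)
    have "vpar t powi bilin (lam t) a (unit_vec i) * frame s (a + unit_vec i)
        = vpar t powi bilin (lam t) a (unit_vec i) * frame t (a + unit_vec i)"
      using torus_frame_mult[OF s, of a "unit_vec i"] torus_frame_mult[OF t, of a "unit_vec i"] add eq
      by auto
    then show ?case using v0 by simp
  next
    case (diff a i)
    have "frame s (a - unit_vec i) * frame t (unit_vec i) = frame t (a - unit_vec i) * frame t (unit_vec i)"
      using torus_frame_mult[OF s, of "a - unit_vec i" "unit_vec i"]
        torus_frame_mult[OF t, of "a - unit_vec i" "unit_vec i"] diff eq
      by simp
    then show ?case using nz by simp
  qed
qed

lemma mutate_mutate:
  assumes t: "quantum_seed t" and k: "k \<in> unfrozen t"
  shows "mutate k (mutate k t) = t"
proof -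
  have t': "quantum_seed (mutate k t)" and k': "k \<in> unfrozen (mutate k t)"
    using quantum_seed_mutate[OF t k] k by auto
  obtain d where d: "compatible_with t d"
    using quantum_seed_compatible_with[OF t] .
  have b: "mutate_bmat k (mutate k t) = bmat t"
    by (simp add: mutate_bmat_def vec_eq_iff bmat_diag[OF t])
  \<comment> \<open>Both lifts use negative parts, but of opposite columns, so they compose to a
    transvection instead of the identity. It preserves the form because the two cross terms are
    \<open>d k * m $ k * m' $ k\<close> with opposite signs.\<close>
  have lift2: "lift k t (lift k (mutate k t) m) = m + (m $ k) *s p_star t (unit_vec k)" for m
  proof -
    have "pos_part (bmat t $ i $ k) = bmat t $ i $ k + pos_part (- bmat t $ i $ k)" for i
      using pos_part_diff[of "bmat t $ i $ k"] by simp
    then show ?thesis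
      by (simp add: vec_eq_iff lift_nth[OF t] lift_nth[OF t'] p_star_unit bmat_diag[OF t]
          mutate_bmat_def algebra_simps)
  qed
  have "bilin (mutate_lam k (mutate k t)) m m' = bilin (lam t) m m'" for m m'
    unfolding bilin_mutate[OF t' k'] mutate_simps bilin_mutate[OF t k] lift2 bilin_add_left
      bilin_add_right bilin_scale_left bilin_scale_right bilin_self[OF t]
    using quantum_seed_skew[OF t, of m "p_star t (unit_vec k)"]
    by (simp add: bilin_p_star_unit_left[OF t d k])
  from this[of "unit_vec _" "unit_vec _"] have l: "mutate_lam k (mutate k t) = lam t"
    unfolding bilin_unit by (simp add: vec_eq_iff)
  have "frame (mutate k (mutate k t)) = frame t"
  proof (rule torus_frame_unique)
    show "frame (mutate k (mutate k t)) (unit_vec i) = frame t (unit_vec i)" for i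
      using cluster_var_mutate[OF t' k', of i] cluster_var_mutate[OF t k, of i]
      by (simp add: cluster_var_def mutate_var_mutate[OF t k])
  qed (use l torus_frame_mutate[OF t' k'] quantum_seed_torus[OF t] frame_nonzero[OF t] in auto)
  then show ?thesis
    using b l by (simp add: mutate_def)
qed


section \<open>Seeds reachable by mutation\<close>

lemma mutate_seq_simps [simp]:
  "mutate_seq [] t = t" "mutate_seq (k # w) t = mutate_seq w (mutate k t)"
  "mutate_seq (w @ w') t = mutate_seq w' (mutate_seq w t)"
  by (simp_all add: mutate_seq_def)

lemma trop_seq_append: "trop_seq (w @ w') t g = trop_seq w' (mutate_seq w t) (trop_seq w t g)"
  by (induction w t g rule: trop_seq.induct) simp_all

lemma mutate_seq_invariants:
  assumes "quantum_seed t" "compatible_with t d" "set w \<subseteq> unfrozen t"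
  shows "quantum_seed (mutate_seq w t) \<and> compatible_with (mutate_seq w t) d \<and>
    unfrozen (mutate_seq w t) = unfrozen t \<and> vpar (mutate_seq w t) = vpar t \<and>
    (\<forall>j. j \<notin> unfrozen t \<longrightarrow> cluster_var (mutate_seq w t) j = cluster_var t j)"
  using assms
proof (induction w arbitrary: t)
  case (Cons k w)
  then have k: "k \<in> unfrozen t" by simp
  have "cluster_var (mutate k t) j = cluster_var t j" if "j \<notin> unfrozen t" for j
    using cluster_var_mutate[OF Cons.prems(1) k, of j] k that by auto
  then show ?case
    using Cons.IH[of "mutate k t"] Cons.prems quantum_seed_mutate[OF Cons.prems(1) k]
      compatible_with_mutate[OF Cons.prems(1,2) k]
    by simp
qed auto

lemma mutate_seq_rev:
  assumes "quantum_seed t" "set w \<subseteq> unfrozen t"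
  shows "mutate_seq (rev w) (mutate_seq w t) = t"
  using assms
proof (induction w arbitrary: t)
  case (Cons k w)
  then show ?case
    using quantum_seed_mutate[of t k] mutate_mutate[of t k] by simp
qed auto

lemma seeds_refl [simp]: "t \<in> seeds t"
  unfolding seeds_def by (auto intro!: exI[of _ "[]"])

lemma seeds_unfrozen:
  assumes "quantum_seed t" "s \<in> seeds t"
  shows "unfrozen s = unfrozen t"
proof -
  obtain d where "compatible_with t d"
    using quantum_seed_compatible_with[OF assms(1)] .
  then show ?thesis
    using assms mutate_seq_invariants[OF assms(1)] by (auto simp: seeds_def)
qed

lemma seeds_trans:
  assumes "quantum_seed t" "s \<in> seeds t" "r \<in> seeds s"
  shows "r \<in> seeds t"
proof -
  obtain w where w: "set w \<subseteq> unfrozen t" "s = mutate_seq w t"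
    using assms(2) by (auto simp: seeds_def)
  obtain w' where w': "set w' \<subseteq> unfrozen t" "r = mutate_seq w' s"
    using assms(3) seeds_unfrozen[OF assms(1,2)] by (auto simp: seeds_def)
  show ?thesis
    unfolding seeds_def using w w' by (auto intro!: exI[of _ "w @ w'"])
qed

lemma seeds_sym:
  assumes "quantum_seed t" "s \<in> seeds t"
  shows "t \<in> seeds s"
proof -
  obtain w where w: "set w \<subseteq> unfrozen t" "s = mutate_seq w t"
    using assms(2) by (auto simp: seeds_def)
  then show ?thesis
    using mutate_seq_rev[OF assms(1) w(1)] seeds_unfrozen[OF assms]
    unfolding seeds_def by (auto intro!: exI[of _ "rev w"])
qed

section \<open>Closed forms of the tropical transformations\<close>

lemma trop_eq:
  assumes "quantum_seed t"
  shows "trop k t g = g - (2 * g $ k) *s unit_vec k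
    + pos_part (g $ k) *s pos_col k t - pos_part (- g $ k) *s neg_col k t"
  using bmat_diag[OF assms, of k]
  by (auto simp: vec_eq_iff trop_def pos_part_def max_def)

text \<open>Free of case distinctions on the entries of \<open>bmat\<close>, so that the linear map
  \<open>psi\<close> can be applied term by term.\<close>

lemma trop_op_eq:
  assumes "quantum_seed t"
  shows "trop_op k t g = g - (2 * g $ k) *s unit_vec k
    + pos_part (g $ k) *s neg_col k t - pos_part (- g $ k) *s pos_col k t"
  using bmat_diag[OF assms, of k]
  by (auto simp: vec_eq_iff trop_op_def pos_part_def max_def)

lemma trop_zero_coord:
  assumes "quantum_seed t" "g $ k = 0"
  shows "trop k t g = g"
  using assms by (simp add: trop_eq)

lemma leading_add_lower:
  assumes t: "quantum_seed t" and Z: "leading t g p Z" and W: "leading t h q W"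
    and "dom_le t h g" "h \<noteq> g"
  shows "leading t g p (Z + W)"
proof -
  have LP: "Z \<in> LP t" "W \<in> LP t"
    using Z W by (auto simp: leading_def below_def)
  have "lp_coeff t W g = 0"
    using W assms(4,5) dom_le_antisym[OF t] by (force simp: leading_def below_def)
  moreover have "dom_le t m g" if "lp_coeff t (Z + W) m \<noteq> 0" for m
  proof (cases "lp_coeff t Z m = 0")
    case True
    then have "dom_le t m h"
      using that W by (auto simp: leading_def below_def lp_coeff_add[OF t LP])
    then show ?thesis using assms(4) dom_le_trans by blast
  qed (use Z in \<open>auto simp: leading_def below_def\<close>)
  ultimately show ?thesis
    using Z LP by (simp add: leading_def below_def LP_add lp_coeff_add[OF t LP])
qed

lemma vp_inject [simp]: "vp a = vp b \<longleftrightarrow> a = b"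
proof
  assume "vp a = vp b"
  then have "Poly_Mapping.lookup (vp a) a = Poly_Mapping.lookup (vp b) a" by simp
  then show "a = b" by (auto simp: vp_def lookup_single when_def split: if_splits)
qed auto


section \<open>Degrees of clusters with respect to other seeds\<close>

locale common_triangular =
  fixes t0 :: "('i::finite, 'f::division_ring) qseed" and A L :: "'f set" and d :: "'i \<Rightarrow> int"
  assumes t0: "quantum_seed t0" and d0: "compatible_with t0 d"
    and subalgebra: "kk_subalgebra (vpar t0) A"
    and common: "common_triangular_basis t0 A L"
begin

abbreviation "S \<equiv> seeds t0"
abbreviation "U \<equiv> unfrozen t0"
abbreviation "v \<equiv> vpar t0"

lemma seed_mutate_seq: "s \<in> S \<Longrightarrow> \<exists>w. set w \<subseteq> U \<and> s = mutate_seq w t0"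
  by (auto simp: seeds_def)

lemma seed:
  assumes "s \<in> S"
  shows "quantum_seed s" "compatible_with s d" "unfrozen s = U" "vpar s = v"
    "j \<notin> U \<Longrightarrow> cluster_var s j = cluster_var t0 j"
  using assms mutate_seq_invariants[OF t0 d0] by (auto simp: seeds_def)

lemma seed_mutate:
  assumes "s \<in> S" "k \<in> U"
  shows "mutate k s \<in> S"
proof (rule seeds_trans[OF t0 assms(1)])
  show "mutate k s \<in> seeds s"
    unfolding seeds_def using assms(2) seed(3)[OF assms(1)] by (intro CollectI exI[of _ "[k]"]) simp
qed

lemma triangular:
  assumes "s \<in> S"
  shows "triangular_basis s A L"
  using seed_mutate_seq[OF assms] common by (auto simp: common_triangular_basis_def)

lemma basis_pointed:
  assumes "s \<in> S"
  obtains Lg where "L = range Lg" "\<forall>g. pointed s g (Lg g)"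
    "\<forall>g i. \<exists>b :: int ^ 'i \<Rightarrow>\<^sub>0 laurent.
           (\<forall>g'\<in>Poly_Mapping.keys b. dom_le s g' (g + unit_vec i)) \<and>
           Poly_Mapping.lookup b (g + unit_vec i) = 1 \<and>
           (\<forall>g'. dom_less s g' (g + unit_vec i) \<longrightarrow> Poly_Mapping.lookup b g' \<in> laurent_m) \<and>
           deg_normalize s (cluster_var s i * Lg g) =
             (\<Sum>g'\<in>Poly_Mapping.keys b. scale (vpar s) (Poly_Mapping.lookup b g') (Lg g'))"
proof -
  have "degree_triangular s A L"
    using triangular[OF assms] by (simp add: triangular_basis_def)
  then show ?thesis
    unfolding degree_triangular_def
    by (elim conjE exE) (rule that)
qed

lemma pointed_unique:
  assumes "s \<in> S" "pointed s g Z" "pointed s g' Z"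
  shows "g = g'"
  using assms seed(1)[OF assms(1)] by (auto simp: pointed_def dest: has_degree_unique)

lemma pointed_ex: "s \<in> S \<Longrightarrow> Z \<in> L \<Longrightarrow> \<exists>g. pointed s g Z"
  using basis_pointed[of s] by (metis rangeE)

lemma pointed_deg: "s \<in> S \<Longrightarrow> Z \<in> L \<Longrightarrow> pointed s (deg s Z) Z"
  using pointed_ex deg_eqI[OF seed(1)] by (metis pointed_def)

lemma pointed_inj:
  assumes "s \<in> S" "Z \<in> L" "Z' \<in> L" "pointed s g Z" "pointed s g Z'"
  shows "Z = Z'"
proof -
  obtain Lg where Lg: "L = range Lg" "\<forall>g. pointed s g (Lg g)"
    using basis_pointed[OF assms(1)] by blast
  obtain a b where ab: "Z = Lg a" "Z' = Lg b"
    using assms(2,3) Lg(1) by blast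
  have "a = g" "b = g"
    using pointed_unique[OF assms(1)] Lg(2) assms(4,5) unfolding ab by blast+
  then show ?thesis using ab by simp
qed

lemma pointed_LP: "pointed s g Z \<Longrightarrow> Z \<in> LP s"
  by (simp add: pointed_def has_degree_def)

text \<open>The hypothesis speaks only of mutation sequences starting at \<open>t0\<close>. The
  single step at \<open>s\<close> results from comparing a sequence \<open>w\<close> leading to
  \<open>s\<close> with \<open>w @ [k]\<close>.\<close>

lemma pointed_trop:
  assumes s: "s \<in> S" and Z: "Z \<in> L" and k: "k \<in> U" and g: "pointed s g Z"
  shows "pointed (mutate k s) (trop k s g) Z"
proof -
  obtain w where w: "set w \<subseteq> U" "s = mutate_seq w t0"
    using seed_mutate_seq[OF s] by blast
  obtain g0 where "pointed t0 g0 Z"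
    using pointed_ex[OF seeds_refl Z] by blast
  then have *: "pointed (mutate_seq w' t0) (trop_seq w' t0 g0) Z" if "set w' \<subseteq> U" for w'
    using common Z that unfolding common_triangular_basis_def by blast
  have "g = trop_seq w t0 g0"
    using pointed_unique[OF s g] *[OF w(1)] w(2) by simp
  then show ?thesis
    using *[of "w @ [k]"] w k by (simp add: trop_seq_append)
qed

lemma frame_mem_L:
  assumes "s \<in> S" "\<And>i. u $ i \<ge> 0"
  shows "frame s u \<in> L"
  using triangular[OF assms(1)] assms(2)
  unfolding triangular_basis_def cluster_monomials_def by blast

lemma cluster_var_mem_L: "s \<in> S \<Longrightarrow> cluster_var s i \<in> L"
  unfolding cluster_var_def by (rule frame_mem_L) auto

text \<open>The extended g-vectors of the cluster of \<open>t\<close> with respect to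
  \<open>s\<close>.\<close>

definition degv :: "('i, 'f) qseed \<Rightarrow> ('i, 'f) qseed \<Rightarrow> 'i \<Rightarrow> int ^ 'i" where
  "degv s t i = deg s (cluster_var t i)"

lemma pointed_degv: "s \<in> S \<Longrightarrow> t \<in> S \<Longrightarrow> pointed s (degv s t i) (cluster_var t i)"
  unfolding degv_def by (intro pointed_deg cluster_var_mem_L)

lemma degv_eqI: "s \<in> S \<Longrightarrow> t \<in> S \<Longrightarrow> pointed s g (cluster_var t i) \<Longrightarrow> degv s t i = g"
  using pointed_degv pointed_unique by blast

text \<open>The linear map given by the G-matrix. For nonnegative \<open>u\<close> it is the degree
  in \<open>s\<close> of \<open>frame t u\<close>; for other exponents it is just the linear
  extension.\<close>

definition psi :: "('i, 'f) qseed \<Rightarrow> ('i, 'f) qseed \<Rightarrow> int ^ 'i \<Rightarrow> int ^ 'i" where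
  "psi s t u = (\<Sum>i\<in>UNIV. (u $ i) *s degv s t i)"

lemma psi_nth: "psi s t u $ j = (\<Sum>i\<in>UNIV. u $ i * degv s t i $ j)"
  by (simp add: psi_def)

lemma psi_add: "psi s t (a + b) = psi s t a + psi s t b"
  by (simp add: vec_eq_iff psi_nth distrib_right sum.distrib)

lemma psi_scale: "psi s t (c *s a) = c *s psi s t a"
  by (simp add: vec_eq_iff psi_nth sum_distrib_left mult.assoc)

lemma psi_0 [simp]: "psi s t 0 = 0"
  by (simp add: vec_eq_iff psi_nth)

lemma psi_uminus: "psi s t (- a) = - psi s t a"
  by (simp add: vec_eq_iff psi_nth sum_negf)

lemma psi_diff: "psi s t (a - b) = psi s t a - psi s t b"
  using psi_add[of s t a "- b"] by (simp add: psi_uminus)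

lemma psi_unit [simp]: "psi s t (unit_vec i) = degv s t i"
proof -
  have "(\<Sum>i'\<in>UNIV. unit_vec i $ i' * degv s t i' $ j) = (\<Sum>i'\<in>UNIV. if i' = i then degv s t i $ j else 0)" for j
    by (intro sum.cong refl) auto
  then show ?thesis by (simp add: vec_eq_iff psi_nth)
qed

text \<open>Two views of one product: its leading term is the product of the leading terms, and it
  is a power of \<open>v\<close> times a cluster monomial, which is pointed because it belongs to
  \<open>L\<close>. Equal degrees give additivity, equal coefficients the invariance of
  \<lambda>.\<close>

lemma frame_unit_mult:
  assumes st: "s \<in> S" "t \<in> S" and a: "\<And>i. a $ i \<ge> 0" and lead: "leading s (psi s t a) 1 (frame t a)"
  shows "leading s (psi s t (a + unit_vec i)) 1 (frame t (a + unit_vec i))"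
    and "bilin (lam s) (psi s t a) (degv s t i) = bilin (lam t) a (unit_vec i)"
proof -
  note s = seed(1)[OF st(1)] and t = seed(1)[OF st(2)]
  have "leading s (psi s t a + degv s t i) (vp (bilin (lam s) (psi s t a) (degv s t i)) * (1 * 1))
      (frame t a * frame t (unit_vec i))"
    by (rule leading_mult[OF s lead])
      (use pointed_degv[OF st, of i] in \<open>simp add: pointed_iff_leading[OF s] cluster_var_def\<close>)
  also have "frame t a * frame t (unit_vec i) =
      vpar s powi bilin (lam t) a (unit_vec i) * frame t (a + unit_vec i)"
    by (simp add: torus_frame_mult[OF quantum_seed_torus[OF t]] seed(4)[OF st(1)] seed(4)[OF st(2)])
  finally have 1: "leading s (psi s t a + degv s t i) (vp (bilin (lam s) (psi s t a) (degv s t i)))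
      (vpar s powi bilin (lam t) a (unit_vec i) * frame t (a + unit_vec i))"
    by simp
  have "frame t (a + unit_vec i) \<in> L"
    by (rule frame_mem_L[OF st(2)]) (simp add: a)
  then obtain g where g: "leading s g 1 (frame t (a + unit_vec i))"
    using pointed_ex[OF st(1)] pointed_iff_leading[OF s] by blast
  have 2: "leading s g (vp (bilin (lam t) a (unit_vec i)))
      (vpar s powi bilin (lam t) a (unit_vec i) * frame t (a + unit_vec i))"
    using leading_powi_scale[OF s g] by simp
  have eq: "psi s t a + degv s t i = g"
    using leading_unique[OF s 1 2] by simp
  then show "leading s (psi s t (a + unit_vec i)) 1 (frame t (a + unit_vec i))"
    using g by (simp add: psi_add)
  show "bilin (lam s) (psi s t a) (degv s t i) = bilin (lam t) a (unit_vec i)"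
    using 1 2 eq by (simp add: leading_def)
qed

lemma leading_psi:
  assumes st: "s \<in> S" "t \<in> S" and u: "\<And>i. u $ i \<ge> 0"
  shows "leading s (psi s t u) 1 (frame t u)"
proof -
  note s = seed(1)[OF st(1)] and t = seed(1)[OF st(2)]
  have "\<forall>i. i \<notin> {} \<longrightarrow> u $ i \<ge> 0" using u by simp
  then have "(\<forall>i. u $ i \<ge> 0) \<and> leading s (psi s t u) 1 (frame t u)"
  proof (induction u rule: int_vec_induct)
    case zero
    have "frame t 0 = frame s 0" using s t by (simp add: quantum_seed_def)
    then show ?case using leading_frame[OF s, of 0] by simp
  next
    case (add a i)
    then show ?case using frame_unit_mult(1)[OF st, of a i] by auto
  qed auto
  then show ?thesis by simp
qed

lemma bilin_psi:
  assumes st: "s \<in> S" "t \<in> S"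
  shows "bilin (lam s) (psi s t a) (psi s t b) = bilin (lam t) a b"
proof -
  have sum_left: "bilin M (\<Sum>i\<in>X. f i) b = (\<Sum>i\<in>X. bilin M (f i) b)"
    and sum_right: "bilin M b (\<Sum>i\<in>X. f i) = (\<Sum>i\<in>X. bilin M b (f i))" for M X f and b :: "int ^ 'i"
    by (induction X rule: infinite_finite_induct) (simp_all add: bilin_add_left bilin_add_right)
  have "bilin (lam s) (degv s t i) (degv s t j) = lam t $ i $ j" for i j
    using frame_unit_mult(2)[OF st, of "unit_vec i" j] leading_psi[OF st, of "unit_vec i"]
    by (simp add: bilin_unit)
  then have "bilin (lam s) (psi s t a) (psi s t b) = (\<Sum>i\<in>UNIV. \<Sum>j\<in>UNIV. a $ i * (b $ j * lam t $ i $ j))"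
    unfolding psi_def sum_left
    by (simp add: sum_right bilin_scale_left bilin_scale_right sum_distrib_left mult_ac)
  then show ?thesis
    by (simp only: bilin_def mult_ac)
qed

section \<open>Degrees of the two terms of an exchange relation\<close>

lemma p_star_unit_neq_0:
  assumes "t \<in> S" "k \<in> U"
  shows "p_star t (unit_vec k) \<noteq> 0"
  using p_star_eqD[OF seed(1)[OF assms(1)], of "unit_vec k" 0 k] assms(2) seed(3)[OF assms(1)] by auto

lemma leading_exchange:
  assumes st: "s \<in> S" "t \<in> S" and k: "k \<in> U"
  obtains p where "p \<noteq> 0" "leading s (degv s (mutate k t) k + degv s t k) p
    (mutate_var k t * frame t (unit_vec k))"
proof -
  note s = seed(1)[OF st(1)] and t = seed(1)[OF st(2)]
  have k': "k \<in> unfrozen t" using k seed(3)[OF st(2)] by simp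
  have 1: "leading s (degv s (mutate k t) k) 1 (mutate_var k t)"
    using pointed_degv[OF st(1) seed_mutate[OF st(2) k], of k] cluster_var_mutate[OF t k', of k]
    by (simp add: pointed_iff_leading[OF s])
  have 2: "leading s (degv s t k) 1 (frame t (unit_vec k))"
    using pointed_degv[OF st, of k] by (simp add: pointed_iff_leading[OF s] cluster_var_def)
  show ?thesis
    by (rule that[OF _ leading_mult[OF s 1 2]]) simp
qed

text \<open>Both terms of an exchange relation are pointed in \<open>s\<close> and so is their sum, hence their degrees
  are comparable.\<close>

lemma psi_p_star_comparable:
  assumes st: "s \<in> S" "t \<in> S" and k: "k \<in> U"
  obtains n where "psi s t (p_star t (unit_vec k)) = p_star s n"
proof -
  note s = seed(1)[OF st(1)] and t = seed(1)[OF st(2)]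
  have k': "k \<in> unfrozen t" using k seed(3)[OF st(2)] by simp
  have veq: "vpar t = vpar s" using seed(4)[OF st(1)] seed(4)[OF st(2)] by simp
  show ?thesis
  proof (cases "psi s t (p_star t (unit_vec k)) = 0")
    case False
    let ?a = "bilin (lam t) (exch_minus k t) (neg_col k t)"
    let ?b = "bilin (lam t) (exch_minus k t) (pos_col k t)"
    let ?W = "mutate_var k t * frame t (unit_vec k)"
    obtain p x where p: "p \<noteq> 0" "leading s x p ?W"
      using leading_exchange[OF st k] by metis
    have W: "?W = vpar s powi ?a * frame t (neg_col k t) + vpar s powi ?b * frame t (pos_col k t)"
      using exchange_relation[OF t k'] veq by simp
    have ne: "neg_col k t \<noteq> pos_col k t"
      using p_star_unit_neq_0[OF st(2) k] by (simp add: pos_col_eq)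
    have psine: "psi s t (neg_col k t) \<noteq> psi s t (pos_col k t)"
      using False by (simp add: pos_col_eq psi_add)
    have lm: "leading s (psi s t (neg_col k t)) 1 (frame t (neg_col k t))"
      and lp: "leading s (psi s t (pos_col k t)) 1 (frame t (pos_col k t))"
      by (rule leading_psi[OF st], simp)+
    define c where "c m = (if m = neg_col k t then vp ?a else if m = pos_col k t then vp ?b else 0)" for m
    have supp: "{m. c m \<noteq> 0} = {neg_col k t, pos_col k t}"
      by (auto simp: c_def)
    have lc: "lincomb (vpar s) (frame t) c = ?W"
      unfolding lincomb_def supp W using ne by (simp add: c_def)
    have le: "dom_le s (psi s t m) x" if "c m \<noteq> 0" for m
    proof (rule below_lincombD[OF s, where c = c and Y = "frame t" and p = "\<lambda>_. 1" and \<delta> = "psi s t"])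
      show "leading s (psi s t m) 1 (frame t m) \<and> (1::laurent) \<noteq> 0" if "c m \<noteq> 0" for m
      proof -
        have "m = neg_col k t \<or> m = pos_col k t" using that supp by blast
        then show ?thesis using lm lp by auto
      qed
      show "inj_on (psi s t) {m. c m \<noteq> 0}"
        unfolding supp using psine by auto
      show "below s x (lincomb (vpar s) (frame t) c)"
        unfolding lc using p(2) by (simp add: leading_def)
    qed (use supp that in auto)
    have LP: "frame t (neg_col k t) \<in> LP s" "frame t (pos_col k t) \<in> LP s"
      using lm lp by (auto simp: leading_def below_def)
    have v0: "vpar s \<noteq> 0" using s by (simp add: quantum_seed_def)
    \<comment> \<open>Both degrees lie below \<open>x\<close>. Conversely \<open>x\<close> has a
      nonzero coefficient in one of the terms and so lies below its degree, which makes the two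
      degrees comparable.\<close>
    have "lp_coeff s ?W x = vp ?a * lp_coeff s (frame t (neg_col k t)) x
        + vp ?b * lp_coeff s (frame t (pos_col k t)) x"
      unfolding W using LP v0
      by (simp add: lp_coeff_add[OF s] LP_powi_scale lp_coeff_powi_scale[OF s])
    then have "lp_coeff s (frame t (neg_col k t)) x \<noteq> 0 \<or> lp_coeff s (frame t (pos_col k t)) x \<noteq> 0"
      using p by (auto simp: leading_def)
    then have "dom_le s x (psi s t (neg_col k t)) \<or> dom_le s x (psi s t (pos_col k t))"
      using lm lp by (auto simp: leading_def below_def)
    then have "dom_le s (psi s t (pos_col k t)) (psi s t (neg_col k t)) \<or>
        dom_le s (psi s t (neg_col k t)) (psi s t (pos_col k t))"
      using le[of "neg_col k t"] le[of "pos_col k t"] supp dom_le_trans by blast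
    \<comment> \<open>Which of the two degrees is larger is not known here, so \<open>n\<close> may
      have to be negated; its value is found later by pairing.\<close>
    then obtain n where "psi s t (pos_col k t) = psi s t (neg_col k t) + p_star s n \<or>
        psi s t (neg_col k t) = psi s t (pos_col k t) + p_star s n"
      by (auto simp: dom_le_def)
    then have "psi s t (p_star t (unit_vec k)) = p_star s n \<or> psi s t (p_star t (unit_vec k)) = p_star s (- n)"
      by (auto simp: pos_col_eq psi_add p_star_uminus add.commute eq_neg_iff_add_eq_0)
    then show ?thesis using that by blast
  qed (use that[of 0] in auto)
qed


section \<open>Shifted pairs of seeds\<close>

text \<open>\<open>shift_pair s t \<sigma>\<close> says that \<open>t = s[1]\<close>, where \<open>s\<close> and \<open>t\<close> are reachable.\<close>

definition shift_pair :: "('i, 'f) qseed \<Rightarrow> ('i, 'f) qseed \<Rightarrow> ('i \<Rightarrow> 'i) \<Rightarrow> bool" where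
  "shift_pair s t \<sigma> \<longleftrightarrow> s \<in> S \<and> t \<in> S \<and> \<sigma> permutes U \<and>
     (\<forall>i\<in>U. \<forall>j\<in>U. bmat t $ \<sigma> i $ \<sigma> j = bmat s $ i $ j) \<and>
     (\<forall>k\<in>U. \<forall>i\<in>U. degv s t (\<sigma> k) $ i = (if i = k then - 1 else 0))"

lemma shifted_iff_shift_pair:
  assumes st: "s \<in> S" "t \<in> S"
  shows "shifted s t \<longleftrightarrow> (\<exists>\<sigma>. shift_pair s t \<sigma>)"
proof -
  note s = seed(1)[OF st(1)]
  have 1: "t \<in> seeds s"
    using seeds_trans[OF s seeds_sym[OF t0 st(1)] st(2)] .
  have 2: "(\<exists>h. (\<forall>i\<in>U. h $ i = 0) \<and> has_degree s (- unit_vec k + h) (cluster_var t l)) \<longleftrightarrow>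
      (\<forall>i\<in>U. degv s t l $ i = (if i = k then - 1 else 0))" if "k \<in> U" for k l
  proof -
    have deg: "has_degree s g (cluster_var t l) \<longleftrightarrow> g = degv s t l" for g
      using pointed_degv[OF st, of l] has_degree_unique[OF s] by (auto simp: pointed_def)
    show ?thesis
      unfolding deg
    proof
      assume "\<exists>h. (\<forall>i\<in>U. h $ i = 0) \<and> - unit_vec k + h = degv s t l"
      then obtain h where h: "\<forall>i\<in>U. h $ i = 0" "- unit_vec k + h = degv s t l" by blast
      show "\<forall>i\<in>U. degv s t l $ i = (if i = k then - 1 else 0)"
        using h(1) unfolding h(2)[symmetric] by simp
    next
      assume "\<forall>i\<in>U. degv s t l $ i = (if i = k then - 1 else 0)"
      then show "\<exists>h. (\<forall>i\<in>U. h $ i = 0) \<and> - unit_vec k + h = degv s t l"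
        by (intro exI[of _ "degv s t l + unit_vec k"]) simp
    qed
  qed
  show ?thesis
    unfolding shifted_def shift_pair_def seed(3)[OF st(1)] using 1 2 st by auto
qed

section \<open>The G-matrix of a shifted pair\<close>

lemma degv_frozen:
  assumes "s \<in> S" "t \<in> S" "j \<notin> U"
  shows "degv s t j = unit_vec j"
proof (rule degv_eqI[OF assms(1,2)])
  have "cluster_var t j = frame s (unit_vec j)"
    using seed(5)[OF assms(1)] seed(5)[OF assms(2)] assms(3) by (simp add: cluster_var_def)
  then show "pointed s (unit_vec j) (cluster_var t j)"
    using leading_frame[OF seed(1)[OF assms(1)]] by (simp add: pointed_iff_leading seed(1)[OF assms(1)])
qed

text \<open>The G-matrix is block triangular: frozen variables contribute only frozen unit vectors,
  and the unfrozen block is minus a permutation matrix.\<close>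

lemma psi_nth_unfrozen:
  assumes p: "shift_pair s t \<sigma>" and k: "k \<in> U"
  shows "psi s t u $ k = - u $ \<sigma> k"
proof -
  have st: "s \<in> S" "t \<in> S" and \<sigma>: "\<sigma> permutes U"
    and deg: "\<And>k i. k \<in> U \<Longrightarrow> i \<in> U \<Longrightarrow> degv s t (\<sigma> k) $ i = (if i = k then - 1 else 0)"
    using p by (auto simp: shift_pair_def)
  have "u $ i * degv s t i $ k = (if i = \<sigma> k then - u $ \<sigma> k else 0)" for i
  proof (cases "i \<in> U")
    case True
    then obtain l where l: "i = \<sigma> l" "l \<in> U"
      using permutes_image[OF \<sigma>] by blast
    then show ?thesis
      using deg[OF l(2) k] permutes_inj[OF \<sigma>] by (auto dest: injD)
  next
    case False
    then have "i \<noteq> \<sigma> k" "i \<noteq> k" using k permutes_in_image[OF \<sigma>] by auto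
    then show ?thesis using degv_frozen[OF st False] by simp
  qed
  then show ?thesis by (simp add: psi_nth)
qed

lemma psi_frozen:
  assumes st: "s \<in> S" "t \<in> S" and r: "\<And>i. i \<in> U \<Longrightarrow> r $ i = 0"
  shows "psi s t r = r"
proof -
  have "r $ i * degv s t i $ j = (if i = j then r $ j else 0)" for i j
    by (cases "i \<in> U") (use r in \<open>auto simp: degv_frozen[OF st]\<close>)
  then show ?thesis by (simp add: vec_eq_iff psi_nth)
qed

text \<open>With a negated permutation as unfrozen block and the identity as frozen block, the
  G-matrix is unimodular.\<close>

lemma bij_psi:
  assumes p: "shift_pair s t \<sigma>"
  shows "bij (psi s t)"
proof -
  have st: "s \<in> S" "t \<in> S" and \<sigma>: "\<sigma> permutes U"
    using p by (auto simp: shift_pair_def)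
  have ker: "u = 0" if "psi s t u = 0" for u
  proof -
    have "u $ i = 0" if i: "i \<in> U" for i
    proof -
      obtain l where "i = \<sigma> l" "l \<in> U"
        using permutes_image[OF \<sigma>] i by blast
      then show ?thesis
        using psi_nth_unfrozen[OF p, of l u] \<open>psi s t u = 0\<close> by simp
    qed
    then show ?thesis
      using psi_frozen[OF st, of u] \<open>psi s t u = 0\<close> by simp
  qed
  have "inj (psi s t)"
  proof (rule injI)
    fix x y assume "psi s t x = psi s t y"
    then have "x - y = 0" by - (rule ker, simp add: psi_diff)
    then show "x = y" by simp
  qed
  moreover have "\<exists>u. g = psi s t u" for g
  proof -
    \<comment> \<open>This \<open>u\<close> matches the unfrozen coordinates of \<open>g\<close>;
      the remaining error is purely frozen and is fixed by \<open>psi\<close>.\<close>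
    define u where "u = (\<chi> i. - g $ inv \<sigma> i)"
    have "(g - psi s t u) $ k = 0" if "k \<in> U" for k
      using psi_nth_unfrozen[OF p that, of u] permutes_inverses(2)[OF \<sigma>] by (simp add: u_def)
    then have "psi s t (u + (g - psi s t u)) = g"
      using psi_frozen[OF st, of "g - psi s t u"] by (simp add: psi_add)
    then show ?thesis by metis
  qed
  ultimately show ?thesis
    unfolding bij_def surj_def by blast
qed

text \<open>Up to a factor this follows by pairing with \<open>\<lambda>\<close>. The factors \<open>d (\<sigma> k) / d k\<close> are positive integers,
  and they are all \<open>1\<close> because \<open>d \<circ> \<sigma>\<close> and \<open>d\<close> have the same sum over \<open>U\<close>.\<close>

lemma psi_p_star_unit:
  assumes p: "shift_pair s t \<sigma>" and k: "k \<in> U"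
  shows "psi s t (p_star t (unit_vec (\<sigma> k))) = - p_star s (unit_vec k)"
proof -
  have st: "s \<in> S" "t \<in> S" and \<sigma>: "\<sigma> permutes U"
    using p by (auto simp: shift_pair_def)
  note s = seed(1,2,3)[OF st(1)] and t = seed(1,2,3)[OF st(2)]
  have \<sigma>U: "\<sigma> k \<in> U" if "k \<in> U" for k
    using that permutes_in_image[OF \<sigma>] by simp
  have dpos: "d k > 0" if "k \<in> U" for k
    using d0 that by (simp add: compatible_with_def)
  have "\<exists>r. psi s t (p_star t (unit_vec (\<sigma> k))) = r *s p_star s (unit_vec k) \<and> d k * r = - d (\<sigma> k)"
    if k: "k \<in> U" for k
  proof -
    obtain n where n: "psi s t (p_star t (unit_vec (\<sigma> k))) = p_star s n"
      using psi_p_star_comparable[OF st \<sigma>U[OF k]] by blast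
    \<comment> \<open>\<open>psi\<close> sends the unit vector at \<open>\<sigma> j\<close> to minus
      the unit vector at \<open>j\<close>, up to frozen coordinates, so pairing with it isolates
      \<open>n $ j\<close>.\<close>
    have dn: "d j * n $ j = (if j = k then - d (\<sigma> k) else 0)" if j: "j \<in> U" for j
    proof -
      have "bilin (lam s) (p_star s n) (psi s t (unit_vec (\<sigma> j))) =
          bilin (lam t) (p_star t (unit_vec (\<sigma> k))) (unit_vec (\<sigma> j))"
        unfolding n[symmetric] by (rule bilin_psi[OF st])
      also have "\<dots> = (if j = k then d (\<sigma> k) else 0)"
        using bilin_p_star_unit_left[OF t(1,2), of "\<sigma> k" "unit_vec (\<sigma> j)"] \<sigma>U[OF k]
          permutes_inj[OF \<sigma>] by (auto simp: t(3) dest: injD)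
      finally have 1: "(\<Sum>l\<in>U. d l * n $ l * psi s t (unit_vec (\<sigma> j)) $ l) = (if j = k then d (\<sigma> k) else 0)"
        by (simp only: bilin_p_star[OF s(1,2)] s(3))
      have "(\<Sum>l\<in>U. d l * n $ l * psi s t (unit_vec (\<sigma> j)) $ l) = (\<Sum>l\<in>U. if l = j then - (d j * n $ j) else 0)"
        using permutes_inj[OF \<sigma>]
        by (intro sum.cong refl) (auto simp: psi_nth_unfrozen[OF p] simp del: psi_unit dest: injD)
      also have "\<dots> = - (d j * n $ j)" using j by simp
      finally show ?thesis using 1 by auto
    qed
    have "p_star s n = p_star s (n $ k *s unit_vec k)"
    proof -
      have "bmat s $ i $ j * n $ j = bmat s $ i $ j * (n $ k *s unit_vec k) $ j" for i j
      proof (cases "j \<in> U")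
        case True
        then show ?thesis using dn[OF True] dpos[OF True] by auto
      qed (simp add: quantum_seed_frozen_col[OF s(1)] s(3))
      then show ?thesis by (simp only: p_star_def matrix_vector_mult_def)
    qed
    also have "\<dots> = n $ k *s p_star s (unit_vec k)"
      by (simp add: p_star_def matrix_vector_mult_def vec_eq_iff sum_distrib_left mult_ac)
    finally show ?thesis using n dn[OF k] by auto
  qed
  then obtain r where r: "\<And>k. k \<in> U \<Longrightarrow> psi s t (p_star t (unit_vec (\<sigma> k))) = r k *s p_star s (unit_vec k)"
    "\<And>k. k \<in> U \<Longrightarrow> d k * r k = - d (\<sigma> k)"
    by metis
  have le: "d k \<le> d (\<sigma> k)" if "k \<in> U" for k
  proof -
    have "d k * - r k > 0" using r(2)[OF that] dpos[OF \<sigma>U[OF that]] by simp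
    then have "- r k > 0" using dpos[OF that] by (metis zero_less_mult_pos)
    then have "d k * 1 \<le> d k * - r k" using dpos[OF that] by (intro mult_left_mono) auto
    then show ?thesis using r(2)[OF that] by simp
  qed
  have "(\<Sum>k\<in>U. d (\<sigma> k)) = (\<Sum>k\<in>U. d k)"
    using sum.permute[OF \<sigma>, of d] by (simp add: o_def)
  then have "(\<Sum>k\<in>U. d (\<sigma> k) - d k) = 0"
    by (simp add: sum_subtractf)
  then have "d (\<sigma> k) - d k = 0"
    using le k by (subst (asm) sum_nonneg_eq_0_iff) auto
  then have "d k * r k = d k * (- 1)" using r(2)[OF k] by simp
  then have "r k = - 1" using dpos[OF k] by (simp only: mult_cancel_left) auto
  then show ?thesis using r(1)[OF k] by (simp add: vec_eq_iff)
qed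

lemma p_star_sum: "p_star t n = (\<Sum>k\<in>UNIV. (n $ k) *s p_star t (unit_vec k))"
  by (simp add: vec_eq_iff p_star_unit) (simp add: p_star_def matrix_vector_mult_def mult.commute)

lemma psi_p_star:
  assumes p: "shift_pair s t \<sigma>"
  shows "psi s t (p_star t n) = - p_star s (\<chi> j. n $ \<sigma> j)"
proof -
  have st: "s \<in> S" "t \<in> S" and \<sigma>: "\<sigma> permutes U"
    using p by (auto simp: shift_pair_def)
  have psi_sum: "psi s t (\<Sum>k\<in>X. f k) = (\<Sum>k\<in>X. psi s t (f k))" for X and f :: "'i \<Rightarrow> int ^ 'i"
    by (induction X rule: infinite_finite_induct) (simp_all add: psi_add)
  have zero: "p_star r (unit_vec k) = 0" if "r \<in> S" "k \<notin> U" for r k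
    using quantum_seed_frozen_col[OF seed(1)[OF that(1)]] that
    by (simp add: vec_eq_iff p_star_unit seed(3)[OF that(1)])
  have "psi s t (p_star t n) = (\<Sum>k\<in>UNIV. (n $ \<sigma> k) *s psi s t (p_star t (unit_vec (\<sigma> k))))"
    unfolding p_star_sum[of t n] psi_sum psi_scale
    using permutes_bij[OF \<sigma>] by (intro sum.reindex_bij_betw[symmetric]) simp
  also have "\<dots> = (\<Sum>k\<in>UNIV. - ((n $ \<sigma> k) *s p_star s (unit_vec k)))"
  proof (intro sum.cong refl)
    fix k
    show "(n $ \<sigma> k) *s psi s t (p_star t (unit_vec (\<sigma> k))) = - ((n $ \<sigma> k) *s p_star s (unit_vec k))"
    proof (cases "k \<in> U")
      case True
      then show ?thesis by (simp add: psi_p_star_unit[OF p] vec_eq_iff)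
    next
      case False
      then have "\<sigma> k \<notin> U" using permutes_in_image[OF \<sigma>] by simp
      then show ?thesis using False by (simp add: zero st)
    qed
  qed
  also have "\<dots> = - p_star s (\<chi> j. n $ \<sigma> j)"
    by (subst p_star_sum[of s "\<chi> j. n $ \<sigma> j"]) (simp add: sum_negf)
  finally show ?thesis .
qed

lemma dom_le_psi:
  assumes p: "shift_pair s t \<sigma>"
  shows "dom_le s (psi s t x) (psi s t y) \<longleftrightarrow> dom_le t y x"
proof -
  have st: "s \<in> S" "t \<in> S" and \<sigma>: "\<sigma> permutes U"
    using p by (auto simp: shift_pair_def)
  note Us = seed(3)[OF st(1)] and Ut = seed(3)[OF st(2)]
  show ?thesis
  proof
    assume "dom_le s (psi s t x) (psi s t y)"
    then obtain n where n: "n \<in> N_uf_nonneg s" "psi s t x = psi s t y + p_star s n"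
      by (auto simp: dom_le_def)
    define n' where "n' = (\<chi> i. n $ inv \<sigma> i)"
    have "(\<chi> j. n' $ \<sigma> j) = n"
      by (simp add: n'_def vec_eq_iff permutes_inverses(2)[OF \<sigma>])
    then have "psi s t (x + p_star t n') = psi s t y"
      using n(2) by (simp add: psi_add psi_p_star[OF p])
    then have "y = x + p_star t n'"
      using bij_psi[OF p] by (metis bij_is_inj injD)
    moreover have "n' \<in> N_uf_nonneg t"
      using n(1) permutes_in_image[OF permutes_inv[OF \<sigma>]] by (auto simp: N_uf_nonneg_def n'_def Us Ut)
    ultimately show "dom_le t y x" by (auto simp: dom_le_def)
  next
    assume "dom_le t y x"
    then obtain n where n: "n \<in> N_uf_nonneg t" "y = x + p_star t n"
      by (auto simp: dom_le_def)
    have "psi s t x = psi s t y + p_star s (\<chi> j. n $ \<sigma> j)"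
      unfolding n(2) by (simp add: psi_add psi_p_star[OF p])
    moreover have "(\<chi> j. n $ \<sigma> j) \<in> N_uf_nonneg s"
      using n(1) permutes_in_image[OF \<sigma>] by (auto simp: N_uf_nonneg_def Us Ut)
    ultimately show "dom_le s (psi s t x) (psi s t y)" by (auto simp: dom_le_def)
  qed
qed

text \<open>Multiplication by a large cluster monomial of \<open>t\<close> makes all exponents nonnegative.\<close>

lemma leading_imp_has_codegree:
  assumes p: "shift_pair s t \<sigma>" and Z: "Z \<in> LP t"
    and lead: "leading s (psi s t \<eta>) c Z" and c: "c \<noteq> 0"
  shows "has_codegree t \<eta> Z \<and> lp_coeff t Z \<eta> = c"
proof -
  have st: "s \<in> S" "t \<in> S"
    using p by (auto simp: shift_pair_def)
  note s = seed(1)[OF st(1)] and t = seed(1)[OF st(2)]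
  note qt = quantum_seed_torus[OF t]
  have veq: "vpar t = vpar s" using seed(4)[OF st(1)] seed(4)[OF st(2)] by simp
  have v0: "vpar s \<noteq> 0" using s by (simp add: quantum_seed_def)
  have inj: "inj (psi s t)" using bij_psi[OF p] by (rule bij_is_inj)
  define N where "N = Max (insert 0 ((\<lambda>(m, i). - m $ i) ` (lp_supp t Z \<times> UNIV)))"
  define u :: "int ^ 'i" where "u = (\<chi> i. N)"
  have u0: "u $ i \<ge> 0" for i
    unfolding u_def N_def by simp
  have mu0: "(m + u) $ i \<ge> 0" if "m \<in> lp_supp t Z" for m i
  proof -
    have "- m $ i \<le> N"
      unfolding N_def using that by (intro Max_ge) (auto intro!: image_eqI[of _ _ "(m, i)"])
    then show ?thesis by (simp add: u_def)
  qed
  define W where "W = Z * frame t u"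
  define Y where "Y m = frame t (m + u)" for m
  define b where "b m = lp_coeff t Z m * vp (bilin (lam t) m u)" for m
  have supp: "{m. b m \<noteq> 0} = lp_supp t Z"
    by (auto simp: b_def lp_supp_iff)
  have W: "W = lincomb (vpar s) Y b"
    unfolding W_def lincomb_def supp Y_def
    by (subst LP_expand[OF t Z])
      (simp add: sum_distrib_right mult.assoc torus_frame_mult[OF qt] b_def scalar_mult v0 veq)
  have lY: "leading s (psi s t (m + u)) 1 (Y m)" if "b m \<noteq> 0" for m
    unfolding Y_def using mu0 that supp by (intro leading_psi[OF st]) auto
  have lW: "leading s (psi s t (\<eta> + u)) (vp (bilin (lam t) \<eta> u) * c) W"
    using leading_mult[OF s lead leading_psi[OF st u0]] by (simp add: W_def psi_add bilin_psi[OF st])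
  have injb: "inj_on (\<lambda>m. psi s t (m + u)) {m. b m \<noteq> 0}"
    by (rule inj_onI) (use injD[OF inj] add_right_cancel in blast)
  have fin: "finite {m. b m \<noteq> 0}" by (simp add: supp)
  have le: "dom_le s (psi s t (m + u)) (psi s t (\<eta> + u))" if "b m \<noteq> 0" for m
    by (rule below_lincombD[OF s fin _ injb _ that, where p = "\<lambda>_. 1" and Y = Y])
      (use lY lW W in \<open>auto simp: leading_def\<close>)
  \<comment> \<open>The top coefficient of \<open>W\<close> must come from some term
    \<open>m\<close>. The degree of that term is both above and below the top degree, so injectivity
    of \<open>psi\<close> gives \<open>m = \<eta>\<close>.\<close>
  have b\<eta>: "b \<eta> \<noteq> 0"
  proof -
    have LPY: "Y m \<in> LP s" if "b m \<noteq> 0" for m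
      using lY[OF that] by (simp add: leading_def below_def)
    have "lp_coeff s W (psi s t (\<eta> + u)) = (\<Sum>m | b m \<noteq> 0. b m * lp_coeff s (Y m) (psi s t (\<eta> + u)))"
      unfolding W lincomb_def
      by (subst lp_coeff_sum[OF s]) (use LPY v0 in \<open>auto simp: LP_scale lp_coeff_scale[OF s]\<close>)
    moreover have "lp_coeff s W (psi s t (\<eta> + u)) \<noteq> 0"
      using lW c by (simp add: leading_def)
    ultimately obtain m where m: "b m \<noteq> 0" "lp_coeff s (Y m) (psi s t (\<eta> + u)) \<noteq> 0"
      by (metis (mono_tags, lifting) mem_Collect_eq mult_zero_right sum.not_neutral_contains_not_neutral)
    then have "dom_le s (psi s t (\<eta> + u)) (psi s t (m + u))"
      using lY[OF m(1)] by (auto simp: leading_def below_def)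
    then have "psi s t (m + u) = psi s t (\<eta> + u)"
      using le[OF m(1)] dom_le_antisym[OF s] by blast
    then have "m + u = \<eta> + u" by (rule injD[OF inj])
    then show ?thesis using m(1) by simp
  qed
  have "lp_coeff s W (psi s t (\<eta> + u)) = b \<eta> * 1"
    unfolding W
  proof (rule leading_lincomb_maximal[OF s fin lY injb b\<eta>])
    show "psi s t (y + u) = psi s t (\<eta> + u)"
      if "b y \<noteq> 0" "dom_le s (psi s t (\<eta> + u)) (psi s t (y + u))" for y
      using le[OF that(1)] that(2) dom_le_antisym[OF s] by blast
  qed
  then have "lp_coeff t Z \<eta> * vp (bilin (lam t) \<eta> u) = c * vp (bilin (lam t) \<eta> u)"
    using lW by (simp add: leading_def b_def mult.commute)
  then have coeff: "lp_coeff t Z \<eta> = c" by simp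
  moreover have "dom_le t \<eta> m" if "lp_coeff t Z m \<noteq> 0" for m
    using le[of m] that dom_le_psi[OF p, of "m + u" "\<eta> + u"] by (simp add: b_def)
  ultimately show ?thesis
    using Z c by (simp add: has_codegree_iff[OF t])
qed

lemma shift_pair_copointed:
  assumes p: "shift_pair s t \<sigma>" and Z: "Z \<in> L" and "pointed s (psi s t \<eta>) Z"
  shows "copointed t \<eta> Z"
proof -
  have st: "s \<in> S" "t \<in> S" using p by (auto simp: shift_pair_def)
  have "Z \<in> LP t" using pointed_ex[OF st(2) Z] pointed_LP by blast
  then show ?thesis
    using leading_imp_has_codegree[OF p, of Z \<eta> 1] assms(3) seed(1)[OF st(1)]
    by (simp add: copointed_def pointed_iff_leading)
qed


section \<open>Mutation of shifted pairs\<close>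

lemma p_star_mutate_unit:
  "p_star (mutate k t) (unit_vec k) = - p_star t (unit_vec k)"
  by (simp add: vec_eq_iff p_star_unit mutate_bmat_def)

text \<open>A variable of \<open>t\<close> other than the one at \<open>\<sigma> k\<close> has a
  degree in \<open>s\<close> with coordinate 0 at \<open>k\<close>, and the tropical transformation
  at \<open>k\<close> fixes such degrees.\<close>

lemma psi_mutate_zero_coord:
  assumes p: "shift_pair s t \<sigma>" and k: "k \<in> U" and u: "u $ \<sigma> k = 0"
  shows "psi (mutate k s) t u = psi s t u"
proof -
  have st: "s \<in> S" "t \<in> S" and \<sigma>: "\<sigma> permutes U"
    using p by (auto simp: shift_pair_def)
  have "degv (mutate k s) t i = degv s t i" if "i \<noteq> \<sigma> k" for i
  proof (rule degv_eqI[OF seed_mutate[OF st(1) k] st(2)])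
    have "degv s t i $ k = 0"
      using psi_nth_unfrozen[OF p k, of "unit_vec i"] that by auto
    then show "pointed (mutate k s) (degv s t i) (cluster_var t i)"
      using pointed_trop[OF st(1) cluster_var_mem_L[OF st(2)] k pointed_degv[OF st], of i]
      by (simp add: trop_zero_coord[OF seed(1)[OF st(1)]])
  qed
  then show ?thesis
    unfolding psi_def using u by (intro sum.cong refl) (metis vector_smult_lzero)
qed

text \<open>Seen from \<open>mutate k s\<close>, the exchange term of \<open>neg_col\<close>
  dominates, because \<open>psi\<close> negates column \<open>\<sigma> k\<close> and mutating
  \<open>s\<close> negates column \<open>k\<close>. Thus the degree of the product of the old and
  the new variable is known, and subtracting that of the old one leaves the new degree.\<close>

lemma degv_mutate_mutate:
  assumes p: "shift_pair s t \<sigma>" and k: "k \<in> U"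
  shows "degv (mutate k s) (mutate (\<sigma> k) t) (\<sigma> k) =
    psi s t (neg_col (\<sigma> k) t) - trop k s (degv s t (\<sigma> k))"
proof -
  let ?s' = "mutate k s" and ?k = "\<sigma> k"
  have st: "s \<in> S" "t \<in> S" and \<sigma>: "\<sigma> permutes U"
    using p by (auto simp: shift_pair_def)
  have \<sigma>k: "?k \<in> U" using k permutes_in_image[OF \<sigma>] by simp
  have s': "?s' \<in> S" by (rule seed_mutate[OF st(1) k])
  note qs' = seed(1)[OF s'] and t = seed(1)[OF st(2)]
  have k': "?k \<in> unfrozen t" using \<sigma>k seed(3)[OF st(2)] by simp
  have veq: "vpar t = vpar ?s'" using seed(4)[OF s'] seed(4)[OF st(2)] by simp
  let ?a = "bilin (lam t) (exch_minus ?k t) (neg_col ?k t)"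
  let ?b = "bilin (lam t) (exch_minus ?k t) (pos_col ?k t)"
  let ?W = "mutate_var ?k t * frame t (unit_vec ?k)"
  have diag: "bmat t $ ?k $ ?k = 0" by (rule bmat_diag[OF t])
  have minus: "leading ?s' (psi s t (neg_col ?k t)) (vp ?a) (vpar ?s' powi ?a * frame t (neg_col ?k t))"
    using leading_powi_scale[OF qs' leading_psi[OF s' st(2), of "neg_col ?k t"], of ?a]
      psi_mutate_zero_coord[OF p k, of "neg_col ?k t"] by (simp add: diag)
  have plus: "leading ?s' (psi s t (pos_col ?k t)) (vp ?b) (vpar ?s' powi ?b * frame t (pos_col ?k t))"
    using leading_powi_scale[OF qs' leading_psi[OF s' st(2), of "pos_col ?k t"], of ?b]
      psi_mutate_zero_coord[OF p k, of "pos_col ?k t"] by (simp add: diag)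
  have eq: "psi s t (pos_col ?k t) = psi s t (neg_col ?k t) + p_star ?s' (unit_vec k)"
    by (simp add: pos_col_eq psi_add psi_p_star_unit[OF p k] p_star_mutate_unit)
  have "unit_vec k \<in> N_uf_nonneg ?s'"
    using k seed(3)[OF s'] by (auto simp: N_uf_nonneg_def)
  then have le: "dom_le ?s' (psi s t (pos_col ?k t)) (psi s t (neg_col ?k t))"
    unfolding dom_le_def eq by blast
  have ne: "psi s t (pos_col ?k t) \<noteq> psi s t (neg_col ?k t)"
    unfolding eq using p_star_unit_neq_0[OF s' k] by simp
  have "?W = vpar ?s' powi ?a * frame t (neg_col ?k t) + vpar ?s' powi ?b * frame t (pos_col ?k t)"
    using exchange_relation[OF t k'] veq by simp
  then have 1: "leading ?s' (psi s t (neg_col ?k t)) (vp ?a) ?W"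
    using leading_add_lower[OF qs' minus plus le ne] by simp
  obtain q where 2: "q \<noteq> 0" "leading ?s' (degv ?s' (mutate ?k t) ?k + degv ?s' t ?k) q ?W"
    using leading_exchange[OF s' st(2) \<sigma>k] by metis
  have "degv ?s' t ?k = trop k s (degv s t ?k)"
    by (intro degv_eqI[OF s' st(2)] pointed_trop[OF st(1) cluster_var_mem_L[OF st(2)] k pointed_degv[OF st]])
  then show ?thesis
    using leading_unique[OF qs' 1 2(2)] 2(1) by (simp add: eq_diff_eq)
qed

text \<open>Only the image of the unit vector at \<open>\<sigma> k\<close> changes, so the new map
  is a rank one correction of the old one.\<close>

lemma psi_mutate_mutate:
  assumes p: "shift_pair s t \<sigma>" and k: "k \<in> U"
  shows "psi (mutate k s) (mutate (\<sigma> k) t) u =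
    psi s t u + (u $ \<sigma> k) *s (psi s t (neg_col (\<sigma> k) t) - trop k s (degv s t (\<sigma> k)) - degv s t (\<sigma> k))"
proof -
  let ?s' = "mutate k s" and ?k = "\<sigma> k" and ?t' = "mutate (\<sigma> k) t"
  have st: "s \<in> S" "t \<in> S" and \<sigma>: "\<sigma> permutes U"
    using p by (auto simp: shift_pair_def)
  have \<sigma>k: "?k \<in> U" using k permutes_in_image[OF \<sigma>] by simp
  have k': "?k \<in> unfrozen t" using \<sigma>k seed(3)[OF st(2)] by simp
  have "degv ?s' ?t' i = degv ?s' t i" if "i \<noteq> ?k" for i
    using cluster_var_mutate[OF seed(1)[OF st(2)] k', of i] that by (simp add: degv_def)
  then have eq: "psi ?s' ?t' w = psi ?s' t w" if "w $ ?k = 0" for w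
    unfolding psi_def using that by (intro sum.cong refl) (metis vector_smult_lzero)
  have "psi ?s' ?t' u = psi ?s' ?t' (drop_coord ?k u) + (u $ ?k) *s degv ?s' ?t' ?k"
    by (subst drop_coord_plus_unit[of u ?k]) (simp add: psi_add psi_scale)
  also have "psi ?s' ?t' (drop_coord ?k u) = psi s t (drop_coord ?k u)"
    by (simp add: eq psi_mutate_zero_coord[OF p k])
  also have "psi s t (drop_coord ?k u) = psi s t u - (u $ ?k) *s degv s t ?k"
    by (subst (2) drop_coord_plus_unit[of u ?k]) (simp add: psi_add psi_scale)
  finally show ?thesis
    by (simp add: degv_mutate_mutate[OF p k] vec_eq_iff algebra_simps)
qed

text \<open>\<open>psi\<close> negates both the coordinate at \<open>\<sigma> k\<close> and the
  exchange column, which is why the opposite sign convention in \<open>t\<close> corresponds to the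
  ordinary one in \<open>s\<close>.\<close>

lemma psi_trop_op:
  assumes p: "shift_pair s t \<sigma>" and k: "k \<in> U"
  shows "psi (mutate k s) (mutate (\<sigma> k) t) (trop_op (\<sigma> k) t u) = trop k s (psi s t u)"
proof -
  let ?k = "\<sigma> k"
  have st: "s \<in> S" "t \<in> S" using p by (auto simp: shift_pair_def)
  note s = seed(1)[OF st(1)] and t = seed(1)[OF st(2)]
  have degk: "degv s t ?k $ k = - 1"
    using psi_nth_unfrozen[OF p k, of "unit_vec ?k"] by simp
  have tr: "trop k s (degv s t ?k) = degv s t ?k + 2 *s unit_vec k - neg_col k s"
    by (simp add: trop_eq[OF s] degk pos_part_def vec_eq_iff)
  have up: "psi s t (pos_col ?k t) = psi s t (neg_col ?k t) - p_star s (unit_vec k)"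
    by (simp add: pos_col_eq psi_add psi_p_star_unit[OF p k])
  have nth: "trop_op ?k t u $ ?k = - u $ ?k"
    by (simp add: trop_op_def)
  have gk: "psi s t u $ k = - u $ ?k" by (rule psi_nth_unfrozen[OF p k])
  have us: "pos_col k s = neg_col k s + p_star s (unit_vec k)" by (rule pos_col_eq)
  \<comment> \<open>Eliminating one positive part leaves a single nonlinear quantity on both sides,
    after which they agree coordinatewise.\<close>
  have pp: "pos_part (u $ ?k) = u $ ?k + pos_part (- u $ ?k)"
    using pos_part_diff[of "u $ ?k"] by simp
  have "psi s t (trop_op ?k t u) = psi s t u - (2 * u $ ?k) *s degv s t ?k
      + pos_part (u $ ?k) *s psi s t (neg_col ?k t)
      - pos_part (- u $ ?k) *s (psi s t (neg_col ?k t) - p_star s (unit_vec k))"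
    by (simp add: trop_op_eq[OF t] psi_add psi_diff psi_scale up)
  then show ?thesis
    unfolding psi_mutate_mutate[OF p k] nth tr trop_eq[OF s, of k "psi s t u"] gk us
    by (simp add: vec_eq_iff algebra_simps pp)
qed

lemma shift_pair_mutate:
  assumes p: "shift_pair s t \<sigma>" and k: "k \<in> U"
  shows "shift_pair (mutate k s) (mutate (\<sigma> k) t) \<sigma>"
proof -
  have st: "s \<in> S" "t \<in> S" and \<sigma>: "\<sigma> permutes U"
    and B: "\<And>i j. i \<in> U \<Longrightarrow> j \<in> U \<Longrightarrow> bmat t $ \<sigma> i $ \<sigma> j = bmat s $ i $ j"
    using p by (auto simp: shift_pair_def)
  note s = seed(1)[OF st(1)]
  have \<sigma>U: "\<sigma> i \<in> U" if "i \<in> U" for i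
    using that permutes_in_image[OF \<sigma>] by simp
  have \<sigma>inj: "\<sigma> i = \<sigma> j \<longleftrightarrow> i = j" for i j
    using permutes_inj[OF \<sigma>] by (auto dest: injD)
  have degk: "degv s t (\<sigma> k) $ k = - 1"
    using psi_nth_unfrozen[OF p k, of "unit_vec (\<sigma> k)"] by simp
  have tr: "trop k s (degv s t (\<sigma> k)) = degv s t (\<sigma> k) + 2 *s unit_vec k - neg_col k s"
    by (simp add: trop_eq[OF s] degk pos_part_def vec_eq_iff)
  have "degv (mutate k s) (mutate (\<sigma> k) t) (\<sigma> l) $ i = (if i = l then - 1 else 0)"
    if "l \<in> U" "i \<in> U" for l i
  proof -
    \<comment> \<open>On unfrozen coordinates the \<open>neg_col\<close> terms of the rank one
      correction therefore cancel, and the rest vanishes because the degree at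
      \<open>\<sigma> k\<close> is minus a unit vector there.\<close>
    have "psi s t (neg_col (\<sigma> k) t) $ i = - neg_col k s $ i"
      using psi_nth_unfrozen[OF p \<open>i \<in> U\<close>] B[OF \<open>i \<in> U\<close> k] by simp
    moreover have "degv s t (\<sigma> j) $ i = (if i = j then - 1 else 0)" for j
      using psi_nth_unfrozen[OF p \<open>i \<in> U\<close>, of "unit_vec (\<sigma> j)"] by (auto simp: \<sigma>inj)
    moreover have "psi (mutate k s) (mutate (\<sigma> k) t) (unit_vec (\<sigma> l)) $ i =
        (psi s t (unit_vec (\<sigma> l)) + (unit_vec (\<sigma> l) $ \<sigma> k) *s (psi s t (neg_col (\<sigma> k) t)
          - (degv s t (\<sigma> k) + 2 *s unit_vec k - neg_col k s) - degv s t (\<sigma> k))) $ i"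
      unfolding psi_mutate_mutate[OF p k] tr ..
    ultimately show ?thesis
      by (auto simp: \<sigma>inj)
  qed
  moreover have "mutate_bmat (\<sigma> k) t $ \<sigma> i $ \<sigma> j = mutate_bmat k s $ i $ j" if "i \<in> U" "j \<in> U" for i j
    using that k by (simp add: mutate_bmat_def \<sigma>inj B)
  ultimately show ?thesis
    using seed_mutate[OF st(1) k] seed_mutate[OF st(2) \<sigma>U[OF k]] \<sigma>
    by (simp add: shift_pair_def)
qed

text \<open>The permutation is constant along the path and only the partner moves, so a single pair
  yields a partner for every seed that can be reached.\<close>

lemma shift_pair_mutate_seq:
  assumes "shift_pair s t \<sigma>" "set w \<subseteq> U"
  obtains s' where "shift_pair s' (mutate_seq w t) \<sigma>"
    "\<And>Z \<eta>. Z \<in> L \<Longrightarrow> pointed s (psi s t \<eta>) Z \<Longrightarrow>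
      pointed s' (psi s' (mutate_seq w t) (trop_op_seq w t \<eta>)) Z"
  using assms
proof (induction w arbitrary: s t thesis)
  case Nil
  then show ?case by simp
next
  case (Cons k w)
  have \<sigma>: "\<sigma> permutes U" and s: "s \<in> S" using Cons.prems by (auto simp: shift_pair_def)
  \<comment> \<open>Mutating \<open>t\<close> at \<open>k\<close> has to be accompanied by mutating
    \<open>s\<close> at the vertex that \<open>\<sigma>\<close> matches with
    \<open>k\<close>.\<close>
  define l where "l = inv \<sigma> k"
  have l: "\<sigma> l = k" "l \<in> U"
    using permutes_inverses(1)[OF \<sigma>] permutes_in_image[OF permutes_inv[OF \<sigma>]] Cons.prems
    by (auto simp: l_def)
  have p: "shift_pair (mutate l s) (mutate k t) \<sigma>"
    using shift_pair_mutate[OF Cons.prems(2) l(2)] l(1) by simp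
  have step: "pointed (mutate l s) (psi (mutate l s) (mutate k t) (trop_op k t \<eta>)) Z"
    if "Z \<in> L" "pointed s (psi s t \<eta>) Z" for Z \<eta>
    using psi_trop_op[OF Cons.prems(2) l(2), of \<eta>] pointed_trop[OF s that(1) l(2) that(2)] l(1) by simp
  obtain s' where s': "shift_pair s' (mutate_seq w (mutate k t)) \<sigma>"
    "\<And>Z \<eta>. Z \<in> L \<Longrightarrow> pointed (mutate l s) (psi (mutate l s) (mutate k t) \<eta>) Z \<Longrightarrow>
      pointed s' (psi s' (mutate_seq w (mutate k t)) (trop_op_seq w (mutate k t) \<eta>)) Z"
    using Cons.IH[OF _ p] Cons.prems(3) by auto
  show ?case
    by (rule Cons.prems(1)[of s']) (use s' step in auto)
qed

end


section \<open>Triangular expansions\<close>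

lemma laurent_m_0 [simp]: "0 \<in> laurent_m"
  by (simp add: laurent_m_def)

lemma laurent_m_add: "p \<in> laurent_m \<Longrightarrow> q \<in> laurent_m \<Longrightarrow> p + q \<in> laurent_m"
  unfolding laurent_m_def using Poly_Mapping.keys_add[of p q] by blast

lemma laurent_m_uminus: "p \<in> laurent_m \<Longrightarrow> - p \<in> laurent_m"
  by (simp add: laurent_m_def)

lemma laurent_m_diff: "p \<in> laurent_m \<Longrightarrow> q \<in> laurent_m \<Longrightarrow> p - q \<in> laurent_m"
  using laurent_m_add[of p "- q"] by (simp add: laurent_m_uminus)

lemma laurent_m_sum: "(\<And>x. x \<in> X \<Longrightarrow> f x \<in> laurent_m) \<Longrightarrow> sum f X \<in> laurent_m"
  by (induction X rule: infinite_finite_induct) (auto intro: laurent_m_add)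

lemma laurent_m_mult: "p \<in> laurent_m \<Longrightarrow> q \<in> laurent_m \<Longrightarrow> p * q \<in> laurent_m"
proof -
  assume "p \<in> laurent_m" "q \<in> laurent_m"
  then have "n < 0" if "n \<in> {a + b | a b. a \<in> Poly_Mapping.keys p \<and> b \<in> Poly_Mapping.keys q}" for n
    using that by (auto simp: laurent_m_def intro: add_neg_neg)
  then show ?thesis
    unfolding laurent_m_def using Poly_Mapping.keys_mult[of p q] by blast
qed

lemma laurent_m_mult_vp: "p \<in> laurent_m \<Longrightarrow> e \<le> 0 \<Longrightarrow> p * vp e \<in> laurent_m"
proof -
  assume "p \<in> laurent_m" "e \<le> 0"
  then have "n < 0" if "n \<in> {a + b | a b. a \<in> Poly_Mapping.keys p \<and> b \<in> Poly_Mapping.keys (vp e)}" for n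
    using that by (auto simp: laurent_m_def vp_def intro: add_neg_nonpos)
  then show ?thesis
    unfolding laurent_m_def using Poly_Mapping.keys_mult[of p "vp e"] by blast
qed

lemma lookup_laurent_bar: "Poly_Mapping.lookup (laurent_bar p) n = Poly_Mapping.lookup p (- n)"
  by (simp add: laurent_bar_def map_key.rep_eq)

lemma laurent_bar_diff: "laurent_bar (p - q) = laurent_bar p - laurent_bar q"
  by (rule poly_mapping_eqI) (simp add: lookup_laurent_bar lookup_minus)

text \<open>The support is symmetric about 0 and consists of negative exponents. This is the
  coefficient form of the uniqueness argument for canonical bases.\<close>

lemma laurent_bar_m_eq_0:
  assumes "laurent_bar p = p" "p \<in> laurent_m"
  shows "p = 0"
proof (rule poly_mapping_eqI)
  fix n
  have nonneg: "Poly_Mapping.lookup p n = 0" if "n \<ge> 0" for n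
  proof (rule ccontr)
    assume "Poly_Mapping.lookup p n \<noteq> 0"
    then have "n \<in> Poly_Mapping.keys p" by (simp add: in_keys_iff)
    then have "n < 0" using assms(2) unfolding laurent_m_def by blast
    then show False using that by simp
  qed
  have "Poly_Mapping.lookup p n = Poly_Mapping.lookup p (- n)"
    using lookup_laurent_bar[of p n] unfolding assms(1) .
  then have "Poly_Mapping.lookup p n = 0"
    using nonneg[of n] nonneg[of "- n"] by (cases "n \<ge> 0") auto
  then show "Poly_Mapping.lookup p n = Poly_Mapping.lookup 0 n" by simp
qed

lemma bar_invariant_coeff:
  assumes t: "quantum_seed t" and Z: "bar_invariant t Z"
  shows "laurent_bar (lp_coeff t Z m) = lp_coeff t Z m"
proof -
  have inj: "inj (laurent_expand t)" using t by (simp add: quantum_seed_def)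
  have "Z = laurent_expand t (lp_coeffs t Z)"
    using Z inj by (auto simp: bar_invariant_def LP_def lp_coeffs_def the_inv_f_f)
  then have "laurent_expand t (Poly_Mapping.map laurent_bar (lp_coeffs t Z)) = laurent_expand t (lp_coeffs t Z)"
    using Z by (simp add: bar_invariant_def bar_def)
  then have eq: "Poly_Mapping.map laurent_bar (lp_coeffs t Z) = lp_coeffs t Z"
    using inj by (rule injD[rotated])
  have bar0: "laurent_bar 0 = 0"
    by (rule poly_mapping_eqI) (simp add: lookup_laurent_bar)
  have "Poly_Mapping.lookup (Poly_Mapping.map laurent_bar (lp_coeffs t Z)) m =
      laurent_bar (Poly_Mapping.lookup (lp_coeffs t Z) m)"
    by (simp add: map.rep_eq when_def bar0)
  then show ?thesis
    unfolding eq by (simp add: lp_coeff_def)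
qed

context common_triangular
begin

section \<open>The basis parametrized by degrees with respect to one seed\<close>

definition Lb :: "('i, 'f) qseed \<Rightarrow> int ^ 'i \<Rightarrow> 'f" where
  "Lb s g = (THE Z. Z \<in> L \<and> pointed s g Z)"

lemma Lb:
  assumes "s \<in> S"
  shows "Lb s g \<in> L" "pointed s g (Lb s g)"
proof -
  obtain Lg where Lg: "L = range Lg" "\<forall>g. pointed s g (Lg g)"
    using basis_pointed[OF assms] by blast
  have "\<exists>!Z. Z \<in> L \<and> pointed s g Z"
  proof (rule ex1I[of _ "Lg g"])
    show "Lg g \<in> L \<and> pointed s g (Lg g)" using Lg by auto
    show "Z = Lg g" if "Z \<in> L \<and> pointed s g Z" for Z
      using that Lg by (intro pointed_inj[OF assms]) auto
  qed
  from theI'[OF this] show "Lb s g \<in> L" "pointed s g (Lb s g)"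
    by (simp_all add: Lb_def)
qed

lemma Lb_eqI: "s \<in> S \<Longrightarrow> Z \<in> L \<Longrightarrow> pointed s g Z \<Longrightarrow> Lb s g = Z"
  using pointed_inj[of s "Lb s g" Z g] Lb[of s g] by blast

lemma range_Lb:
  assumes "s \<in> S"
  shows "range (Lb s) = L"
proof
  show "range (Lb s) \<subseteq> L" using Lb(1)[OF assms] by auto
  show "L \<subseteq> range (Lb s)"
  proof
    fix Z assume Z: "Z \<in> L"
    then obtain g where "pointed s g Z" using pointed_ex[OF assms] by blast
    then have "Z = Lb s g" using Lb_eqI[OF assms Z] by simp
    then show "Z \<in> range (Lb s)" by blast
  qed
qed

lemma inj_Lb:
  assumes "s \<in> S"
  shows "inj (Lb s)"
proof (rule injI)
  fix g h assume "Lb s g = Lb s h"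
  then have "pointed s h (Lb s g)" using Lb(2)[OF assms, of h] by simp
  then show "g = h" using pointed_unique[OF assms Lb(2)[OF assms]] by blast
qed

lemma leading_Lb: "s \<in> S \<Longrightarrow> leading s g 1 (Lb s g)"
  using Lb(2) pointed_iff_leading[OF seed(1)] by blast

lemma v_neq_0: "v \<noteq> 0"
  using t0 by (simp add: quantum_seed_def)

lemma v_commute: "v powi a * x = x * v powi a"
  by (rule torus_powi_commute[OF quantum_seed_torus[OF t0]])

lemma v_add: "v powi a * v powi b = v powi (a + b)"
  by (rule torus_powi_add[OF quantum_seed_torus[OF t0]])

lemma v_add_left: "v powi a * (v powi b * x) = v powi (a + b) * x"
  by (simp add: mult.assoc[symmetric] v_add)

lemma v_commute_left: "x * (v powi a * y) = v powi a * (x * y)"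
  by (metis v_commute mult.assoc)

lemma scalar_commute_left: "x * (scalar v p * y) = scalar v p * (x * y)"
  by (metis torus_scalar_central[OF quantum_seed_torus[OF t0]] mult.assoc)

lemma basis: "kk_basis v L A"
  using triangular[OF seeds_refl] by (simp add: triangular_basis_def degree_triangular_def)

lemma L_subset_A: "L \<subseteq> A"
  using basis module.span_superset[OF module_scale[OF v_neq_0]] unfolding kk_basis_def by blast

lemma A_mult: "x \<in> A \<Longrightarrow> y \<in> A \<Longrightarrow> x * y \<in> A"
  using subalgebra by (simp add: kk_subalgebra_def)

lemma A_scale: "x \<in> A \<Longrightarrow> v powi a * x \<in> A"
  using subalgebra module.subspace_scale[OF module_scale[OF v_neq_0], of A x "vp a"]
  by (simp add: kk_subalgebra_def scale_def)

lemma A_expand: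
  assumes s: "s \<in> S" and Z: "Z \<in> A"
  obtains c where "finite {g. c g \<noteq> 0}" "Z = lincomb v (Lb s) c"
proof -
  have "Z \<in> module.span (scale v) L" using basis Z by (simp add: kk_basis_def)
  then obtain T r where T: "finite T" "T \<subseteq> L" "Z = (\<Sum>a\<in>T. scale v (r a) a)"
    unfolding module.span_explicit[OF module_scale[OF v_neq_0]] by blast
  define G where "G = Lb s -` T"
  have G: "finite G" "Lb s ` G = T"
    using finite_vimageI[OF T(1) inj_Lb[OF s]] T(2) range_Lb[OF s] by (auto simp: G_def)
  define c where "c g = (if g \<in> G then r (Lb s g) else 0)" for g
  have sub: "{g. c g \<noteq> 0} \<subseteq> G" by (auto simp: c_def)
  have "Z = (\<Sum>g\<in>G. scale v (r (Lb s g)) (Lb s g))"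
    unfolding T(3) G(2)[symmetric] using inj_Lb[OF s]
    by (subst sum.reindex) (auto intro: inj_on_subset)
  also have "\<dots> = lincomb v (Lb s) c"
    by (subst lincomb_superset[OF G(1) sub]) (auto simp: c_def scale_def intro!: sum.cong)
  finally show ?thesis
    using that finite_subset[OF sub G(1)] by blast
qed

lemma lincomb_Lb_eq_0:
  assumes s: "s \<in> S" and "finite {g. c g \<noteq> 0}" "lincomb v (Lb s) c = 0"
  shows "c g = 0"
proof (rule lincomb_leading_eq_0[OF seed(1)[OF s] assms(2), where \<delta> = "\<lambda>g. g" and p = "\<lambda>_. 1" and Y = "Lb s"])
  show "lincomb (vpar s) (Lb s) c = 0" using assms(3) seed(4)[OF s] by simp
qed (auto simp: leading_Lb[OF s])

lemma lincomb_Lb_unique: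
  assumes s: "s \<in> S" and c: "finite {g. c g \<noteq> 0}" and c': "finite {g. c' g \<noteq> 0}"
    and eq: "lincomb v (Lb s) c = lincomb v (Lb s) c'"
  shows "c = c'"
proof
  fix g
  have 1: "finite {g. - 1 * c' g \<noteq> 0}" by (rule finite_supp_scale[OF c'])
  have "lincomb v (Lb s) (\<lambda>g. c g + - 1 * c' g) = 0"
    unfolding lincomb_add[OF c 1] lincomb_scale[OF c' v_neq_0] using eq
    by (simp add: scalar_uminus)
  from lincomb_Lb_eq_0[OF s finite_supp_add[OF c 1] this] show "c g = c' g"
    by simp
qed

text \<open>Every term other than \<open>Lb s h\<close> has a degree strictly below
  \<open>h\<close>, so \<open>h\<close> is not in its support.\<close>

lemma lincomb_Lb_below:
  assumes s: "s \<in> S" and c: "finite {g. c g \<noteq> 0}" and below: "below s h (lincomb v (Lb s) c)"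
  shows "c g \<noteq> 0 \<Longrightarrow> dom_le s g h" and "lp_coeff s (lincomb v (Lb s) c) h = c h"
proof -
  note qs = seed(1)[OF s]
  have le: "dom_le s g h" if "c g \<noteq> 0" for g
    by (rule below_lincombD[OF qs c, where \<delta> = "\<lambda>g. g" and p = "\<lambda>_. 1" and Y = "Lb s"])
      (use below that seed(4)[OF s] in \<open>auto simp: leading_Lb[OF s]\<close>)
  then show "c g \<noteq> 0 \<Longrightarrow> dom_le s g h" .
  have LP: "Lb s g \<in> LP s" for g
    using leading_Lb[OF s] by (simp add: leading_def below_def)
  have LPs: "scalar v p * Lb s g \<in> LP s" for p g
    using LP_scale[OF LP, of p] v_neq_0 seed(4)[OF s] by simp
  have scale: "lp_coeff s (scalar v p * Lb s g) h = p * lp_coeff s (Lb s g) h" for p g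
    using lp_coeff_scale[OF qs LP, of p] seed(4)[OF s] by simp
  have "lp_coeff s (lincomb v (Lb s) c) h = (\<Sum>g | c g \<noteq> 0. c g * lp_coeff s (Lb s g) h)"
    unfolding lincomb_def by (simp add: lp_coeff_sum[OF qs] LPs scale)
  also have "\<dots> = (\<Sum>g | c g \<noteq> 0. if g = h then c h else 0)"
  proof (intro sum.cong refl)
    fix g assume g: "g \<in> {g. c g \<noteq> 0}"
    show "c g * lp_coeff s (Lb s g) h = (if g = h then c h else 0)"
    proof (cases "g = h")
      case False
      then have "\<not> dom_le s h g"
        using le[of g] g dom_le_antisym[OF qs] by blast
      then have "lp_coeff s (Lb s g) h = 0"
        using leading_Lb[OF s, of g] by (auto simp: leading_def below_def)
      then show ?thesis using False by simp
    qed (use leading_Lb[OF s, of g] in \<open>simp add: leading_def\<close>)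
  qed
  also have "\<dots> = c h" using c by simp
  finally show "lp_coeff s (lincomb v (Lb s) c) h = c h" .
qed

section \<open>Unitriangular expansions and left multiplication\<close>

definition tri_coeffs :: "('i, 'f) qseed \<Rightarrow> int ^ 'i \<Rightarrow> (int ^ 'i \<Rightarrow> laurent) \<Rightarrow> bool" where
  "tri_coeffs s g c \<longleftrightarrow> finite {h. c h \<noteq> 0} \<and> c g = 1 \<and> (\<forall>h. c h \<noteq> 0 \<longrightarrow> dom_le s h g) \<and>
     (\<forall>h. h \<noteq> g \<longrightarrow> c h \<in> laurent_m)"

definition tri :: "('i, 'f) qseed \<Rightarrow> int ^ 'i \<Rightarrow> 'f \<Rightarrow> bool" where
  "tri s g W \<longleftrightarrow> (\<exists>c. tri_coeffs s g c \<and> W = lincomb v (Lb s) c)"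

lemma tri_Lb: "tri s g (Lb s g)"
  unfolding tri_def tri_coeffs_def
  by (intro exI[of _ "\<lambda>h. if h = g then 1 else 0"]) (auto simp: lincomb_single)

lemma tri_lincomb:
  assumes s: "s \<in> S" and c: "tri_coeffs s g c"
    and Y: "\<And>h. c h \<noteq> 0 \<Longrightarrow> tri s (h + \<delta>) (Y h)"
    and e: "\<And>h. c h \<noteq> 0 \<Longrightarrow> e h \<le> 0" "e g = 0"
  shows "tri s (g + \<delta>) (lincomb v Y (\<lambda>h. c h * vp (e h)))"
proof -
  note qs = seed(1)[OF s]
  have fin: "finite {h. c h \<noteq> 0}" and cg: "c g = 1"
    and le: "\<And>h. c h \<noteq> 0 \<Longrightarrow> dom_le s h g" and m: "\<And>h. h \<noteq> g \<Longrightarrow> c h \<in> laurent_m"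
    using c by (auto simp: tri_coeffs_def)
  have "\<forall>h. \<exists>b. c h \<noteq> 0 \<longrightarrow> tri_coeffs s (h + \<delta>) b \<and> Y h = lincomb v (Lb s) b"
    using Y by (auto simp: tri_def)
  then obtain b where b: "\<And>h. c h \<noteq> 0 \<Longrightarrow> tri_coeffs s (h + \<delta>) (b h) \<and> Y h = lincomb v (Lb s) (b h)"
    by metis
  have bfin: "finite {x. b h x \<noteq> 0}" and b1: "b h (h + \<delta>) = 1"
    and ble: "\<And>x. b h x \<noteq> 0 \<Longrightarrow> dom_le s x (h + \<delta>)"
    and bm: "\<And>x. x \<noteq> h + \<delta> \<Longrightarrow> b h x \<in> laurent_m" if "c h \<noteq> 0" for h
    using b[OF that] by (auto simp: tri_coeffs_def)
  define C where "C x = (\<Sum>h | c h \<noteq> 0. c h * vp (e h) * b h x)" for x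
  have Cfin: "finite {x. C x \<noteq> 0}"
    unfolding C_def by (rule finite_supp_sum[OF fin], rule finite_supp_scale, rule bfin) simp
  have Cle: "dom_le s x (g + \<delta>)" if "C x \<noteq> 0" for x
  proof -
    obtain h where "h \<in> {h. c h \<noteq> 0}" "c h * vp (e h) * b h x \<noteq> 0"
      using \<open>C x \<noteq> 0\<close> unfolding C_def by (rule sum.not_neutral_contains_not_neutral)
    then have "dom_le s x (h + \<delta>)" "dom_le s (h + \<delta>) (g + \<delta>)"
      using ble le by auto
    then show ?thesis by (rule dom_le_trans)
  qed
  have C1: "C (g + \<delta>) = 1"
  proof -
    have "c h * vp (e h) * b h (g + \<delta>) = (if h = g then 1 else 0)" if "c h \<noteq> 0" for h
    proof (cases "h = g")
      case False
      have "b h (g + \<delta>) = 0"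
      proof (rule ccontr)
        assume "b h (g + \<delta>) \<noteq> 0"
        then have "dom_le s g h" using ble[OF that] by force
        then show False using False le[OF that] dom_le_antisym[OF qs] by blast
      qed
      then show ?thesis using False by simp
    qed (use cg e(2) b1 in simp)
    then have "C (g + \<delta>) = (\<Sum>h | c h \<noteq> 0. if h = g then 1 else 0)"
      unfolding C_def by (intro sum.cong) auto
    then show ?thesis using fin cg by simp
  qed
  have Cm: "C x \<in> laurent_m" if x: "x \<noteq> g + \<delta>" for x
    unfolding C_def
  proof (rule laurent_m_sum)
    fix h assume "h \<in> {h. c h \<noteq> 0}"
    then have h: "c h \<noteq> 0" by simp
    show "c h * vp (e h) * b h x \<in> laurent_m"
    proof (cases "h = g")
      case True
      then show ?thesis using cg e(2) bm[OF h] x by simp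
    next
      case False
      then have "c h * vp (e h) \<in> laurent_m"
        using m e(1)[OF h] by (intro laurent_m_mult_vp) auto
      then show ?thesis
        using b1[OF h] bm[OF h] laurent_m_mult by (cases "x = h + \<delta>") auto
    qed
  qed
  have "lincomb v (Lb s) C = (\<Sum>h | c h \<noteq> 0. lincomb v (Lb s) (\<lambda>x. (c h * vp (e h)) * b h x))"
    unfolding C_def by (rule lincomb_sum[OF fin], rule finite_supp_scale, rule bfin) simp
  also have "\<dots> = (\<Sum>h | c h \<noteq> 0. scalar v (c h * vp (e h)) * Y h)"
    using b by (intro sum.cong refl) (auto simp: lincomb_scale[OF bfin v_neq_0])
  also have "\<dots> = lincomb v Y (\<lambda>h. c h * vp (e h))"
    by (simp add: lincomb_def)
  finally show ?thesis
    using Cfin Cle C1 Cm unfolding tri_def tri_coeffs_def by (intro exI[of _ C]) simp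
qed

text \<open>With \<open>h - g = p_star s n\<close> the pairing is \<open>- d i * n $ i\<close> for
  unfrozen \<open>i\<close>. This is the sign that makes left multiplication compatible with
  \<open>tri_lincomb\<close>.\<close>

lemma bilin_unit_dom_le:
  assumes s: "s \<in> S" and le: "dom_le s h g"
  shows "bilin (lam s) (unit_vec i) (h - g) \<le> 0" and "i \<notin> U \<Longrightarrow> bilin (lam s) (unit_vec i) (h - g) = 0"
proof -
  note qs = seed(1)[OF s]
  obtain n where n: "n \<in> N_uf_nonneg s" "h - g = p_star s n"
    using le by (auto simp: dom_le_def)
  have eq: "bilin (lam s) (unit_vec i) (h - g) = - (if i \<in> U then d i * n $ i else 0)"
    unfolding n(2) quantum_seed_skew[OF qs, of "unit_vec i"] bilin_p_star_unit[OF qs seed(2)[OF s]]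
      seed(3)[OF s] ..
  have "i \<in> U \<Longrightarrow> 0 \<le> d i * n $ i"
    using d0 n(1) by (force simp: compatible_with_def N_uf_nonneg_def intro: mult_nonneg_nonneg less_imp_le)
  then show "bilin (lam s) (unit_vec i) (h - g) \<le> 0" "i \<notin> U \<Longrightarrow> bilin (lam s) (unit_vec i) (h - g) = 0"
    using eq by auto
qed

lemma tri_left_Lb:
  assumes s: "s \<in> S"
  shows "tri s (g + unit_vec i) (v powi (- bilin (lam s) (unit_vec i) g) * (cluster_var s i * Lb s g))"
proof -
  note qs = seed(1)[OF s]
  obtain Lg where Lg: "L = range Lg" "\<forall>g. pointed s g (Lg g)"
    "\<forall>g i. \<exists>b :: int ^ 'i \<Rightarrow>\<^sub>0 laurent.
           (\<forall>g'\<in>Poly_Mapping.keys b. dom_le s g' (g + unit_vec i)) \<and>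
           Poly_Mapping.lookup b (g + unit_vec i) = 1 \<and>
           (\<forall>g'. dom_less s g' (g + unit_vec i) \<longrightarrow> Poly_Mapping.lookup b g' \<in> laurent_m) \<and>
           deg_normalize s (cluster_var s i * Lg g) =
             (\<Sum>g'\<in>Poly_Mapping.keys b. scale (vpar s) (Poly_Mapping.lookup b g') (Lg g'))"
    using basis_pointed[OF s] by blast
  \<comment> \<open>The parametrization supplied by triangularity is existential; since degrees
    determine basis elements, it must be \<open>Lb s\<close>.\<close>
  have "Lg h = Lb s h" for h
    using Lb_eqI[OF s, of "Lg h" h] Lg(1,2) by auto
  then have Lg_eq: "Lg = Lb s" by (rule ext)
  obtain b where b: "\<forall>g'\<in>Poly_Mapping.keys b. dom_le s g' (g + unit_vec i)"
    "Poly_Mapping.lookup b (g + unit_vec i) = 1"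
    "\<forall>g'. dom_less s g' (g + unit_vec i) \<longrightarrow> Poly_Mapping.lookup b g' \<in> laurent_m"
    "deg_normalize s (cluster_var s i * Lb s g) =
       (\<Sum>g'\<in>Poly_Mapping.keys b. scale (vpar s) (Poly_Mapping.lookup b g') (Lb s g'))"
    using Lg(3)[unfolded Lg_eq, THEN spec, THEN spec, of g i] by blast
  have "leading s (unit_vec i + g) (vp (bilin (lam s) (unit_vec i) g) * (1 * 1)) (cluster_var s i * Lb s g)"
    unfolding cluster_var_def by (rule leading_mult[OF qs leading_frame[OF qs] leading_Lb[OF s]])
  then have lead: "leading s (g + unit_vec i) (vp (bilin (lam s) (unit_vec i) g)) (cluster_var s i * Lb s g)"
    by (simp add: add.commute)
  then have "deg s (cluster_var s i * Lb s g) = g + unit_vec i"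
    by (intro deg_eqI[OF qs]) (simp add: has_degree_iff[OF qs] leading_def)
  then have "v powi (- bilin (lam s) (unit_vec i) g) * (cluster_var s i * Lb s g) =
      deg_normalize s (cluster_var s i * Lb s g)"
    using lead seed(4)[OF s] by (simp add: deg_normalize_def leading_def power_int_minus)
  also have "\<dots> = lincomb v (Lb s) (Poly_Mapping.lookup b)"
    unfolding b(4) by (simp add: lincomb_def scale_def seed(4)[OF s] Poly_Mapping.keys.rep_eq)
  moreover have "tri_coeffs s (g + unit_vec i) (Poly_Mapping.lookup b)"
    unfolding tri_coeffs_def
  proof (intro conjI allI impI)
    show "Poly_Mapping.lookup b h \<in> laurent_m" if "h \<noteq> g + unit_vec i" for h
    proof (cases "h \<in> Poly_Mapping.keys b")
      case True
      then show ?thesis using b(1,3) that by (auto simp: dom_less_def)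
    qed (simp add: in_keys_iff)
  qed (use b in \<open>auto simp: in_keys_iff finite_lookup\<close>)
  ultimately show ?thesis unfolding tri_def by metis
qed

lemma tri_left:
  assumes s: "s \<in> S" and W: "tri s g W"
  shows "tri s (g + unit_vec i) (v powi (- bilin (lam s) (unit_vec i) g) * (cluster_var s i * W))"
proof -
  obtain c where c: "tri_coeffs s g c" "W = lincomb v (Lb s) c"
    using W by (auto simp: tri_def)
  define Y where "Y h = v powi (- bilin (lam s) (unit_vec i) h) * (cluster_var s i * Lb s h)" for h
  define e where "e h = bilin (lam s) (unit_vec i) (h - g)" for h
  have "tri s (g + unit_vec i) (lincomb v Y (\<lambda>h. c h * vp (e h)))"
  proof (rule tri_lincomb[OF s c(1)])
    show "e h \<le> 0" if "c h \<noteq> 0" for h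
      unfolding e_def using bilin_unit_dom_le(1)[OF s] c(1) that by (simp add: tri_coeffs_def)
  qed (simp_all add: Y_def e_def tri_left_Lb[OF s])
  also have "lincomb v Y (\<lambda>h. c h * vp (e h)) =
      v powi (- bilin (lam s) (unit_vec i) g) * (cluster_var s i * W)"
    unfolding lincomb_def c(2) Y_def e_def sum_distrib_left
    by (intro sum.cong) (simp_all add: scalar_mult[OF v_neq_0] mult.assoc v_add_left bilin_diff_right
        scalar_commute_left[of "cluster_var s i"] scalar_commute_left[where x = "v powi a" for a])
  finally show ?thesis .
qed

text \<open>A frozen variable \<open>v\<close>-commutes with basis elements, so the product is bar-invariant after
  normalization and the coefficients in \<open>\<m>\<close> vanish.\<close>

lemma frozen_mult_Lb:
  assumes s: "s \<in> S" and j: "j \<notin> U"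
  shows "cluster_var s j * Lb s g = v powi bilin (lam s) (unit_vec j) g * Lb s (g + unit_vec j)"
proof -
  note qs = seed(1)[OF s]
  let ?h = "g + unit_vec j" and ?a = "bilin (lam s) (unit_vec j) g"
  define W where "W = v powi (- ?a) * (cluster_var s j * Lb s g)"
  have barL: "laurent_bar (lp_coeff s Z m) = lp_coeff s Z m" if "Z \<in> L" for Z m
    using triangular[OF s] that
    by (intro bar_invariant_coeff[OF qs]) (simp add: triangular_basis_def degree_triangular_def)
  have LPL: "Lb s g \<in> LP s" for g
    using leading_Lb[OF s] by (simp add: leading_def below_def)
  have coeffW: "lp_coeff s W m = lp_coeff s (Lb s g) (m - unit_vec j)" for m
  proof (cases "lp_coeff s (Lb s g) (m - unit_vec j) = 0")
    case True
    then show ?thesis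
      unfolding W_def seed(4)[OF s, symmetric] cluster_var_def
      by (simp add: lp_coeff_powi_scale[OF qs] LP_mult[OF quantum_seed_torus[OF qs]] LPL
          lp_coeff_frame_mult[OF qs LPL])
  next
    case False
    then have "dom_le s (m - unit_vec j) g"
      using leading_Lb[OF s, of g] by (auto simp: leading_def below_def)
    then have "bilin (lam s) (unit_vec j) (m - unit_vec j) = ?a"
      using bilin_unit_dom_le(2)[OF s _ j, of "m - unit_vec j" g]
      by (simp add: bilin_diff_right)
    then show ?thesis
      unfolding W_def seed(4)[OF s, symmetric] cluster_var_def
      by (simp add: lp_coeff_powi_scale[OF qs] LP_mult[OF quantum_seed_torus[OF qs]] LPL
          lp_coeff_frame_mult[OF qs LPL] vp_inv)
  qed
  obtain c where c: "tri_coeffs s ?h c" "W = lincomb v (Lb s) c"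
    using tri_left_Lb[OF s, of g j] by (auto simp: tri_def W_def)
  define c' where "c' x = (if x = ?h then 0 else c x)" for x
  have fin: "finite {x. c' x \<noteq> 0}"
    by (rule finite_subset[of _ "{x. c x \<noteq> 0}"]) (use c(1) in \<open>auto simp: tri_coeffs_def c'_def\<close>)
  have c_eq: "c = (\<lambda>x. c' x + (if x = ?h then 1 else 0))"
    using c(1) by (auto simp: c'_def tri_coeffs_def)
  have W: "W = lincomb v (Lb s) c' + Lb s ?h"
    unfolding c(2) by (subst c_eq, subst lincomb_add[OF fin]) (simp_all add: lincomb_single)
  have LPc': "lincomb v (Lb s) c' \<in> LP s"
    unfolding lincomb_def seed(4)[OF s, symmetric]
    by (intro LP_sum LP_scale LPL) (use v_neq_0 seed(4)[OF s] in simp)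
  have barc': "laurent_bar (lp_coeff s (lincomb v (Lb s) c') m) = lp_coeff s (lincomb v (Lb s) c') m" for m
  proof -
    have "lp_coeff s (lincomb v (Lb s) c') m = lp_coeff s W m - lp_coeff s (Lb s ?h) m"
      unfolding W by (simp add: lp_coeff_add[OF qs LPc' LPL])
    then show ?thesis
      by (simp add: coeffW laurent_bar_diff barL Lb(1)[OF s])
  qed
  have "c' x = 0" for x
  proof (rule ccontr)
    assume x: "c' x \<noteq> 0"
    obtain y where y: "c' y \<noteq> 0" "\<And>z. c' z \<noteq> 0 \<Longrightarrow> dom_le s y z \<Longrightarrow> z = y"
      using leading_lincomb_exists_maximal[where \<delta> = "\<lambda>g. g", OF qs fin x] by blast
    \<comment> \<open>At a maximal degree the coefficient in the basis is also a Laurent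
      coefficient, to which bar-invariance applies.\<close>
    have "lp_coeff s (lincomb (vpar s) (Lb s) c') y = c' y * 1"
      by (rule leading_lincomb_maximal[where \<delta> = "\<lambda>g. g", OF qs fin leading_Lb[OF s] _ y(1)])
        (simp, rule y(2))
    then have "laurent_bar (c' y) = c' y"
      using barc'[of y] seed(4)[OF s] by simp
    moreover have "c' y \<in> laurent_m"
      using c(1) y(1) by (auto simp: c'_def tri_coeffs_def)
    ultimately show False using laurent_bar_m_eq_0 y(1) by blast
  qed
  then have "lincomb v (Lb s) c' = 0"
    by (simp add: lincomb_def)
  then have W_eq: "W = Lb s ?h" using W by simp
  have "v powi ?a * W = cluster_var s j * Lb s g" by (simp add: W_def v_add_left)
  then show ?thesis unfolding W_eq by (rule sym)
qed

section \<open>Products of monomials of two seeds\<close>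

lemma cluster_var_neq_0: "s \<in> S \<Longrightarrow> cluster_var s i \<noteq> 0"
  unfolding cluster_var_def by (rule frame_nonzero[OF seed(1)])

text \<open>Multiplication by a frozen variable permutes \<open>L\<close> up to powers of
  \<open>v\<close>, hence so does its inverse; the power is the same for all degrees below
  \<open>g\<close>.\<close>

lemma tri_left_frozen_inverse:
  assumes s: "s \<in> S" and j: "j \<notin> U" and W: "tri s g W"
  shows "tri s (g - unit_vec j) (v powi bilin (lam s) (unit_vec j) g * (inverse (cluster_var s j) * W))"
proof -
  note qs = seed(1)[OF s]
  obtain c where c: "tri_coeffs s g c" "W = lincomb v (Lb s) c"
    using W by (auto simp: tri_def)
  have inv: "inverse (cluster_var s j) * Lb s h = v powi (- bilin (lam s) (unit_vec j) h) * Lb s (h - unit_vec j)" for h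
  proof -
    have "Lb s h = v powi (- bilin (lam s) (unit_vec j) h) * (cluster_var s j * Lb s (h - unit_vec j))"
      using frozen_mult_Lb[OF s j, of "h - unit_vec j"]
      by (simp add: v_add_left bilin_diff_right bilin_self[OF qs])
    then have "inverse (cluster_var s j) * Lb s h = v powi (- bilin (lam s) (unit_vec j) h) *
        (inverse (cluster_var s j) * (cluster_var s j * Lb s (h - unit_vec j)))"
      by (metis v_commute_left)
    then show ?thesis
      using cluster_var_neq_0[OF s] by (simp add: mult.assoc[symmetric])
  qed
  have "tri s (g + - unit_vec j) (lincomb v (\<lambda>h. Lb s (h - unit_vec j)) (\<lambda>h. c h * vp 0))"
    by (rule tri_lincomb[OF s c(1)]) (use tri_Lb in auto)
  also have "lincomb v (\<lambda>h. Lb s (h - unit_vec j)) (\<lambda>h. c h * vp 0) =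
      v powi bilin (lam s) (unit_vec j) g * (inverse (cluster_var s j) * W)"
    unfolding lincomb_def c(2) sum_distrib_left
  proof (intro sum.cong)
    fix h assume "h \<in> {h. c h \<noteq> 0}"
    then have "dom_le s h g" using c(1) by (simp add: tri_coeffs_def)
    then have "bilin (lam s) (unit_vec j) h = bilin (lam s) (unit_vec j) g"
      using bilin_unit_dom_le(2)[OF s _ j, of h g] by (simp add: bilin_diff_right)
    then show "scalar v (c h * vp 0) * Lb s (h - unit_vec j) = v powi bilin (lam s) (unit_vec j) g *
        (inverse (cluster_var s j) * (scalar v (c h) * Lb s h))"
      by (simp add: scalar_commute_left[of "inverse (cluster_var s j)"]
          scalar_commute_left[where x = "v powi a" for a] inv v_add_left)
  qed simp
  finally show ?thesis by simp
qed

text \<open>For \<open>a = 0\<close> the product is a cluster monomial of \<open>t\<close>, hence a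
  basis element. A change of \<open>a\<close> by one unit is a left multiplication by a variable of
  \<open>s\<close> or by the inverse of a frozen one.\<close>

lemma tri_frame:
  assumes st: "s \<in> S" "t \<in> S" and u: "\<And>i. u $ i \<ge> 0" and a: "\<And>i. i \<in> U \<Longrightarrow> a $ i \<ge> 0"
  shows "tri s (a + psi s t u) (v powi (- bilin (lam s) a (psi s t u)) * (frame s a * frame t u))"
proof -
  note qs = seed(1)[OF st(1)]
  note fm = torus_frame_mult[OF quantum_seed_torus[OF qs], unfolded seed(4)[OF st(1)]]
  have "\<forall>i. i \<notin> - U \<longrightarrow> a $ i \<ge> 0" using a by simp
  then show ?thesis
  proof (induction a rule: int_vec_induct)
    case zero
    have "Lb s (psi s t u) = frame t u"
      using leading_psi[OF st u] frame_mem_L[OF st(2) u]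
      by (intro Lb_eqI[OF st(1)]) (auto simp: pointed_iff_leading[OF qs])
    then show ?case
      using tri_Lb[of s "psi s t u"] qs by (simp add: quantum_seed_def)
  next
    case (add a i)
    have "frame s (a + unit_vec i) = v powi (- bilin (lam s) (unit_vec i) a) * (cluster_var s i * frame s a)"
      by (simp add: cluster_var_def fm v_add_left add.commute)
    then have "v powi (- bilin (lam s) (a + unit_vec i) (psi s t u)) * (frame s (a + unit_vec i) * frame t u) =
        v powi (- bilin (lam s) (a + unit_vec i) (psi s t u) - bilin (lam s) (unit_vec i) a) *
          (cluster_var s i * (frame s a * frame t u))"
      by (simp add: v_add_left mult.assoc)
    also have "- bilin (lam s) (a + unit_vec i) (psi s t u) - bilin (lam s) (unit_vec i) a =
        - bilin (lam s) (unit_vec i) (a + psi s t u) - bilin (lam s) a (psi s t u)"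
      by (simp add: bilin_add_left bilin_add_right)
    also have "v powi \<dots> * (cluster_var s i * (frame s a * frame t u)) =
        v powi (- bilin (lam s) (unit_vec i) (a + psi s t u)) * (cluster_var s i *
          (v powi (- bilin (lam s) a (psi s t u)) * (frame s a * frame t u)))"
      by (simp add: v_commute_left[of "cluster_var s i"] v_add_left)
    finally show ?case
      using tri_left[OF st(1) add, of i] by (simp add: add_ac)
  next
    case (diff a i)
    have "v powi bilin (lam s) (unit_vec i) a * frame s a = cluster_var s i * frame s (a - unit_vec i)"
      by (simp add: cluster_var_def fm bilin_diff_right bilin_self[OF qs])
    then have "inverse (cluster_var s i) * (v powi bilin (lam s) (unit_vec i) a * frame s a) = frame s (a - unit_vec i)"
      using cluster_var_neq_0[OF st(1), of i] by (simp add: mult.assoc[symmetric])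
    then have "frame s (a - unit_vec i) = v powi bilin (lam s) (unit_vec i) a * (inverse (cluster_var s i) * frame s a)"
      by (simp add: v_commute_left[of "inverse (cluster_var s i)"])
    then have "v powi (- bilin (lam s) (a - unit_vec i) (psi s t u)) * (frame s (a - unit_vec i) * frame t u) =
        v powi (- bilin (lam s) (a - unit_vec i) (psi s t u) + bilin (lam s) (unit_vec i) a) *
          (inverse (cluster_var s i) * (frame s a * frame t u))"
      by (simp add: v_add_left mult.assoc)
    also have "- bilin (lam s) (a - unit_vec i) (psi s t u) + bilin (lam s) (unit_vec i) a =
        bilin (lam s) (unit_vec i) (a + psi s t u) - bilin (lam s) a (psi s t u)"
      by (simp add: bilin_diff_left bilin_add_right)
    also have "v powi \<dots> * (inverse (cluster_var s i) * (frame s a * frame t u)) =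
        v powi bilin (lam s) (unit_vec i) (a + psi s t u) * (inverse (cluster_var s i) *
          (v powi (- bilin (lam s) a (psi s t u)) * (frame s a * frame t u)))"
      by (simp add: v_commute_left[of "inverse (cluster_var s i)"] v_add_left)
    finally show ?case
      using tri_left_frozen_inverse[OF st(1) _ diff(2), of i] diff(1) by (simp add: algebra_simps)
  qed
qed

lemma exists_standard_monomial:
  assumes p: "shift_pair s t \<sigma>"
  obtains a u where "\<And>i. u $ i \<ge> 0" "\<And>i. i \<in> U \<Longrightarrow> a $ i \<ge> 0" "g = a + psi s t u"
proof -
  have \<sigma>: "\<sigma> permutes U" using p by (simp add: shift_pair_def)
  \<comment> \<open>On unfrozen coordinates \<open>psi\<close> contributes negatively, so
    \<open>u\<close> absorbs the negative part of \<open>g\<close> and the positive part is left to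
    \<open>a\<close>, whose frozen coordinates are unrestricted.\<close>
  define u where "u = (\<chi> i. pos_part (- g $ inv \<sigma> i))"
  have "(g - psi s t u) $ i \<ge> 0" if "i \<in> U" for i
    using psi_nth_unfrozen[OF p that, of u] permutes_inverses(2)[OF \<sigma>]
    by (simp add: u_def pos_part_def)
  then show ?thesis
    by (intro that[of u "g - psi s t u"]) (auto simp: u_def)
qed

text \<open>The expansion of \<open>Lb s g\<close> by products \<open>frame s a * frame t u\<close> is unitriangular. Multiplying these
  from the right by \<open>X\<^sub>i(t)\<close> yields products of the same kind, and inverting the expansion only involves
  the coefficients at finitely many degrees between the given one and \<open>g\<close>.\<close>

lemma tri_right:
  assumes p: "shift_pair s t \<sigma>"
  shows "tri s (g + degv s t i) (v powi (- bilin (lam s) g (degv s t i)) * (Lb s g * cluster_var t i))"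
proof -
  have st: "s \<in> S" "t \<in> S"
    using p by (auto simp: shift_pair_def)
  note qs = seed(1)[OF st(1)] and qt = seed(1)[OF st(2)]
  define \<delta> where "\<delta> = degv s t i"
  define X where "X = cluster_var t i"
  define Y where "Y g = v powi (- bilin (lam s) g \<delta>) * (Lb s g * X)" for g
  \<comment> \<open>The unfrozen coordinates of \<open>\<delta>\<close> are 0 or -1, which gives
    right multiplication by \<open>X\<close> the same favourable sign as left multiplication by
    variables of \<open>s\<close>.\<close>
  have \<delta>: "bilin (lam s) (h - g) \<delta> \<le> 0" if "dom_le s h g" for h g
  proof -
    obtain n where n: "n \<in> N_uf_nonneg s" "h - g = p_star s n"
      using \<open>dom_le s h g\<close> by (auto simp: dom_le_def)
    have "d k * n $ k * \<delta> $ k \<le> 0" if k: "k \<in> U" for k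
    proof -
      have "\<delta> $ k \<le> 0"
        using psi_nth_unfrozen[OF p k, of "unit_vec i"] by (simp add: \<delta>_def)
      moreover have "d k * n $ k \<ge> 0"
        using d0 n(1) k by (force simp: compatible_with_def N_uf_nonneg_def intro: mult_nonneg_nonneg less_imp_le)
      ultimately show ?thesis by (simp add: mult_nonneg_nonpos)
    qed
    then show ?thesis
      unfolding n(2) bilin_p_star[OF qs seed(2)[OF st(1)]] seed(3)[OF st(1)] by (rule sum_nonpos)
  qed
  have XL: "X \<in> L" unfolding X_def by (rule cluster_var_mem_L[OF st(2)])
  have YA: "Y g \<in> A" for g
    unfolding Y_def using L_subset_A Lb(1)[OF st(1)] XL by (intro A_scale A_mult) auto
  have "\<forall>g. \<exists>c. finite {x. c x \<noteq> 0} \<and> Y g = lincomb v (Lb s) c"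
    using A_expand[OF st(1) YA] by metis
  then obtain C where Cfin: "\<And>g. finite {x. C g x \<noteq> 0}" and CY: "\<And>g. Y g = lincomb v (Lb s) (C g)"
    by metis
  have leadY: "leading s (g + \<delta>) 1 (Y g)" for g
  proof -
    have "leading s \<delta> 1 X"
      using pointed_degv[OF st, of i] by (simp add: \<delta>_def X_def pointed_iff_leading[OF qs])
    from leading_powi_scale[OF qs leading_mult[OF qs leading_Lb[OF st(1), of g] this], of "- bilin (lam s) g \<delta>"]
    show ?thesis by (simp add: Y_def seed(4)[OF st(1)] vp_add)
  qed
  have Cle: "C g x \<noteq> 0 \<Longrightarrow> dom_le s x (g + \<delta>)" and C1: "C g (g + \<delta>) = 1" for g x
    using lincomb_Lb_below[OF st(1) Cfin, of "g + \<delta>" g] leadY[of g] unfolding CY leading_def by auto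
  \<comment> \<open>\<open>b\<close> expands a product \<open>W\<close> of degree \<open>g\<close>
    of the two monomials, and \<open>e\<close> expands the normalized \<open>W * X\<close>, again
    such a product. Since \<open>b g = 1\<close>, comparing the two expansions isolates
    \<open>C g\<close>.\<close>
  have rec: "\<exists>b e. tri_coeffs s g b \<and> tri_coeffs s (g + \<delta>) e \<and>
      (\<forall>x. C g x = e x - (\<Sum>h\<in>{h. b h \<noteq> 0} - {g}. b h * vp (bilin (lam s) (h - g) \<delta>) * C h x))" for g
  proof -
    obtain a u where u: "\<And>i. u $ i \<ge> 0" and a: "\<And>i. i \<in> U \<Longrightarrow> a $ i \<ge> 0" and g: "g = a + psi s t u"
      using exists_standard_monomial[OF p, of g] by blast
    define W where "W = v powi (- bilin (lam s) a (psi s t u)) * (frame s a * frame t u)"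
    obtain b where b: "tri_coeffs s g b" "W = lincomb v (Lb s) b"
      using tri_frame[OF st u a] unfolding g W_def tri_def by blast
    have "v powi (- bilin (lam s) a (psi s t (u + unit_vec i))) * (frame s a * frame t (u + unit_vec i)) =
        v powi (- bilin (lam s) g \<delta>) * (W * X)"
    proof -
      have "frame t (u + unit_vec i) = v powi (- bilin (lam s) (psi s t u) \<delta>) * (frame t u * X)"
        using bilin_psi[OF st, of u "unit_vec i"]
          torus_frame_mult[OF quantum_seed_torus[OF qt], of u "unit_vec i", unfolded seed(4)[OF st(2)]]
        by (simp add: X_def cluster_var_def \<delta>_def v_add_left)
      then have "v powi (- bilin (lam s) a (psi s t (u + unit_vec i))) * (frame s a * frame t (u + unit_vec i)) =
          v powi (- bilin (lam s) a (psi s t (u + unit_vec i)) - bilin (lam s) (psi s t u) \<delta>) *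
            (frame s a * (frame t u * X))"
        by (simp add: v_commute_left[of "frame s a"] v_add_left)
      also have "- bilin (lam s) a (psi s t (u + unit_vec i)) - bilin (lam s) (psi s t u) \<delta> =
          - bilin (lam s) g \<delta> - bilin (lam s) a (psi s t u)"
        by (simp add: g psi_add \<delta>_def bilin_add_left bilin_add_right)
      also have "v powi \<dots> * (frame s a * (frame t u * X)) = v powi (- bilin (lam s) g \<delta>) * (W * X)"
        by (simp add: W_def v_add_left mult.assoc)
      finally show ?thesis .
    qed
    moreover have "tri s (a + psi s t (u + unit_vec i)) (v powi (- bilin (lam s) a (psi s t (u + unit_vec i))) *
        (frame s a * frame t (u + unit_vec i)))"
      using u a by (intro tri_frame[OF st]) simp_all
    moreover have "a + psi s t (u + unit_vec i) = g + \<delta>"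
      by (simp add: g psi_add \<delta>_def add.assoc)
    ultimately obtain e where e: "tri_coeffs s (g + \<delta>) e" "v powi (- bilin (lam s) g \<delta>) * (W * X) = lincomb v (Lb s) e"
      by (auto simp: tri_def)
    have bfin: "finite {h. b h \<noteq> 0}" and efin: "finite {h. e h \<noteq> 0}" and bg: "b g = 1"
      using b(1) e(1) by (auto simp: tri_coeffs_def)
    define D where "D x = (\<Sum>h | b h \<noteq> 0. b h * vp (bilin (lam s) (h - g) \<delta>) * C h x)" for x
    have "v powi (- bilin (lam s) g \<delta>) * (W * X) = (\<Sum>h | b h \<noteq> 0. scalar v (b h * vp (bilin (lam s) (h - g) \<delta>)) * Y h)"
      unfolding b(2) lincomb_def sum_distrib_right sum_distrib_left
    proof (intro sum.cong refl)
      fix h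
      have "scalar v (b h * vp (bilin (lam s) (h - g) \<delta>)) * Y h =
          scalar v (b h) * (v powi (bilin (lam s) (h - g) \<delta> - bilin (lam s) h \<delta>) * (Lb s h * X))"
        by (simp add: scalar_mult[OF v_neq_0] mult.assoc Y_def v_add_left)
      also have "\<dots> = v powi (- bilin (lam s) g \<delta>) * (scalar v (b h) * Lb s h * X)"
        by (simp add: bilin_diff_left scalar_commute_left[where x = "v powi a" for a] mult.assoc)
      finally show "v powi (- bilin (lam s) g \<delta>) * (scalar v (b h) * Lb s h * X) =
          scalar v (b h * vp (bilin (lam s) (h - g) \<delta>)) * Y h" ..
    qed
    also have "\<dots> = (\<Sum>h | b h \<noteq> 0. lincomb v (Lb s) (\<lambda>x. (b h * vp (bilin (lam s) (h - g) \<delta>)) * C h x))"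
      by (simp only: CY lincomb_scale[OF Cfin v_neq_0])
    also have "\<dots> = lincomb v (Lb s) D"
      unfolding D_def by (rule lincomb_sum[OF bfin, symmetric]) (rule finite_supp_scale[OF Cfin])
    finally have "lincomb v (Lb s) e = lincomb v (Lb s) D" using e(2) by simp
    moreover have "finite {x. D x \<noteq> 0}"
      unfolding D_def by (rule finite_supp_sum[OF bfin]) (rule finite_supp_scale[OF Cfin])
    ultimately have "e = D" using lincomb_Lb_unique[OF st(1) efin] by blast
    moreover have "D x = C g x + (\<Sum>h\<in>{h. b h \<noteq> 0} - {g}. b h * vp (bilin (lam s) (h - g) \<delta>) * C h x)" for x
      unfolding D_def using bfin bg by (subst sum.remove[of _ g]) auto
    ultimately show ?thesis
      using b(1) e(1) by (intro exI[of _ b] exI[of _ e]) simp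
  qed
  have Cm: "C g (g + \<delta> + p_star s n) \<in> laurent_m"
    if "n \<in> N_uf_nonneg s" "n \<noteq> 0" for g n
    using that
  \<comment> \<open>The size of \<open>n\<close> measures how far the given degree lies below the
    top. Passing from \<open>g\<close> to a smaller \<open>h\<close> uses up a nonzero part
    \<open>n1\<close>, and only the rest \<open>n2\<close> remains below
    \<open>h + \<delta>\<close>.\<close>
  proof (induction "nat (\<Sum>k\<in>UNIV. n $ k)" arbitrary: g n rule: less_induct)
    case less
    let ?x = "g + \<delta> + p_star s n"
    obtain b e where b: "tri_coeffs s g b" and e: "tri_coeffs s (g + \<delta>) e"
      and C: "C g ?x = e ?x - (\<Sum>h\<in>{h. b h \<noteq> 0} - {g}. b h * vp (bilin (lam s) (h - g) \<delta>) * C h ?x)"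
      using rec[of g] by blast
    have n_nonzero: "p_star s m \<noteq> 0" if "m \<in> N_uf_nonneg s" "m \<noteq> 0" for m
    proof
      assume "p_star s m = 0"
      then have "m $ k = 0" if "k \<in> unfrozen s" for k
        using p_star_eqD[OF qs, of m 0 k] that by simp
      then have "m = 0"
        using \<open>m \<in> N_uf_nonneg s\<close> by (auto simp: N_uf_nonneg_def vec_eq_iff)
      then show False using \<open>m \<noteq> 0\<close> by simp
    qed
    have "e ?x \<in> laurent_m"
      using e n_nonzero[OF less.prems] by (simp add: tri_coeffs_def)
    moreover have "(\<Sum>h\<in>{h. b h \<noteq> 0} - {g}. b h * vp (bilin (lam s) (h - g) \<delta>) * C h ?x) \<in> laurent_m"
    proof (rule laurent_m_sum)
      fix h assume "h \<in> {h. b h \<noteq> 0} - {g}"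
      then have h: "b h \<noteq> 0" "h \<noteq> g" by auto
      then have hg: "dom_le s h g" and bm: "b h \<in> laurent_m"
        using b by (auto simp: tri_coeffs_def)
      have m: "b h * vp (bilin (lam s) (h - g) \<delta>) \<in> laurent_m"
        by (rule laurent_m_mult_vp[OF bm \<delta>[OF hg]])
      show "b h * vp (bilin (lam s) (h - g) \<delta>) * C h ?x \<in> laurent_m"
      proof (cases "C h ?x = 0")
        case False
        obtain n1 where n1: "n1 \<in> N_uf_nonneg s" "h = g + p_star s n1"
          using hg by (auto simp: dom_le_def)
        obtain n2 where n2: "n2 \<in> N_uf_nonneg s" "?x = h + \<delta> + p_star s n2"
          using Cle[OF False] by (auto simp: dom_le_def)
        have "p_star s n = p_star s (n1 + n2)"
          using n1(2) n2(2) by (simp add: p_star_add add_ac)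
        then have "n $ k = n1 $ k + n2 $ k" for k
          using p_star_eqD[OF qs, of n "n1 + n2" k] less.prems(1) n1(1) n2(1)
          by (cases "k \<in> unfrozen s") (auto simp: N_uf_nonneg_def)
        then have sum: "(\<Sum>k\<in>UNIV. n $ k) = (\<Sum>k\<in>UNIV. n1 $ k) + (\<Sum>k\<in>UNIV. n2 $ k)"
          by (simp add: sum.distrib)
        have "n1 \<noteq> 0" using h(2) n1(2) by auto
        then obtain k where "n1 $ k \<noteq> 0" by (auto simp: vec_eq_iff)
        then have "(\<Sum>k\<in>UNIV. n1 $ k) > 0"
          using n1(1) by (intro sum_pos2[of _ k]) (auto simp: N_uf_nonneg_def order_less_le)
        moreover have "(\<Sum>k\<in>UNIV. n2 $ k) \<ge> 0"
          using n2(1) by (intro sum_nonneg) (auto simp: N_uf_nonneg_def)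
        ultimately have smaller: "nat (\<Sum>k\<in>UNIV. n2 $ k) < nat (\<Sum>k\<in>UNIV. n $ k)"
          using sum by linarith
        show ?thesis
        \<comment> \<open>The factor coming from \<open>b\<close> is already in
          \<open>laurent_m\<close>; it remains to multiply by 1 at the top degree or by a
          coefficient covered by the induction.\<close>
        proof (cases "n2 = 0")
          case True
          then have "?x = h + \<delta>" using n2(2) by simp
          then show ?thesis using C1[of h] m by (simp only: mult_1_right)
        next
          case n2_nonzero: False
          have "C h ?x \<in> laurent_m"
            unfolding n2(2) by (rule less.hyps[OF smaller n2(1) n2_nonzero])
          then show ?thesis using m by (rule laurent_m_mult[rotated])
        qed
      qed simp
    qed
    ultimately show ?case unfolding C by (rule laurent_m_diff)
  qed
  have "C g x \<in> laurent_m" if "x \<noteq> g + \<delta>" for x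
  proof (cases "C g x = 0")
    case False
    then obtain n where n: "n \<in> N_uf_nonneg s" "x = g + \<delta> + p_star s n"
      using Cle by (auto simp: dom_le_def)
    then have "n \<noteq> 0" using that by auto
    then show ?thesis using Cm n by simp
  qed simp
  then have "tri s (g + \<delta>) (Y g)"
    unfolding tri_def tri_coeffs_def CY[of g] using Cfin Cle C1 by (intro exI[of _ "C g"]) simp
  then show ?thesis by (simp add: Y_def \<delta>_def X_def)
qed


section \<open>Double triangularity\<close>

lemma codegree_triangular_shift_pair:
  assumes p: "shift_pair s t \<sigma>"
  shows "codegree_triangular t A L"
proof -
  have st: "s \<in> S" "t \<in> S"
    using p by (auto simp: shift_pair_def)
  note qs = seed(1)[OF st(1)] and qt = seed(1)[OF st(2)]
  note bij = bij_psi[OF p]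
  define Le where "Le = Lb s \<circ> psi s t"
  have LeL: "Le \<eta> \<in> L" for \<eta>
    by (simp add: Le_def Lb(1)[OF st(1)])
  have range: "L = range Le"
    unfolding Le_def image_comp[symmetric] bij_is_surj[OF bij] range_Lb[OF st(1)] ..
  have cop: "copointed t \<eta> (Le \<eta>)" for \<eta>
    using shift_pair_copointed[OF p LeL] Lb(2)[OF st(1)] by (simp add: Le_def)
  have mult: "\<exists>c :: int ^ 'i \<Rightarrow>\<^sub>0 laurent.
           (\<forall>\<eta>'\<in>Poly_Mapping.keys c. dom_le t (\<eta> + unit_vec i) \<eta>') \<and>
           Poly_Mapping.lookup c (\<eta> + unit_vec i) = 1 \<and>
           (\<forall>\<eta>'. dom_less t (\<eta> + unit_vec i) \<eta>' \<longrightarrow> Poly_Mapping.lookup c \<eta>' \<in> laurent_m) \<and>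
           codeg_normalize t (Le \<eta> * cluster_var t i) =
             (\<Sum>\<eta>'\<in>Poly_Mapping.keys c. scale (vpar t) (Poly_Mapping.lookup c \<eta>') (Le \<eta>'))" for \<eta> i
  proof -
    let ?a = "bilin (lam s) (psi s t \<eta>) (degv s t i)"
    let ?Z = "Le \<eta> * cluster_var t i"
    obtain c where c: "tri_coeffs s (psi s t (\<eta> + unit_vec i)) c" "v powi (- ?a) * ?Z = lincomb v (Lb s) c"
      using tri_right[OF p, of "psi s t \<eta>" i] by (auto simp: tri_def psi_add Le_def)
    have fin: "finite {x. (c \<circ> psi s t) x \<noteq> 0}"
      using finite_vimageI[OF _ bij_is_inj[OF bij], of "{x. c x \<noteq> 0}"] c(1)
      by (simp add: tri_coeffs_def vimage_def)
    note look = lookup_Abs[OF fin]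
    have "pointed s (degv s t i) (cluster_var t i)" by (rule pointed_degv[OF st])
    then have "leading s (psi s t (\<eta> + unit_vec i)) (vp ?a) ?Z"
      using leading_mult[OF qs leading_Lb[OF st(1)], of "degv s t i" 1 "cluster_var t i" "psi s t \<eta>"]
      by (simp add: pointed_iff_leading[OF qs] Le_def psi_add)
    moreover have "?Z \<in> LP t"
    proof (rule LP_mult[OF quantum_seed_torus[OF qt]])
      show "Le \<eta> \<in> LP t" using cop[of \<eta>] by (simp add: copointed_def has_codegree_def)
    qed (simp add: cluster_var_def)
    \<comment> \<open>The codegree coefficient in \<open>t\<close> equals the leading coefficient in
      \<open>s\<close>, so normalizing by codegree in \<open>t\<close> is the normalization already
      present in \<open>tri_right\<close>.\<close>
    ultimately have cd: "has_codegree t (\<eta> + unit_vec i) ?Z \<and> lp_coeff t ?Z (\<eta> + unit_vec i) = vp ?a"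
      by (intro leading_imp_has_codegree[OF p]) auto
    then have "codeg t ?Z = \<eta> + unit_vec i" by (intro codeg_eqI) simp
    then have "codeg_normalize t ?Z = v powi (- ?a) * ?Z"
      using cd seed(4)[OF st(2)] by (simp add: codeg_normalize_def power_int_minus)
    also have "\<dots> = lincomb v Le (c \<circ> psi s t)"
      unfolding c(2) unfolding Le_def by (rule lincomb_reindex[OF bij])
    finally have norm: "codeg_normalize t ?Z = lincomb v Le (c \<circ> psi s t)" .
    show ?thesis
    proof (intro exI[of _ "Abs_poly_mapping (c \<circ> psi s t)"] conjI ballI allI impI)
      fix \<eta>' assume "\<eta>' \<in> Poly_Mapping.keys (Abs_poly_mapping (c \<circ> psi s t))"
      then have "dom_le s (psi s t \<eta>') (psi s t (\<eta> + unit_vec i))"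
        using c(1) by (simp add: in_keys_iff look tri_coeffs_def)
      then show "dom_le t (\<eta> + unit_vec i) \<eta>'" by (simp only: dom_le_psi[OF p])
    next
      show "Poly_Mapping.lookup (Abs_poly_mapping (c \<circ> psi s t)) (\<eta> + unit_vec i) = 1"
        using c(1) by (simp add: look tri_coeffs_def)
    next
      fix \<eta>' assume "dom_less t (\<eta> + unit_vec i) \<eta>'"
      then have "psi s t \<eta>' \<noteq> psi s t (\<eta> + unit_vec i)"
        using bij_is_inj[OF bij] by (auto simp: dom_less_def dest: injD)
      then show "Poly_Mapping.lookup (Abs_poly_mapping (c \<circ> psi s t)) \<eta>' \<in> laurent_m"
        using c(1) by (simp add: look tri_coeffs_def)
    next
      show "codeg_normalize t ?Z = (\<Sum>\<eta>'\<in>Poly_Mapping.keys (Abs_poly_mapping (c \<circ> psi s t)).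
          scale (vpar t) (Poly_Mapping.lookup (Abs_poly_mapping (c \<circ> psi s t)) \<eta>') (Le \<eta>'))"
        unfolding norm by (simp add: lincomb_def scale_def seed(4)[OF st(2)] Poly_Mapping.keys.rep_eq look)
    qed
  qed
  have "degree_triangular t A L"
    using triangular[OF st(2)] by (simp add: triangular_basis_def)
  then show ?thesis
    unfolding codegree_triangular_def degree_triangular_def using range cop mult by blast
qed

text \<open>Following a path from \<open>t0[1]\<close> back to \<open>t0\<close>, and then on to any other seed, the pair
  \<open>(t0, t0[1])\<close> is mutated into a pair ending at that seed.\<close>

lemma shift_pair_exists:
  assumes "t \<in> S"
  obtains s \<sigma> where "shift_pair s t \<sigma>"
proof -
  obtain s1 where s1: "shifted t0 s1"
    using triangular[OF seeds_refl] by (auto simp: triangular_basis_def)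
  then have s1S: "s1 \<in> S" by (simp add: shifted_def)
  obtain \<sigma> where \<sigma>: "shift_pair t0 s1 \<sigma>"
    using s1 shifted_iff_shift_pair[OF seeds_refl s1S] by blast
  have "t \<in> seeds s1"
    by (rule seeds_trans[OF seed(1)[OF s1S] seeds_sym[OF t0 s1S] assms])
  then obtain w where w: "set w \<subseteq> U" "t = mutate_seq w s1"
    by (auto simp: seeds_def seed(3)[OF s1S])
  obtain s where "shift_pair s (mutate_seq w s1) \<sigma>"
    by (rule shift_pair_mutate_seq[OF \<sigma> w(1)]) (blast intro: that)
  then show ?thesis using that unfolding w(2) by blast
qed

text \<open>The partner \<open>s\<close> plays the role of \<open>t[-1]\<close>; its cluster
  monomials are in \<open>L\<close> because \<open>L\<close> is triangular with respect to every
  reachable seed.\<close>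

lemma double_triangular_basis:
  assumes "t \<in> S"
  shows "double_triangular_basis t A L"
proof -
  obtain s \<sigma> where p: "shift_pair s t \<sigma>"
    using shift_pair_exists[OF assms] .
  have s: "s \<in> S" using p by (simp add: shift_pair_def)
  have "shifted s t" using p shifted_iff_shift_pair[OF s assms] by blast
  moreover have "s \<in> seeds t"
    by (rule seeds_trans[OF seed(1)[OF assms] seeds_sym[OF t0 assms] s])
  moreover have "cluster_monomials s \<subseteq> L"
    using triangular[OF s] by (simp add: triangular_basis_def)
  ultimately show ?thesis
    using triangular[OF assms] codegree_triangular_shift_pair[OF p]
    unfolding double_triangular_basis_def triangular_basis_def by blast
qed

lemma compatibly_copointed_basis: "compatibly_copointed_basis t0 L"
proof -
  obtain s \<sigma> where p: "shift_pair s t0 \<sigma>"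
    using shift_pair_exists[OF seeds_refl] .
  have s: "s \<in> S" using p by (simp add: shift_pair_def)
  note bij = bij_psi[OF p]
  have ex: "\<exists>\<eta>. pointed s (psi s t0 \<eta>) Z" if "Z \<in> L" for Z
    using pointed_ex[OF s that] bij_is_surj[OF bij] by (metis surjD)
  have "compatibly_copointed t0 Z" if Z: "Z \<in> L" for Z
  proof -
    obtain \<eta> where \<eta>: "pointed s (psi s t0 \<eta>) Z" using ex[OF Z] by blast
    have "copointed (mutate_seq w t0) (trop_op_seq w t0 \<eta>) Z" if w: "set w \<subseteq> U" for w
    proof -
      obtain s' where s': "shift_pair s' (mutate_seq w t0) \<sigma>"
        "\<And>Z \<eta>. Z \<in> L \<Longrightarrow> pointed s (psi s t0 \<eta>) Z \<Longrightarrow>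
          pointed s' (psi s' (mutate_seq w t0) (trop_op_seq w t0 \<eta>)) Z"
        by (rule shift_pair_mutate_seq[OF p w]) (blast intro: that)
      show ?thesis
        by (rule shift_pair_copointed[OF s'(1) Z s'(2)[OF Z \<eta>]])
    qed
    moreover have "Z \<in> upper_cluster_algebra t0"
      unfolding upper_cluster_algebra_def using pointed_ex[OF _ Z] pointed_LP by blast
    moreover have "copointed t0 \<eta> Z" by (rule shift_pair_copointed[OF p Z \<eta>])
    ultimately show ?thesis unfolding compatibly_copointed_def by blast
  qed
  \<comment> \<open>The codegree determines the degree in \<open>s\<close> through
    \<open>psi\<close>, and that degree determines the basis element.\<close>
  moreover have "inj_on (codeg t0) L"
  proof (rule inj_onI)
    fix Z Z' assume Z: "Z \<in> L" "Z' \<in> L" and eq: "codeg t0 Z = codeg t0 Z'"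
    obtain \<eta> \<eta>' where \<eta>: "pointed s (psi s t0 \<eta>) Z" "pointed s (psi s t0 \<eta>') Z'"
      using ex Z by blast
    have "codeg t0 Z = \<eta>" "codeg t0 Z' = \<eta>'"
      using shift_pair_copointed[OF p Z(1) \<eta>(1)] shift_pair_copointed[OF p Z(2) \<eta>(2)]
      by (auto simp: copointed_def intro: codeg_eqI)
    then show "Z = Z'" using pointed_inj[OF s Z \<eta>(1)] \<eta>(2) eq by simp
  qed
  ultimately show ?thesis unfolding compatibly_copointed_basis_def by blast
qed

end

theorem theorem1p5:
  fixes t :: "('i::finite, 'f::division_ring) qseed"
    and A L :: "'f set"
  assumes "quantum_seed t"
    and "injective_reachable t"
    and "kk_subalgebra (vpar t) A"
    and "A \<subseteq> upper_cluster_algebra t"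
    and "common_triangular_basis t A L"
  shows "(\<forall>t'\<in>seeds t. double_triangular_basis t' A L) \<and> compatibly_copointed_basis t L"
proof -
  obtain d where d: "compatible_with t d"
    using quantum_seed_compatible_with[OF assms(1)] .
  interpret common_triangular t A L d
    by unfold_locales (use assms d in auto)
  show ?thesis
    using double_triangular_basis compatibly_copointed_basis by blast
qed

end
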